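(* Let $G$ be a 4-dimensional Lie group equipped with a left-invariant Riemannian metric, and let $\mathfrak{g}$ be its Lie algebra with the induced inner product. Let $\mathcal{F}$ be a left-invariant conformal foliation on $G$ with minimal leaves of codimension $2$. Then there is an orthonormal basis $\{X,Y,Z,W\}$ of $\mathfrak{g}$ such that $\mathcal{F}$ is the foliation tangent to the left-invariant distribution $\mathcal{V}$ generated by $Z,W$, and such that the Lie brackets of $\mathfrak{g}$ are given by one of the following twenty families $\mathfrak{g}_1,\dots,\mathfrak{g}_{20}$, where all parameters are real and satisfy the indicated conditions, and where brackets of basis elements that are not listed (and do not follow from the listed ones by antisymmetry) are zero. $\mathfrak{g}_1(\lambda,r,w_1,w_2)$, $\lambda\ne 0$, $r\neq 0$: $[W,Z]=\lambda W$, $[Z,X]=w_1W$, $[Z,Y]=w_2W$, $\lambda[Y,X]=\lambda rX+rw_1W$. $\mathfrak{g}_2(\lambda,\alpha,\beta,w_1,w_2)$, $\lambda\neq 0$, $(\lambda-\alpha)^2+\beta^2\neq 0$: $[W,Z]=\lambda W$, $[Z,X]=\alpha X+\beta Y+w_1W$, $[Z,Y]=-\beta X+\alpha Y+w_2W$. $\mathfrak{g}_3(\alpha,\beta,w_1,w_2,\theta_2)$, $\alpha\neq 0$, $\theta_2\neq 0$: $[W,Z]=-2\alpha W$, $[Z,X]=\alpha X+\beta Y+w_1W$, $[Z,Y]=-\beta X+\alpha Y+w_2W$, $[Y,X]=\theta_2W$. $\mathfrak{g}_4(\lambda,z_2,w_1,w_2)$, $\lambda\neq 0$: $[W,Z]=\lambda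 W$, $[Z,X]=\lambda X+w_1W$, $[Z,Y]=\lambda Y+z_2Z+w_2W$, $[W,Y]=-z_2W$, $\lambda[Y,X]=-z_2\lambda X-z_2w_1W$. $\mathfrak{g}_5(\alpha,a,\beta,b,r)$, $r\neq 0$, $a\beta-\alpha b\neq 0$: $[Z,X]=\alpha X+\beta Y+\frac{r(\beta b-\alpha a)}{2(a\beta-\alpha b)}Z+\frac{r(\alpha^2-\beta^2)}{2(a\beta-\alpha b)}W$, $[Z,Y]=-\beta X+\alpha Y+\frac{r(\alpha b+\beta a)}{2(a\beta-\alpha b)}Z-\frac{r\alpha\beta}{a\beta-\alpha b}W$, $[W,X]=aX+bY+\frac{r(b^2-a^2)}{2(a\beta-\alpha b)}Z+\frac{r(\alpha a-\beta b)}{2(a\beta-\alpha b)}W$, $[W,Y]=-bX+aY+\frac{rab}{a\beta-\alpha b}Z-\frac{r(\alpha b+\beta a)}{2(a\beta-\alpha b)}W$, $[Y,X]=rX-\frac{ar^2}{2(a\beta-\alpha b)}Z+\frac{\alpha r^2}{2(a\beta-\alpha b)}W$. $\mathfrak{g}_6(z_1,z_2,z_3,r,\theta_1,\theta_2)$, $r\neq 0$, $z_1\neq 0$, $z_3\neq 0$: $[Z,X]=z_1Z-\frac{z_1^2}{z_3}W$, $[Z,Y]=z_2Z+\frac{z_1(r-2z_2)}{2z_3}W$, $[W,X]=z_3Z-z_1W$, $[W,Y]=\frac{z_3(r+2z_2)}{2z_1}Z-z_2W$, $[Y,X]=rX+\theta_1Z+\theta_2W$. $\mathfrak{g}_7(z_2,w_1,w_2,\theta_1,\theta_2)$,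 $z_2\neq 0$, $w_1\neq 0$: $[Z,X]=w_1W$, $[Z,Y]=z_2Z+w_2W$, $[W,Y]=-z_2W$, $[Y,X]=2z_2X+\theta_1Z+\theta_2W$. $\mathfrak{g}_8(z_2,z_4,w_2,r,\theta_1,\theta_2)$, $r\neq 0$: $[Z,Y]=z_2Z+w_2W$, $[W,Y]=z_4Z-z_2W$, $[Y,X]=rX+\theta_1Z+\theta_2W$. $\mathfrak{g}_9(z_2,z_3,z_4,\theta_1,\theta_2)$, $z_2\neq 0$: $[Z,Y]=z_2Z$, $[W,X]=z_3Z$, $[W,Y]=z_4Z-z_2W$, $[Y,X]=-2z_2X+\theta_1Z+\theta_2W$. $\mathfrak{g}_{10}(\alpha,a,\beta,b)$, $\alpha b-a\beta\neq 0$: $[Z,X]=\alpha X+\beta Y$, $[Z,Y]=-\beta X+\alpha Y$, $[W,X]=aX+bY$, $[W,Y]=-bX+aY$. $\mathfrak{g}_{11}(z_1,z_2,z_3,w_1,\theta_1,\theta_2)$, $z_1\neq 0$: $[Z,X]=z_1Z+w_1W$, $[Z,Y]=z_2Z+\frac{z_2w_1}{z_1}W$, $[W,X]=z_3Z-z_1W$, $[W,Y]=\frac{z_2z_3}{z_1}Z-z_2W$, $[Y,X]=\theta_1Z+\theta_2W$. $\mathfrak{g}_{12}(z_3,w_1,w_2,\theta_1,\theta_2)$, $w_1\neq 0$: $[Z,X]=w_1W$, $[Z,Y]=w_2W$, $[W,X]=z_3Z$, $[W,Y]=\frac{z_3w_2}{w_1}Z$, $[Y,X]=\theta_1Z+\theta_2W$.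 $\mathfrak{g}_{13}(z_3,z_4,\theta_1,\theta_2)$, $z_3\neq 0$: $[W,X]=z_3Z$, $[W,Y]=z_4Z$, $[Y,X]=\theta_1Z+\theta_2W$. $\mathfrak{g}_{14}(z_2,z_4,w_2,\theta_1,\theta_2)$: $[Z,Y]=z_2Z+w_2W$, $[W,Y]=z_4Z-z_2W$, $[Y,X]=\theta_1Z+\theta_2W$. $\mathfrak{g}_{15}(\alpha,w_1,w_2)$, $\alpha\neq 0$: $[Z,X]=\alpha X+w_1W$, $[Z,Y]=\alpha Y+w_2W$. $\mathfrak{g}_{16}(\beta,w_1,w_2,\theta_1,\theta_2)$, $\beta\neq 0$: $[Z,X]=\beta Y+w_1W$, $[Z,Y]=-\beta X+w_2W$, $[Y,X]=\theta_1Z+\theta_2W$. $\mathfrak{g}_{17}(\alpha,a,w_1,w_2)$, $\alpha\neq 0$, $a\neq 0$: $[Z,X]=\alpha X-\frac{aw_1}{\alpha}Z+w_1W$, $[Z,Y]=\alpha Y-\frac{aw_2}{\alpha}Z+w_2W$, $[W,X]=aX-\frac{a^2w_1}{\alpha^2}Z+\frac{aw_1}{\alpha}W$, $[W,Y]=aY-\frac{a^2w_2}{\alpha^2}Z+\frac{aw_2}{\alpha}W$. $\mathfrak{g}_{18}(\beta,b,z_3,z_4,\theta_1,\theta_2)$, $\beta\neq 0$, $b\neq 0$: $[Z,X]=\beta Y+\frac{\beta z_3}{b}Z-\frac{\beta^2z_3}{b^2}W$, $[Z,Y]=-\beta X+\frac{\beta z_4}{b}Z-\frac{\beta^2z_4}{b^2}W$,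 $[W,X]=bY+z_3Z-\frac{\beta z_3}{b}W$, $[W,Y]=-bX+z_4Z-\frac{\beta z_4}{b}W$, $[Y,X]=\theta_1Z+\theta_2W$. $\mathfrak{g}_{19}(\alpha,\beta,w_1,w_2)$, $\alpha\neq 0$, $\beta\neq 0$: $[Z,X]=\alpha X+\beta Y+w_1W$, $[Z,Y]=-\beta X+\alpha Y+w_2W$. $\mathfrak{g}_{20}(\alpha,a,\beta,w_1,w_2)$, $\alpha\neq 0$, $a\neq 0$, $\beta\neq 0$: $[Z,X]=\alpha X+\beta Y-\frac{aw_1}{\alpha}Z+w_1W$, $[Z,Y]=-\beta X+\alpha Y-\frac{aw_2}{\alpha}Z+w_2W$, $[W,X]=aX+\frac{\beta a}{\alpha}Y-\frac{a^2w_1}{\alpha^2}Z+\frac{a}{\alpha}w_1W$, $[W,Y]=-\frac{\beta a}{\alpha}X+aY-\frac{a^2w_2}{\alpha^2}Z+\frac{a}{\alpha}w_2W$.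
   Context: The Lie algebra $\mathfrak{g}$ of $G$ is identified with the left-invariant vector fields on $G$. Let $(M,g)$ be a Riemannian manifold with Levi-Civita connection $\nabla$, $\mathcal{V}$ an involutive distribution on $M$ and $\mathcal{H}$ its orthogonal complement; $\mathcal{V}$ and $\mathcal{H}$ also denote the orthogonal projections of $TM$ onto these subbundles, and $\mathcal{F}$ is the foliation tangent to $\mathcal{V}$. The second fundamental forms are $B^{\mathcal{V}}(U,V)=\frac12\mathcal{H}(\nabla_UV+\nabla_VU)$ for $U,V\in\mathcal{V}$ and $B^{\mathcal{H}}(X,Y)=\frac12\mathcal{V}(\nabla_XY+\nabla_YX)$ for $X,Y\in\mathcal{H}$. The foliation $\mathcal{F}$ is conformal if there is a vector field $V\in\mathcal{V}$ with $B^{\mathcal{H}}=g\otimes V$ on $\mathcal{H}$, and it is minimal (has minimal leaves) if $\mathrm{trace}\,B^{\mathcal{V}}=0$. A foliation on a Lie group $G$ is left-invariant if its tangent distribution $\mathcal{V}$ is left-invariant, i.e. is generated by left-invariant vector fields. Codimension 2 means $\dim\mathcal{H}=2$. *)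

theory Defs
  imports "HOL-Analysis.Analysis" "HOL-Library.Function_Algebras"
begin

section \<open>Functions as a real vector space\<close>

instantiation "fun" :: (type, scaleR) scaleR
begin

definition scaleR_fun :: "real \<Rightarrow> ('a \<Rightarrow> 'b) \<Rightarrow> 'a \<Rightarrow> 'b" where
  "scaleR_fun c f = (\<lambda>x. c *\<^sub>R f x)"

instance ..

end

instance "fun" :: (type, real_vector) real_vector
  by standard
    (simp_all add: fun_eq_iff scaleR_fun_def plus_fun_def scaleR_add_right scaleR_add_left)


section \<open>Smooth manifolds\<close>

primrec Ck_on :: "nat \<Rightarrow> 'a::real_normed_vector set \<Rightarrow> ('a \<Rightarrow> 'b::real_normed_vector) \<Rightarrow> bool" where
  "Ck_on 0 S f \<longleftrightarrow> continuous_on S f"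
| "Ck_on (Suc k) S f \<longleftrightarrow>
     (\<forall>x\<in>S. f differentiable (at x)) \<and> (\<forall>v. Ck_on k S (\<lambda>x. frechet_derivative f (at x) v))"

text \<open>Only used for open \<open>S\<close>.\<close>

definition smooth_on :: "'a::real_normed_vector set \<Rightarrow> ('a \<Rightarrow> 'b::real_normed_vector) \<Rightarrow> bool" where
  "smooth_on S f \<longleftrightarrow> (\<forall>k. Ck_on k S f)"

type_synonym ('m, 'e) chart = "'m set \<times> ('m \<Rightarrow> 'e)"
type_synonym ('m, 'e) atlas = "('m, 'e) chart set"

definition smooth_manifold ::
  "('m::{t2_space,second_countable_topology}, 'e::euclidean_space) atlas \<Rightarrow> bool" where
  "smooth_manifold A \<longleftrightarrow>
     (\<forall>(U, \<phi>)\<in>A. open U \<and> open (\<phi> ` U) \<and> homeomorphism U (\<phi> ` U) \<phi> (inv_into U \<phi>)) \<and>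
     (\<Union>(U, \<phi>)\<in>A. U) = UNIV \<and>
     (\<forall>(U, \<phi>)\<in>A. \<forall>(V, \<psi>)\<in>A. smooth_on (\<phi> ` (U \<inter> V)) (\<psi> \<circ> inv_into U \<phi>))"

definition smooth_map ::
  "('m::topological_space, 'e::real_normed_vector) atlas \<Rightarrow>
   ('n::topological_space, 'd::real_normed_vector) atlas \<Rightarrow> ('m \<Rightarrow> 'n) \<Rightarrow> bool" where
  "smooth_map A B F \<longleftrightarrow>
     continuous_on UNIV F \<and>
     (\<forall>(U, \<phi>)\<in>A. \<forall>(V, \<psi>)\<in>B. smooth_on (\<phi> ` (U \<inter> F -` V)) (\<psi> \<circ> F \<circ> inv_into U \<phi>))"

definition prod_atlas ::
  "('m, 'e) atlas \<Rightarrow> ('n, 'd) atlas \<Rightarrow> ('m \<times> 'n, 'e \<times> 'd) atlas" where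
  "prod_atlas A B = {(U \<times> V, map_prod \<phi> \<psi>) | U \<phi> V \<psi>. (U, \<phi>) \<in> A \<and> (V, \<psi>) \<in> B}"

definition smooth_functions ::
  "('m::topological_space, 'e::real_normed_vector) atlas \<Rightarrow> ('m \<Rightarrow> real) set" where
  "smooth_functions A = {f. smooth_map A {(UNIV, id)} f}"


section \<open>Tangent vectors and vector fields\<close>

text \<open>
  Tangent vectors at \<open>p\<close> are the derivations at \<open>p\<close> of the algebra of smooth functions. As functions
  on the whole type they are made unique by the value 0 outside the smooth functions.
\<close>

type_synonym 'm tvec = "('m \<Rightarrow> real) \<Rightarrow> real"
type_synonym 'm vfield = "'m \<Rightarrow> 'm tvec"

definition tangent_space ::
  "('m::topological_space, 'e::real_normed_vector) atlas \<Rightarrow> 'm \<Rightarrow> 'm tvec set" where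
  "tangent_space A p =
     {v. (\<forall>f\<in>smooth_functions A. \<forall>h\<in>smooth_functions A.
            v (f + h) = v f + v h \<and> v (f * h) = f p * v h + h p * v f) \<and>
         (\<forall>c. \<forall>f\<in>smooth_functions A. v (c *\<^sub>R f) = c * v f) \<and>
         (\<forall>f. f \<notin> smooth_functions A \<longrightarrow> v f = 0)}"

definition differential ::
  "('m::topological_space, 'e::real_normed_vector) atlas \<Rightarrow>
   ('n::topological_space, 'd::real_normed_vector) atlas \<Rightarrow> ('m \<Rightarrow> 'n) \<Rightarrow> 'm tvec \<Rightarrow> 'n tvec" where
  "differential A B F v = (\<lambda>f. if f \<in> smooth_functions B then v (f \<circ> F) else 0)"

definition vector_fields ::
  "('m::topological_space, 'e::real_normed_vector) atlas \<Rightarrow> 'm vfield set" where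
  "vector_fields A =
     {X. (\<forall>p. X p \<in> tangent_space A p) \<and>
         (\<forall>f\<in>smooth_functions A. (\<lambda>p. X p f) \<in> smooth_functions A)}"

definition fscale :: "('m \<Rightarrow> real) \<Rightarrow> 'm vfield \<Rightarrow> 'm vfield" where
  "fscale f X = (\<lambda>p. f p *\<^sub>R X p)"

text \<open>\<open>[X, Y] f = X (Y f) - Y (X f)\<close>. For non-smooth \<open>f\<close> both \<open>X f\<close> and \<open>Y f\<close> are 0, so
  the bracket is 0 there, too.\<close>

definition lie_bracket :: "'m vfield \<Rightarrow> 'm vfield \<Rightarrow> 'm vfield" where
  "lie_bracket X Y = (\<lambda>p f. X p (\<lambda>q. Y q f) - Y p (\<lambda>q. X q f))"


section \<open>Riemannian metrics and the Levi-Civita connection\<close>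

type_synonym 'm metric = "'m \<Rightarrow> 'm tvec \<Rightarrow> 'm tvec \<Rightarrow> real"
type_synonym 'm connection = "'m vfield \<Rightarrow> 'm vfield \<Rightarrow> 'm vfield"

definition riemannian_metric ::
  "('m::topological_space, 'e::real_normed_vector) atlas \<Rightarrow> 'm metric \<Rightarrow> bool" where
  "riemannian_metric A g \<longleftrightarrow>
     (\<forall>p. \<forall>u\<in>tangent_space A p. \<forall>v\<in>tangent_space A p.
        g p u v = g p v u \<and> (u \<noteq> 0 \<longrightarrow> g p u u > 0) \<and>
        (\<forall>w\<in>tangent_space A p. g p (u + v) w = g p u w + g p v w) \<and>
        (\<forall>c. g p (c *\<^sub>R u) v = c * g p u v)) \<and>
     (\<forall>X\<in>vector_fields A. \<forall>Y\<in>vector_fields A. (\<lambda>p. g p (X p) (Y p)) \<in> smooth_functions A)"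

definition affine_connection ::
  "('m::topological_space, 'e::real_normed_vector) atlas \<Rightarrow> 'm connection \<Rightarrow> bool" where
  "affine_connection A nab \<longleftrightarrow>
     (\<forall>X\<in>vector_fields A. \<forall>Y\<in>vector_fields A.
        nab X Y \<in> vector_fields A \<and>
        (\<forall>X'\<in>vector_fields A. nab (X + X') Y = nab X Y + nab X' Y) \<and>
        (\<forall>Y'\<in>vector_fields A. nab X (Y + Y') = nab X Y + nab X Y') \<and>
        (\<forall>f\<in>smooth_functions A.
           nab (fscale f X) Y = fscale f (nab X Y) \<and>
           nab X (fscale f Y) = fscale (\<lambda>p. X p f) Y + fscale f (nab X Y)))"

definition levi_civita ::
  "('m::topological_space, 'e::real_normed_vector) atlas \<Rightarrow> 'm metric \<Rightarrow> 'm connection \<Rightarrow> bool" where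
  "levi_civita A g nab \<longleftrightarrow>
     affine_connection A nab \<and>
     (\<forall>X\<in>vector_fields A. \<forall>Y\<in>vector_fields A. nab X Y - nab Y X = lie_bracket X Y) \<and>
     (\<forall>X\<in>vector_fields A. \<forall>Y\<in>vector_fields A. \<forall>Z\<in>vector_fields A. \<forall>p.
        X p (\<lambda>q. g q (Y q) (Z q)) = g p (nab X Y p) (Z p) + g p (Y p) (nab X Z p))"


section \<open>Distributions and foliations\<close>

type_synonym 'm distribution = "'m \<Rightarrow> 'm tvec set"

definition sections ::
  "('m::topological_space, 'e::real_normed_vector) atlas \<Rightarrow> 'm distribution \<Rightarrow> 'm vfield set" where
  "sections A D = {X \<in> vector_fields A. \<forall>p. X p \<in> D p}"

definition smooth_distribution ::
  "('m::topological_space, 'e::real_normed_vector) atlas \<Rightarrow> 'm distribution \<Rightarrow> bool" where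
  "smooth_distribution A D \<longleftrightarrow>
     (\<forall>p. subspace (D p) \<and> D p \<subseteq> tangent_space A p) \<and>
     (\<exists>k. \<forall>p. dim (D p) = k) \<and>
     (\<forall>p. \<forall>v\<in>D p. \<exists>X\<in>sections A D. X p = v)"

text \<open>A foliation is represented by its tangent distribution.\<close>

definition foliation ::
  "('m::topological_space, 'e::real_normed_vector) atlas \<Rightarrow> 'm distribution \<Rightarrow> bool" where
  "foliation A D \<longleftrightarrow>
     smooth_distribution A D \<and>
     (\<forall>X\<in>sections A D. \<forall>Y\<in>sections A D. lie_bracket X Y \<in> sections A D)"

definition orth_complement ::
  "('m::topological_space, 'e::real_normed_vector) atlas \<Rightarrow> 'm metric \<Rightarrow> 'm distribution \<Rightarrow>
   'm distribution" where
  "orth_complement A g D = (\<lambda>p. {v \<in> tangent_space A p. \<forall>w\<in>D p. g p v w = 0})"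

definition orth_proj :: "'m metric \<Rightarrow> 'm distribution \<Rightarrow> 'm \<Rightarrow> 'm tvec \<Rightarrow> 'm tvec" where
  "orth_proj g N p v = (THE w. w \<in> N p \<and> (\<forall>n\<in>N p. g p (v - w) n = 0))"

text \<open>The second fundamental form, evaluated on sections of a distribution whose orthogonal
  complement is \<open>N\<close>.\<close>

definition second_fundamental_form ::
  "'m metric \<Rightarrow> 'm connection \<Rightarrow> 'm distribution \<Rightarrow> 'm vfield \<Rightarrow> 'm vfield \<Rightarrow> 'm vfield" where
  "second_fundamental_form g nab N U V = (\<lambda>p. (1/2) *\<^sub>R orth_proj g N p (nab U V p + nab V U p))"

definition conformal_foliation ::
  "('m::topological_space, 'e::real_normed_vector) atlas \<Rightarrow> 'm metric \<Rightarrow> 'm connection \<Rightarrow>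
   'm distribution \<Rightarrow> bool" where
  "conformal_foliation A g nab D \<longleftrightarrow>
     foliation A D \<and>
     (\<exists>V\<in>sections A D.
        \<forall>X\<in>sections A (orth_complement A g D). \<forall>Y\<in>sections A (orth_complement A g D).
        second_fundamental_form g nab D X Y = fscale (\<lambda>p. g p (X p) (Y p)) V)"

definition orthonormal_basis ::
  "('v::real_vector \<Rightarrow> 'v \<Rightarrow> real) \<Rightarrow> 'v set \<Rightarrow> 'v list \<Rightarrow> bool" where
  "orthonormal_basis ip S vs \<longleftrightarrow>
     span (set vs) = S \<and>
     (\<forall>i<length vs. \<forall>j<length vs. ip (vs ! i) (vs ! j) = (if i = j then 1 else 0))"

text \<open>The trace at \<open>p\<close> is computed with sections whose values at \<open>p\<close> form an orthonormal basis; the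
  second fundamental form is tensorial, so the choice of these sections does not matter.\<close>

definition minimal_foliation ::
  "('m::topological_space, 'e::real_normed_vector) atlas \<Rightarrow> 'm metric \<Rightarrow> 'm connection \<Rightarrow>
   'm distribution \<Rightarrow> bool" where
  "minimal_foliation A g nab D \<longleftrightarrow>
     foliation A D \<and>
     (\<forall>p Es. set Es \<subseteq> sections A D \<and> orthonormal_basis (g p) (D p) (map (\<lambda>E. E p) Es) \<longrightarrow>
        (\<Sum>E\<leftarrow>Es. second_fundamental_form g nab (orth_complement A g D) E E p) = 0)"


section \<open>Lie groups\<close>

definition lie_group ::
  "('m::{t2_space,second_countable_topology}, 'e::euclidean_space) atlas \<Rightarrow>
   ('m \<Rightarrow> 'm \<Rightarrow> 'm) \<Rightarrow> 'm \<Rightarrow> ('m \<Rightarrow> 'm) \<Rightarrow> bool" where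
  "lie_group A mul e iv \<longleftrightarrow>
     smooth_manifold A \<and> group mul e iv \<and>
     smooth_map (prod_atlas A A) A (\<lambda>(x, y). mul x y) \<and> smooth_map A A iv"

definition left_invariant_fields ::
  "('m::topological_space, 'e::real_normed_vector) atlas \<Rightarrow> ('m \<Rightarrow> 'm \<Rightarrow> 'm) \<Rightarrow> 'm vfield set" where
  "left_invariant_fields A mul =
     {X \<in> vector_fields A. \<forall>a p. X (mul a p) = differential A A (mul a) (X p)}"

definition left_invariant_metric ::
  "('m::topological_space, 'e::real_normed_vector) atlas \<Rightarrow> ('m \<Rightarrow> 'm \<Rightarrow> 'm) \<Rightarrow> 'm metric \<Rightarrow> bool" where
  "left_invariant_metric A mul g \<longleftrightarrow>
     riemannian_metric A g \<and>
     (\<forall>a p. \<forall>u\<in>tangent_space A p. \<forall>v\<in>tangent_space A p.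
        g (mul a p) (differential A A (mul a) u) (differential A A (mul a) v) = g p u v)"

definition generated_distribution :: "'m vfield set \<Rightarrow> 'm distribution" where
  "generated_distribution S = (\<lambda>p. span ((\<lambda>X. X p) ` S))"

definition left_invariant_distribution ::
  "('m::topological_space, 'e::real_normed_vector) atlas \<Rightarrow> ('m \<Rightarrow> 'm \<Rightarrow> 'm) \<Rightarrow> 'm distribution \<Rightarrow> bool" where
  "left_invariant_distribution A mul D \<longleftrightarrow>
     (\<exists>S\<subseteq>left_invariant_fields A mul. D = generated_distribution S)"

definition induced_inner_product :: "'m metric \<Rightarrow> 'm \<Rightarrow> 'm vfield \<Rightarrow> 'm vfield \<Rightarrow> real" where
  "induced_inner_product g e X Y = g e (X e) (Y e)"


section \<open>The families of Lie brackets\<close>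

text \<open>The parameter called \<open>\<kappa>\<close> is usually written as a lambda.\<close>

definition lie_g1 ::
  "('v::real_vector \<Rightarrow> 'v \<Rightarrow> 'v) \<Rightarrow> 'v \<Rightarrow> 'v \<Rightarrow> 'v \<Rightarrow> 'v \<Rightarrow>
    real \<Rightarrow> real \<Rightarrow> real \<Rightarrow> real \<Rightarrow> bool" where
  "lie_g1 br X Y Z W \<kappa> r w1 w2 \<longleftrightarrow>
     \<kappa> \<noteq> 0 \<and> r \<noteq> 0 \<and>
     br W Z = \<kappa> *\<^sub>R W \<and>
     br Z X = w1 *\<^sub>R W \<and>
     br Z Y = w2 *\<^sub>R W \<and>
     br W X = 0 \<and>
     br W Y = 0 \<and>
     \<kappa> *\<^sub>R br Y X = (\<kappa> * r) *\<^sub>R X + (r * w1) *\<^sub>R W"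

definition lie_g2 ::
  "('v::real_vector \<Rightarrow> 'v \<Rightarrow> 'v) \<Rightarrow> 'v \<Rightarrow> 'v \<Rightarrow> 'v \<Rightarrow> 'v \<Rightarrow>
    real \<Rightarrow> real \<Rightarrow> real \<Rightarrow> real \<Rightarrow> real \<Rightarrow> bool" where
  "lie_g2 br X Y Z W \<kappa> \<alpha> \<beta> w1 w2 \<longleftrightarrow>
     \<kappa> \<noteq> 0 \<and> (\<kappa> - \<alpha>)^2 + \<beta>^2 \<noteq> 0 \<and>
     br W Z = \<kappa> *\<^sub>R W \<and>
     br Z X = \<alpha> *\<^sub>R X + \<beta> *\<^sub>R Y + w1 *\<^sub>R W \<and>
     br Z Y = (- \<beta>) *\<^sub>R X + \<alpha> *\<^sub>R Y + w2 *\<^sub>R W \<and>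
     br W X = 0 \<and>
     br W Y = 0 \<and>
     br Y X = 0"

definition lie_g3 ::
  "('v::real_vector \<Rightarrow> 'v \<Rightarrow> 'v) \<Rightarrow> 'v \<Rightarrow> 'v \<Rightarrow> 'v \<Rightarrow> 'v \<Rightarrow>
    real \<Rightarrow> real \<Rightarrow> real \<Rightarrow> real \<Rightarrow> real \<Rightarrow> bool" where
  "lie_g3 br X Y Z W \<alpha> \<beta> w1 w2 \<theta>2 \<longleftrightarrow>
     \<alpha> \<noteq> 0 \<and> \<theta>2 \<noteq> 0 \<and>
     br W Z = (- 2 * \<alpha>) *\<^sub>R W \<and>
     br Z X = \<alpha> *\<^sub>R X + \<beta> *\<^sub>R Y + w1 *\<^sub>R W \<and>
     br Z Y = (- \<beta>) *\<^sub>R X + \<alpha> *\<^sub>R Y + w2 *\<^sub>R W \<and>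
     br W X = 0 \<and>
     br W Y = 0 \<and>
     br Y X = \<theta>2 *\<^sub>R W"

definition lie_g4 ::
  "('v::real_vector \<Rightarrow> 'v \<Rightarrow> 'v) \<Rightarrow> 'v \<Rightarrow> 'v \<Rightarrow> 'v \<Rightarrow> 'v \<Rightarrow>
    real \<Rightarrow> real \<Rightarrow> real \<Rightarrow> real \<Rightarrow> bool" where
  "lie_g4 br X Y Z W \<kappa> z2 w1 w2 \<longleftrightarrow>
     \<kappa> \<noteq> 0 \<and>
     br W Z = \<kappa> *\<^sub>R W \<and>
     br Z X = \<kappa> *\<^sub>R X + w1 *\<^sub>R W \<and>
     br Z Y = \<kappa> *\<^sub>R Y + z2 *\<^sub>R Z + w2 *\<^sub>R W \<and>
     br W X = 0 \<and>
     br W Y = (- z2) *\<^sub>R W \<and>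
     \<kappa> *\<^sub>R br Y X = (- z2 * \<kappa>) *\<^sub>R X - (z2 * w1) *\<^sub>R W"

definition lie_g5 ::
  "('v::real_vector \<Rightarrow> 'v \<Rightarrow> 'v) \<Rightarrow> 'v \<Rightarrow> 'v \<Rightarrow> 'v \<Rightarrow> 'v \<Rightarrow>
    real \<Rightarrow> real \<Rightarrow> real \<Rightarrow> real \<Rightarrow> real \<Rightarrow> bool" where
  "lie_g5 br X Y Z W \<alpha> a \<beta> b r \<longleftrightarrow>
     r \<noteq> 0 \<and> a * \<beta> - \<alpha> * b \<noteq> 0 \<and>
     br W Z = 0 \<and>
     br Z X = \<alpha> *\<^sub>R X + \<beta> *\<^sub>R Y
         + (r * (\<beta> * b - \<alpha> * a) / (2 * (a * \<beta> - \<alpha> * b))) *\<^sub>R Z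
         + (r * (\<alpha>^2 - \<beta>^2) / (2 * (a * \<beta> - \<alpha> * b))) *\<^sub>R W \<and>
     br Z Y = (- \<beta>) *\<^sub>R X + \<alpha> *\<^sub>R Y
         + (r * (\<alpha> * b + \<beta> * a) / (2 * (a * \<beta> - \<alpha> * b))) *\<^sub>R Z
         - (r * \<alpha> * \<beta> / (a * \<beta> - \<alpha> * b)) *\<^sub>R W \<and>
     br W X = a *\<^sub>R X + b *\<^sub>R Y
         + (r * (b^2 - a^2) / (2 * (a * \<beta> - \<alpha> * b))) *\<^sub>R Z
         + (r * (\<alpha> * a - \<beta> * b) / (2 * (a * \<beta> - \<alpha> * b))) *\<^sub>R W \<and>
     br W Y = (- b) *\<^sub>R X + a *\<^sub>R Y
         + (r * a * b / (a * \<beta> - \<alpha> * b)) *\<^sub>R Z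
         - (r * (\<alpha> * b + \<beta> * a) / (2 * (a * \<beta> - \<alpha> * b))) *\<^sub>R W \<and>
     br Y X = r *\<^sub>R X
         - (a * r^2 / (2 * (a * \<beta> - \<alpha> * b))) *\<^sub>R Z
         + (\<alpha> * r^2 / (2 * (a * \<beta> - \<alpha> * b))) *\<^sub>R W"

definition lie_g6 ::
  "('v::real_vector \<Rightarrow> 'v \<Rightarrow> 'v) \<Rightarrow> 'v \<Rightarrow> 'v \<Rightarrow> 'v \<Rightarrow> 'v \<Rightarrow>
    real \<Rightarrow> real \<Rightarrow> real \<Rightarrow> real \<Rightarrow> real \<Rightarrow> real \<Rightarrow> bool" where
  "lie_g6 br X Y Z W z1 z2 z3 r \<theta>1 \<theta>2 \<longleftrightarrow>
     r \<noteq> 0 \<and> z1 \<noteq> 0 \<and> z3 \<noteq> 0 \<and>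
     br W Z = 0 \<and>
     br Z X = z1 *\<^sub>R Z - (z1^2 / z3) *\<^sub>R W \<and>
     br Z Y = z2 *\<^sub>R Z + (z1 * (r - 2 * z2) / (2 * z3)) *\<^sub>R W \<and>
     br W X = z3 *\<^sub>R Z - z1 *\<^sub>R W \<and>
     br W Y = (z3 * (r + 2 * z2) / (2 * z1)) *\<^sub>R Z - z2 *\<^sub>R W \<and>
     br Y X = r *\<^sub>R X + \<theta>1 *\<^sub>R Z + \<theta>2 *\<^sub>R W"

definition lie_g7 ::
  "('v::real_vector \<Rightarrow> 'v \<Rightarrow> 'v) \<Rightarrow> 'v \<Rightarrow> 'v \<Rightarrow> 'v \<Rightarrow> 'v \<Rightarrow>
    real \<Rightarrow> real \<Rightarrow> real \<Rightarrow> real \<Rightarrow> real \<Rightarrow> bool" where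
  "lie_g7 br X Y Z W z2 w1 w2 \<theta>1 \<theta>2 \<longleftrightarrow>
     z2 \<noteq> 0 \<and> w1 \<noteq> 0 \<and>
     br W Z = 0 \<and>
     br Z X = w1 *\<^sub>R W \<and>
     br Z Y = z2 *\<^sub>R Z + w2 *\<^sub>R W \<and>
     br W X = 0 \<and>
     br W Y = (- z2) *\<^sub>R W \<and>
     br Y X = (2 * z2) *\<^sub>R X + \<theta>1 *\<^sub>R Z + \<theta>2 *\<^sub>R W"

definition lie_g8 ::
  "('v::real_vector \<Rightarrow> 'v \<Rightarrow> 'v) \<Rightarrow> 'v \<Rightarrow> 'v \<Rightarrow> 'v \<Rightarrow> 'v \<Rightarrow>
    real \<Rightarrow> real \<Rightarrow> real \<Rightarrow> real \<Rightarrow> real \<Rightarrow> real \<Rightarrow> bool" where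
  "lie_g8 br X Y Z W z2 z4 w2 r \<theta>1 \<theta>2 \<longleftrightarrow>
     r \<noteq> 0 \<and>
     br W Z = 0 \<and>
     br Z X = 0 \<and>
     br Z Y = z2 *\<^sub>R Z + w2 *\<^sub>R W \<and>
     br W X = 0 \<and>
     br W Y = z4 *\<^sub>R Z - z2 *\<^sub>R W \<and>
     br Y X = r *\<^sub>R X + \<theta>1 *\<^sub>R Z + \<theta>2 *\<^sub>R W"

definition lie_g9 ::
  "('v::real_vector \<Rightarrow> 'v \<Rightarrow> 'v) \<Rightarrow> 'v \<Rightarrow> 'v \<Rightarrow> 'v \<Rightarrow> 'v \<Rightarrow>
    real \<Rightarrow> real \<Rightarrow> real \<Rightarrow> real \<Rightarrow> real \<Rightarrow> bool" where
  "lie_g9 br X Y Z W z2 z3 z4 \<theta>1 \<theta>2 \<longleftrightarrow>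
     z2 \<noteq> 0 \<and>
     br W Z = 0 \<and>
     br Z X = 0 \<and>
     br Z Y = z2 *\<^sub>R Z \<and>
     br W X = z3 *\<^sub>R Z \<and>
     br W Y = z4 *\<^sub>R Z - z2 *\<^sub>R W \<and>
     br Y X = (- 2 * z2) *\<^sub>R X + \<theta>1 *\<^sub>R Z + \<theta>2 *\<^sub>R W"

definition lie_g10 ::
  "('v::real_vector \<Rightarrow> 'v \<Rightarrow> 'v) \<Rightarrow> 'v \<Rightarrow> 'v \<Rightarrow> 'v \<Rightarrow> 'v \<Rightarrow>
    real \<Rightarrow> real \<Rightarrow> real \<Rightarrow> real \<Rightarrow> bool" where
  "lie_g10 br X Y Z W \<alpha> a \<beta> b \<longleftrightarrow>
     \<alpha> * b - a * \<beta> \<noteq> 0 \<and>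
     br W Z = 0 \<and>
     br Z X = \<alpha> *\<^sub>R X + \<beta> *\<^sub>R Y \<and>
     br Z Y = (- \<beta>) *\<^sub>R X + \<alpha> *\<^sub>R Y \<and>
     br W X = a *\<^sub>R X + b *\<^sub>R Y \<and>
     br W Y = (- b) *\<^sub>R X + a *\<^sub>R Y \<and>
     br Y X = 0"

definition lie_g11 ::
  "('v::real_vector \<Rightarrow> 'v \<Rightarrow> 'v) \<Rightarrow> 'v \<Rightarrow> 'v \<Rightarrow> 'v \<Rightarrow> 'v \<Rightarrow>
    real \<Rightarrow> real \<Rightarrow> real \<Rightarrow> real \<Rightarrow> real \<Rightarrow> real \<Rightarrow> bool" where
  "lie_g11 br X Y Z W z1 z2 z3 w1 \<theta>1 \<theta>2 \<longleftrightarrow>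
     z1 \<noteq> 0 \<and>
     br W Z = 0 \<and>
     br Z X = z1 *\<^sub>R Z + w1 *\<^sub>R W \<and>
     br Z Y = z2 *\<^sub>R Z + (z2 * w1 / z1) *\<^sub>R W \<and>
     br W X = z3 *\<^sub>R Z - z1 *\<^sub>R W \<and>
     br W Y = (z2 * z3 / z1) *\<^sub>R Z - z2 *\<^sub>R W \<and>
     br Y X = \<theta>1 *\<^sub>R Z + \<theta>2 *\<^sub>R W"

definition lie_g12 ::
  "('v::real_vector \<Rightarrow> 'v \<Rightarrow> 'v) \<Rightarrow> 'v \<Rightarrow> 'v \<Rightarrow> 'v \<Rightarrow> 'v \<Rightarrow>
    real \<Rightarrow> real \<Rightarrow> real \<Rightarrow> real \<Rightarrow> real \<Rightarrow> bool" where
  "lie_g12 br X Y Z W z3 w1 w2 \<theta>1 \<theta>2 \<longleftrightarrow>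
     w1 \<noteq> 0 \<and>
     br W Z = 0 \<and>
     br Z X = w1 *\<^sub>R W \<and>
     br Z Y = w2 *\<^sub>R W \<and>
     br W X = z3 *\<^sub>R Z \<and>
     br W Y = (z3 * w2 / w1) *\<^sub>R Z \<and>
     br Y X = \<theta>1 *\<^sub>R Z + \<theta>2 *\<^sub>R W"

definition lie_g13 ::
  "('v::real_vector \<Rightarrow> 'v \<Rightarrow> 'v) \<Rightarrow> 'v \<Rightarrow> 'v \<Rightarrow> 'v \<Rightarrow> 'v \<Rightarrow>
    real \<Rightarrow> real \<Rightarrow> real \<Rightarrow> real \<Rightarrow> bool" where
  "lie_g13 br X Y Z W z3 z4 \<theta>1 \<theta>2 \<longleftrightarrow>
     z3 \<noteq> 0 \<and>
     br W Z = 0 \<and>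
     br Z X = 0 \<and>
     br Z Y = 0 \<and>
     br W X = z3 *\<^sub>R Z \<and>
     br W Y = z4 *\<^sub>R Z \<and>
     br Y X = \<theta>1 *\<^sub>R Z + \<theta>2 *\<^sub>R W"

definition lie_g14 ::
  "('v::real_vector \<Rightarrow> 'v \<Rightarrow> 'v) \<Rightarrow> 'v \<Rightarrow> 'v \<Rightarrow> 'v \<Rightarrow> 'v \<Rightarrow>
    real \<Rightarrow> real \<Rightarrow> real \<Rightarrow> real \<Rightarrow> real \<Rightarrow> bool" where
  "lie_g14 br X Y Z W z2 z4 w2 \<theta>1 \<theta>2 \<longleftrightarrow>
     br W Z = 0 \<and>
     br Z X = 0 \<and>
     br Z Y = z2 *\<^sub>R Z + w2 *\<^sub>R W \<and>
     br W X = 0 \<and>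
     br W Y = z4 *\<^sub>R Z - z2 *\<^sub>R W \<and>
     br Y X = \<theta>1 *\<^sub>R Z + \<theta>2 *\<^sub>R W"

definition lie_g15 ::
  "('v::real_vector \<Rightarrow> 'v \<Rightarrow> 'v) \<Rightarrow> 'v \<Rightarrow> 'v \<Rightarrow> 'v \<Rightarrow> 'v \<Rightarrow>
    real \<Rightarrow> real \<Rightarrow> real \<Rightarrow> bool" where
  "lie_g15 br X Y Z W \<alpha> w1 w2 \<longleftrightarrow>
     \<alpha> \<noteq> 0 \<and>
     br W Z = 0 \<and>
     br Z X = \<alpha> *\<^sub>R X + w1 *\<^sub>R W \<and>
     br Z Y = \<alpha> *\<^sub>R Y + w2 *\<^sub>R W \<and>
     br W X = 0 \<and>
     br W Y = 0 \<and>
     br Y X = 0"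

definition lie_g16 ::
  "('v::real_vector \<Rightarrow> 'v \<Rightarrow> 'v) \<Rightarrow> 'v \<Rightarrow> 'v \<Rightarrow> 'v \<Rightarrow> 'v \<Rightarrow>
    real \<Rightarrow> real \<Rightarrow> real \<Rightarrow> real \<Rightarrow> real \<Rightarrow> bool" where
  "lie_g16 br X Y Z W \<beta> w1 w2 \<theta>1 \<theta>2 \<longleftrightarrow>
     \<beta> \<noteq> 0 \<and>
     br W Z = 0 \<and>
     br Z X = \<beta> *\<^sub>R Y + w1 *\<^sub>R W \<and>
     br Z Y = (- \<beta>) *\<^sub>R X + w2 *\<^sub>R W \<and>
     br W X = 0 \<and>
     br W Y = 0 \<and>
     br Y X = \<theta>1 *\<^sub>R Z + \<theta>2 *\<^sub>R W"

definition lie_g17 ::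
  "('v::real_vector \<Rightarrow> 'v \<Rightarrow> 'v) \<Rightarrow> 'v \<Rightarrow> 'v \<Rightarrow> 'v \<Rightarrow> 'v \<Rightarrow>
    real \<Rightarrow> real \<Rightarrow> real \<Rightarrow> real \<Rightarrow> bool" where
  "lie_g17 br X Y Z W \<alpha> a w1 w2 \<longleftrightarrow>
     \<alpha> \<noteq> 0 \<and> a \<noteq> 0 \<and>
     br W Z = 0 \<and>
     br Z X = \<alpha> *\<^sub>R X - (a * w1 / \<alpha>) *\<^sub>R Z + w1 *\<^sub>R W \<and>
     br Z Y = \<alpha> *\<^sub>R Y - (a * w2 / \<alpha>) *\<^sub>R Z + w2 *\<^sub>R W \<and>
     br W X = a *\<^sub>R X - (a^2 * w1 / \<alpha>^2) *\<^sub>R Z + (a * w1 / \<alpha>) *\<^sub>R W \<and>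
     br W Y = a *\<^sub>R Y - (a^2 * w2 / \<alpha>^2) *\<^sub>R Z + (a * w2 / \<alpha>) *\<^sub>R W \<and>
     br Y X = 0"

definition lie_g18 ::
  "('v::real_vector \<Rightarrow> 'v \<Rightarrow> 'v) \<Rightarrow> 'v \<Rightarrow> 'v \<Rightarrow> 'v \<Rightarrow> 'v \<Rightarrow>
    real \<Rightarrow> real \<Rightarrow> real \<Rightarrow> real \<Rightarrow> real \<Rightarrow> real \<Rightarrow> bool" where
  "lie_g18 br X Y Z W \<beta> b z3 z4 \<theta>1 \<theta>2 \<longleftrightarrow>
     \<beta> \<noteq> 0 \<and> b \<noteq> 0 \<and>
     br W Z = 0 \<and>
     br Z X = \<beta> *\<^sub>R Y + (\<beta> * z3 / b) *\<^sub>R Z - (\<beta>^2 * z3 / b^2) *\<^sub>R W \<and>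
     br Z Y = (- \<beta>) *\<^sub>R X + (\<beta> * z4 / b) *\<^sub>R Z - (\<beta>^2 * z4 / b^2) *\<^sub>R W \<and>
     br W X = b *\<^sub>R Y + z3 *\<^sub>R Z - (\<beta> * z3 / b) *\<^sub>R W \<and>
     br W Y = (- b) *\<^sub>R X + z4 *\<^sub>R Z - (\<beta> * z4 / b) *\<^sub>R W \<and>
     br Y X = \<theta>1 *\<^sub>R Z + \<theta>2 *\<^sub>R W"

definition lie_g19 ::
  "('v::real_vector \<Rightarrow> 'v \<Rightarrow> 'v) \<Rightarrow> 'v \<Rightarrow> 'v \<Rightarrow> 'v \<Rightarrow> 'v \<Rightarrow>
    real \<Rightarrow> real \<Rightarrow> real \<Rightarrow> real \<Rightarrow> bool" where
  "lie_g19 br X Y Z W \<alpha> \<beta> w1 w2 \<longleftrightarrow>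
     \<alpha> \<noteq> 0 \<and> \<beta> \<noteq> 0 \<and>
     br W Z = 0 \<and>
     br Z X = \<alpha> *\<^sub>R X + \<beta> *\<^sub>R Y + w1 *\<^sub>R W \<and>
     br Z Y = (- \<beta>) *\<^sub>R X + \<alpha> *\<^sub>R Y + w2 *\<^sub>R W \<and>
     br W X = 0 \<and>
     br W Y = 0 \<and>
     br Y X = 0"

definition lie_g20 ::
  "('v::real_vector \<Rightarrow> 'v \<Rightarrow> 'v) \<Rightarrow> 'v \<Rightarrow> 'v \<Rightarrow> 'v \<Rightarrow> 'v \<Rightarrow>
    real \<Rightarrow> real \<Rightarrow> real \<Rightarrow> real \<Rightarrow> real \<Rightarrow> bool" where
  "lie_g20 br X Y Z W \<alpha> a \<beta> w1 w2 \<longleftrightarrow>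
     \<alpha> \<noteq> 0 \<and> a \<noteq> 0 \<and> \<beta> \<noteq> 0 \<and>
     br W Z = 0 \<and>
     br Z X = \<alpha> *\<^sub>R X + \<beta> *\<^sub>R Y - (a * w1 / \<alpha>) *\<^sub>R Z + w1 *\<^sub>R W \<and>
     br Z Y = (- \<beta>) *\<^sub>R X + \<alpha> *\<^sub>R Y - (a * w2 / \<alpha>) *\<^sub>R Z + w2 *\<^sub>R W \<and>
     br W X = a *\<^sub>R X + (\<beta> * a / \<alpha>) *\<^sub>R Y - (a^2 * w1 / \<alpha>^2) *\<^sub>R Z + (a / \<alpha> * w1) *\<^sub>R W \<and>
     br W Y = (- (\<beta> * a / \<alpha>)) *\<^sub>R X + a *\<^sub>R Y - (a^2 * w2 / \<alpha>^2) *\<^sub>R Z + (a / \<alpha> * w2) *\<^sub>R W \<and>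
     br Y X = 0"

end

theory Submission
  imports Defs
begin

text \<open>
  All hypotheses concern left-invariant objects, so the theorem is a statement about the Lie algebra.

  \<^emph>\<open>From geometry to algebra.\<close> Tangent vectors are derivations of the algebra of smooth functions;
  bump functions and the Hadamard lemma identify them with directional derivatives in a chart. Hence
  \<open>T\<^sub>e G\<close> has dimension 4, and every vector at \<open>e\<close> extends to a smooth left-invariant field, so that
  evaluation at \<open>e\<close> identifies the Lie algebra with \<open>T\<^sub>e G\<close>. On left-invariant fields the metric is
  constant, and then skew-symmetry and vanishing torsion of the Levi-Civita connection turn the second
  fundamental forms into brackets: for \<open>U\<close> vertical and \<open>X, Y\<close> horizontal, conformality reads
  \<open>g [U, X] Y + g [U, Y] X = 2 g X Y \<mu> U\<close>, and minimality says that the vertical part of \<open>[\<cdot>, X]\<close> has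
  trace 0 on the vertical space (\<open>conformal_bracket\<close>, \<open>minimal_bracket\<close>).

  \<^emph>\<open>The algebra.\<close> Identify the horizontal plane with the complex numbers. By conformality, bracketing
  with \<open>Z\<close> and \<open>W\<close> induces on it the multiplications by two complex numbers \<open>A\<close> and \<open>B\<close>. Rotations of
  the pairs \<open>(X, Y)\<close> and \<open>(Z, W)\<close> remove the \<open>Y\<close>-component of \<open>[Y, X]\<close> and achieve \<open>[W, Z] = \<kappa> W\<close>; the
  Jacobi identity then becomes a short system of complex equations (\<open>jacobi_equations\<close>).
  If \<open>\<kappa> \<noteq> 0\<close>, the system forces \<open>B = 0\<close> and gives the families 1 to 4 (\<open>family_kappa_nonzero\<close>).
  If \<open>\<kappa> = 0\<close>, rotations of \<open>(Z, W)\<close> are still free, and the cases are distinguished by the real rank of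
  the pair \<open>(A, B)\<close>. Rank 0 is a question on pairs of traceless \<open>2 \<times> 2\<close> matrices and gives the families
  6 to 9 and 11 to 14 (\<open>family_abelian_ideal\<close>). For rank 1 a rotation makes \<open>B = 0\<close>, and the families 15,
  16 and 19 arise (\<open>family_rank_one\<close>). For rank 2 the complex equations are linear with a unique
  solution, which gives the families 5 and 10 (\<open>family_rank_two\<close>).
\<close>

section \<open>Smooth functions between normed spaces\<close>

lemma frechet_derivative_cong_open:
  assumes "open S" "x \<in> S" "\<And>y. y \<in> S \<Longrightarrow> f y = g y"
  shows "frechet_derivative f (at x) = frechet_derivative g (at x)"
proof -
  have "(f has_derivative D) (at x) \<longleftrightarrow> (g has_derivative D) (at x)" for D
    using assms has_derivative_transform_within_open by metis
  then show ?thesis by (simp add: frechet_derivative_def)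
qed

lemma Ck_on_subset: "Ck_on k S f \<Longrightarrow> T \<subseteq> S \<Longrightarrow> Ck_on k T f"
  by (induction k arbitrary: f) (auto intro: continuous_on_subset)

lemma Ck_on_imp_continuous_on: "Ck_on k S f \<Longrightarrow> continuous_on S f"
  by (cases k) (auto intro!: continuous_at_imp_continuous_on differentiable_imp_continuous_within)

lemma Ck_on_SucD: "Ck_on (Suc k) S f \<Longrightarrow> Ck_on k S f"
proof (induction k arbitrary: f)
  case 0
  then show ?case using Ck_on_imp_continuous_on[OF 0] by simp
next
  case (Suc k)
  have "\<forall>x\<in>S. f differentiable (at x)"
    using Suc.prems by (subst (asm) Ck_on.simps(2)) blast
  moreover have "Ck_on k S (\<lambda>x. frechet_derivative f (at x) v)" for v
    using Suc.prems by (subst (asm) Ck_on.simps(2)) (blast intro: Suc.IH)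
  ultimately show ?case by (subst Ck_on.simps(2)) blast
qed

lemma Ck_on_cong:
  assumes "open S" "\<And>x. x \<in> S \<Longrightarrow> f x = g x" "Ck_on k S f"
  shows "Ck_on k S g"
  using assms(2,3)
proof (induction k arbitrary: f g)
  case 0
  then show ?case using continuous_on_cong by (metis Ck_on.simps(1))
next
  case (Suc k)
  have D: "frechet_derivative f (at x) = frechet_derivative g (at x)" if "x \<in> S" for x
    using frechet_derivative_cong_open assms(1) that Suc.prems(1) by metis
  have "g differentiable (at x)" if "x \<in> S" for x
  proof -
    have "f differentiable (at x)" using Suc.prems(2) that by simp
    then show ?thesis
      unfolding differentiable_def
      using has_derivative_transform_within_open[OF _ assms(1) that] Suc.prems(1) by blast
  qed
  moreover have "Ck_on k S (\<lambda>x. frechet_derivative g (at x) v)" for v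
    by (rule Suc.IH[of "\<lambda>x. frechet_derivative f (at x) v"]) (use Suc.prems(2) D in auto)
  ultimately show ?case by simp
qed

lemma Ck_on_local:
  assumes "\<And>x. x \<in> S \<Longrightarrow> \<exists>T. open T \<and> x \<in> T \<and> Ck_on k T f"
  shows "Ck_on k S f"
  using assms
proof (induction k arbitrary: f)
  case 0
  then have "isCont f x" if "x \<in> S" for x
    using that by (metis Ck_on.simps(1) continuous_on_eq_continuous_at)
  then show ?case by (simp add: continuous_at_imp_continuous_on)
next
  case (Suc k)
  then show ?case by fastforce
qed

lemma Ck_on_SucI:
  assumes "open S" "\<And>x. x \<in> S \<Longrightarrow> (f has_derivative f' x) (at x)" "\<And>v. Ck_on k S (\<lambda>x. f' x v)"
  shows "Ck_on (Suc k) S f"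
proof -
  have "Ck_on k S (\<lambda>x. frechet_derivative f (at x) v)" for v
  proof (rule Ck_on_cong[OF assms(1) _ assms(3)[of v]])
    show "f' x v = frechet_derivative f (at x) v" if "x \<in> S" for x
      using frechet_derivative_at[OF assms(2)[OF that]] by simp
  qed
  then show ?thesis using assms(2) by (auto simp: differentiable_def)
qed

lemma Ck_on_SucE:
  assumes "Ck_on (Suc k) S f"
  obtains f' where "\<And>x. x \<in> S \<Longrightarrow> (f has_derivative f' x) (at x)" "\<And>v. Ck_on k S (\<lambda>x. f' x v)"
  using assms that[of "\<lambda>x. frechet_derivative f (at x)"]
  by (auto simp: frechet_derivative_works)

lemma Ck_on_const: "open S \<Longrightarrow> Ck_on k S (\<lambda>x. c)"
proof (induction k arbitrary: c)
  case (Suc k)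
  show ?case by (rule Ck_on_SucI[OF Suc.prems has_derivative_const]) (rule Suc.IH[OF Suc.prems])
qed simp

lemma Ck_on_linear:
  assumes "open S" "bounded_linear f"
  shows "Ck_on k S f"
proof (cases k)
  case 0
  then show ?thesis using assms by (simp add: linear_continuous_on)
next
  case (Suc j)
  show ?thesis unfolding Suc
    by (rule Ck_on_SucI[OF assms(1) bounded_linear_imp_has_derivative[OF assms(2)]])
      (rule Ck_on_const[OF assms(1)])
qed

lemma Ck_on_add:
  assumes "open S" "Ck_on k S f" "Ck_on k S g"
  shows "Ck_on k S (\<lambda>x. f x + g x)"
  using assms(2,3)
proof (induction k arbitrary: f g)
  case 0
  then show ?case by (simp add: continuous_on_add)
next
  case (Suc k)
  obtain f' where f: "\<And>x. x \<in> S \<Longrightarrow> (f has_derivative f' x) (at x)" "\<And>v. Ck_on k S (\<lambda>x. f' x v)"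
    using Ck_on_SucE[OF Suc.prems(1)] by blast
  obtain g' where g: "\<And>x. x \<in> S \<Longrightarrow> (g has_derivative g' x) (at x)" "\<And>v. Ck_on k S (\<lambda>x. g' x v)"
    using Ck_on_SucE[OF Suc.prems(2)] by blast
  show ?case
    by (rule Ck_on_SucI[OF assms(1) has_derivative_add[OF f(1) g(1)]]) (auto intro: Suc.IH f g)
qed

lemma Ck_on_sum:
  assumes "open S" "\<And>i. i \<in> I \<Longrightarrow> Ck_on k S (f i)"
  shows "Ck_on k S (\<lambda>x. \<Sum>i\<in>I. f i x)"
  using assms(2)
  by (induction I rule: infinite_finite_induct) (auto intro: Ck_on_const Ck_on_add assms(1))

lemma Ck_on_bilinear:
  assumes "open S" "bounded_bilinear B" "Ck_on k S f" "Ck_on k S g"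
  shows "Ck_on k S (\<lambda>x. B (f x) (g x))"
  using assms(3,4)
proof (induction k arbitrary: f g)
  case 0
  then show ?case by (simp add: bounded_bilinear.continuous_on[OF assms(2)])
next
  case (Suc k)
  obtain f' where f: "\<And>x. x \<in> S \<Longrightarrow> (f has_derivative f' x) (at x)" "\<And>v. Ck_on k S (\<lambda>x. f' x v)"
    using Ck_on_SucE[OF Suc.prems(1)] by blast
  obtain g' where g: "\<And>x. x \<in> S \<Longrightarrow> (g has_derivative g' x) (at x)" "\<And>v. Ck_on k S (\<lambda>x. g' x v)"
    using Ck_on_SucE[OF Suc.prems(2)] by blast
  show ?case
    by (rule Ck_on_SucI[OF assms(1) bounded_bilinear.FDERIV[OF assms(2) f(1) g(1)]])
      (auto intro!: Ck_on_add Suc.IH f g assms(1) Ck_on_SucD[OF Suc.prems(1)] Ck_on_SucD[OF Suc.prems(2)])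
qed

text \<open>
  The derivative of \<open>g \<circ> f\<close> in direction \<open>v\<close> is evaluated in a direction that depends on the point.
  Expanding that direction in a basis turns it into a sum of products of \<open>C\<^sup>k\<close> functions; this is
  where the finite dimension of the middle space is used.
\<close>

lemma Ck_on_compose:
  fixes f :: "'a::real_normed_vector \<Rightarrow> 'b::euclidean_space"
    and g :: "'b \<Rightarrow> 'c::real_normed_vector"
  assumes "open S" "open T" "f ` S \<subseteq> T" "Ck_on k S f" "Ck_on k T g"
  shows "Ck_on k S (\<lambda>x. g (f x))"
  using assms(4,5)
proof (induction k arbitrary: g)
  case 0
  then show ?case using continuous_on_compose2[of T g S f] assms(3) by simp
next
  case (Suc k)
  obtain f' where f: "\<And>x. x \<in> S \<Longrightarrow> (f has_derivative f' x) (at x)" "\<And>v. Ck_on k S (\<lambda>x. f' x v)"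
    using Ck_on_SucE[OF Suc.prems(1)] by blast
  obtain g' where g: "\<And>x. x \<in> T \<Longrightarrow> (g has_derivative g' x) (at x)" "\<And>v. Ck_on k T (\<lambda>x. g' x v)"
    using Ck_on_SucE[OF Suc.prems(2)] by blast
  have lin: "linear (g' (f x))" if "x \<in> S" for x
    using g(1) assms(3) that has_derivative_linear by blast
  show ?case
  proof (rule Ck_on_SucI[OF assms(1)])
    show "((\<lambda>x. g (f x)) has_derivative (\<lambda>v. g' (f x) (f' x v))) (at x)" if "x \<in> S" for x
      using has_derivative_compose[OF f(1)[OF that] g(1)] assms(3) that by blast
    show "Ck_on k S (\<lambda>x. g' (f x) (f' x v))" for v
    proof (rule Ck_on_cong[OF assms(1)])
      show "(\<Sum>b\<in>Basis. (f' x v \<bullet> b) *\<^sub>R g' (f x) b) = g' (f x) (f' x v)" if "x \<in> S" for x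
      proof -
        have "g' (f x) (f' x v) = g' (f x) (\<Sum>b\<in>Basis. (f' x v \<bullet> b) *\<^sub>R b)"
          by (simp add: euclidean_representation)
        also have "\<dots> = (\<Sum>b\<in>Basis. (f' x v \<bullet> b) *\<^sub>R g' (f x) b)"
          using lin[OF that] by (simp add: linear_sum linear_cmul)
        finally show ?thesis by simp
      qed
      have gb: "Ck_on k S (\<lambda>x. g' (f x) b)" for b
        by (rule Suc.IH[OF Ck_on_SucD[OF Suc.prems(1)] g(2)])
      show "Ck_on k S (\<lambda>x. \<Sum>b\<in>Basis. (f' x v \<bullet> b) *\<^sub>R g' (f x) b)"
        by (intro Ck_on_sum Ck_on_bilinear[OF assms(1) bounded_bilinear_scaleR] gb assms(1)
            Ck_on_bilinear[OF assms(1) bounded_bilinear_inner] f(2) Ck_on_const)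
    qed
  qed
qed

lemma smooth_on_subset: "smooth_on S f \<Longrightarrow> T \<subseteq> S \<Longrightarrow> smooth_on T f"
  by (auto simp: smooth_on_def intro: Ck_on_subset)

lemma smooth_on_imp_continuous_on: "smooth_on S f \<Longrightarrow> continuous_on S f"
  unfolding smooth_on_def using Ck_on_imp_continuous_on by blast

lemma smooth_on_cong:
  "open S \<Longrightarrow> smooth_on S f \<Longrightarrow> (\<And>x. x \<in> S \<Longrightarrow> f x = g x) \<Longrightarrow> smooth_on S g"
  by (auto simp: smooth_on_def intro: Ck_on_cong)

lemma smooth_on_local:
  "(\<And>x. x \<in> S \<Longrightarrow> \<exists>T. open T \<and> x \<in> T \<and> smooth_on T f) \<Longrightarrow> smooth_on S f"
  unfolding smooth_on_def by (metis Ck_on_local)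

lemma smooth_on_has_derivative:
  assumes "smooth_on S f" "x \<in> S"
  shows "(f has_derivative frechet_derivative f (at x)) (at x)"
proof -
  have "Ck_on (Suc 0) S f" using assms by (auto simp: smooth_on_def)
  then show ?thesis using assms by (simp add: frechet_derivative_works)
qed

lemma smooth_on_derivative:
  assumes "smooth_on S f"
  shows "smooth_on S (\<lambda>x. frechet_derivative f (at x) v)"
  unfolding smooth_on_def
proof
  fix k
  have "Ck_on (Suc k) S f" using assms unfolding smooth_on_def by blast
  then show "Ck_on k S (\<lambda>x. frechet_derivative f (at x) v)" by simp
qed

lemma smooth_on_const: "open S \<Longrightarrow> smooth_on S (\<lambda>x. c)"
  by (simp add: smooth_on_def Ck_on_const)

lemma smooth_on_linear: "open S \<Longrightarrow> bounded_linear f \<Longrightarrow> smooth_on S f"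
  by (simp add: smooth_on_def Ck_on_linear)

lemma smooth_on_add: "open S \<Longrightarrow> smooth_on S f \<Longrightarrow> smooth_on S g \<Longrightarrow> smooth_on S (\<lambda>x. f x + g x)"
  by (simp add: smooth_on_def Ck_on_add)

lemma smooth_on_bilinear:
  "open S \<Longrightarrow> bounded_bilinear B \<Longrightarrow> smooth_on S f \<Longrightarrow> smooth_on S g \<Longrightarrow>
    smooth_on S (\<lambda>x. B (f x) (g x))"
  by (simp add: smooth_on_def Ck_on_bilinear)

lemma smooth_on_mult:
  fixes f g :: "'a::real_normed_vector \<Rightarrow> real"
  shows "open S \<Longrightarrow> smooth_on S f \<Longrightarrow> smooth_on S g \<Longrightarrow> smooth_on S (\<lambda>x. f x * g x)"
  by (rule smooth_on_bilinear[OF _ bounded_bilinear_mult])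

lemma smooth_on_diff:
  fixes f g :: "'a::real_normed_vector \<Rightarrow> 'b::real_normed_vector"
  assumes "open S" "smooth_on S f" "smooth_on S g"
  shows "smooth_on S (\<lambda>x. f x - g x)"
proof -
  have "smooth_on S (\<lambda>x. (-1) *\<^sub>R g x)"
    by (rule smooth_on_bilinear[OF assms(1) bounded_bilinear_scaleR smooth_on_const assms(3)])
      (rule assms(1))
  from smooth_on_add[OF assms(1,2) this] show ?thesis by simp
qed

lemma smooth_on_compose:
  fixes f :: "'a::real_normed_vector \<Rightarrow> 'b::euclidean_space"
    and g :: "'b \<Rightarrow> 'c::real_normed_vector"
  assumes "open S" "open T" "f ` S \<subseteq> T" "smooth_on S f" "smooth_on T g"
  shows "smooth_on S (\<lambda>x. g (f x))"
  using Ck_on_compose[OF assms(1-3)] assms(4,5) unfolding smooth_on_def by blast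


section \<open>Bump functions\<close>

text \<open>
  The classical flat function \<open>exp (-1/t)\<close> is the member \<open>n = 0\<close> of this family. The whole family is
  needed because it is closed under differentiation up to linear combinations, so that smoothness of
  all members follows by one induction.
\<close>

definition flat_function :: "nat \<Rightarrow> real \<Rightarrow> real" where
  "flat_function n t = (if t > 0 then exp (- (1 / t)) / t ^ n else 0)"

lemma flat_function_tendsto_0: "(flat_function n \<longlongrightarrow> 0) (at 0)"
proof -
  have "((\<lambda>s. s ^ n / exp s) \<longlongrightarrow> (0::real)) at_top"
    by (rule tendsto_power_div_exp_0)
  then have "((\<lambda>t. inverse t ^ n / exp (inverse t)) \<longlongrightarrow> (0::real)) (at_right 0)"
    by (rule filterlim_compose) (rule filterlim_inverse_at_top_right)
  moreover have "eventually (\<lambda>t::real. inverse t ^ n / exp (inverse t) = flat_function n t) (at_right 0)"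
    unfolding eventually_at_right_field
    by (intro exI[of _ 1]) (auto simp: flat_function_def field_simps exp_minus)
  ultimately have R: "(flat_function n \<longlongrightarrow> 0) (at_right 0)"
    by (rule Lim_transform_eventually)
  have "eventually (\<lambda>t::real. 0 = flat_function n t) (at_left 0)"
    unfolding eventually_at_left_field by (intro exI[of _ "-1"]) (auto simp: flat_function_def)
  then have "(flat_function n \<longlongrightarrow> 0) (at_left 0)"
    by (rule Lim_transform_eventually[OF tendsto_const])
  with R show ?thesis by (simp add: filterlim_split_at)
qed

lemma flat_function_has_derivative:
  "(flat_function n has_real_derivative flat_function (n + 2) t - n * flat_function (n + 1) t) (at t)"
proof (cases t "0::real" rule: linorder_cases)
  case less
  have "((\<lambda>t. 0::real) has_real_derivative 0) (at t)" by simp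
  then have "(flat_function n has_real_derivative 0) (at t)"
    by (rule DERIV_cong_ev[THEN iffD1, rotated 3])
      (use less in \<open>auto simp: flat_function_def eventually_nhds intro!: exI[of _ "{..<0}"]\<close>)
  then show ?thesis using less by (simp add: flat_function_def)
next
  case greater
  have "((\<lambda>t. exp (- (1 / t)) / t ^ n) has_real_derivative
      flat_function (n + 2) t - n * flat_function (n + 1) t) (at t)"
    using greater
    apply (auto intro!: derivative_eq_intros simp: flat_function_def)
    apply (cases n; simp add: field_simps power2_eq_square)
    done
  then show ?thesis
    by (rule DERIV_cong_ev[THEN iffD1, rotated 3])
      (use greater in \<open>auto simp: flat_function_def eventually_nhds intro!: exI[of _ "{0<..}"]\<close>)
next
  case equal
  \<comment> \<open>The difference quotient of one member at 0 is the next member, which tends to 0.\<close>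
  have "((\<lambda>h. (flat_function n (0 + h) - flat_function n 0) / h) \<longlongrightarrow> 0) (at 0)"
  proof (rule Lim_transform_eventually[OF flat_function_tendsto_0[of "n + 1"]])
    show "\<forall>\<^sub>F h in at 0. flat_function (n + 1) h = (flat_function n (0 + h) - flat_function n 0) / h"
      by (auto simp: flat_function_def eventually_at_filter)
  qed
  then have "(flat_function n has_real_derivative 0) (at 0)"
    by (simp add: DERIV_def)
  then show ?thesis using equal by (simp add: flat_function_def)
qed

lemma smooth_on_flat_function: "smooth_on UNIV (flat_function n)"
  unfolding smooth_on_def
proof
  fix k
  show "Ck_on k UNIV (flat_function n)"
  proof (induction k arbitrary: n)
    case 0
    have "isCont (flat_function n) t" for t
      by (rule DERIV_isCont[OF flat_function_has_derivative])
    then show ?case by (simp add: continuous_at_imp_continuous_on)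
  next
    case (Suc k)
    show ?case
    proof (rule Ck_on_SucI)
      show "(flat_function n has_derivative
          (*) (flat_function (n + 2) t + - n * flat_function (n + 1) t)) (at t)" for t
        using flat_function_has_derivative[of n t] unfolding has_field_derivative_def by simp
      show "Ck_on k UNIV (\<lambda>t. (flat_function (n + 2) t + - n * flat_function (n + 1) t) * v)" for v
        by (intro Ck_on_bilinear[OF open_UNIV bounded_bilinear_mult] Ck_on_const Ck_on_add Suc.IH open_UNIV)
    qed simp
  qed
qed

definition bump :: "'a::euclidean_space \<Rightarrow> real \<Rightarrow> 'a \<Rightarrow> real" where
  "bump c \<epsilon> x = flat_function 0 (\<epsilon>\<^sup>2 - (x - c) \<bullet> (x - c)) / flat_function 0 (\<epsilon>\<^sup>2)"

lemma bump_center: "\<epsilon> > 0 \<Longrightarrow> bump c \<epsilon> c = 1"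
  by (simp add: bump_def flat_function_def)

lemma bump_outside: 
  assumes "\<epsilon> > 0" "x \<notin> cball c \<epsilon>" shows "bump c \<epsilon> x = 0"
proof -
  have "\<epsilon> < norm (x - c)" using assms by (simp add: dist_norm norm_minus_commute)
  then have "\<epsilon>\<^sup>2 < (norm (x - c))\<^sup>2" using assms by (simp add: power_strict_mono)
  then show ?thesis by (simp add: bump_def flat_function_def power2_norm_eq_inner)
qed

lemma smooth_on_bump: "smooth_on UNIV (bump c \<epsilon>)"
proof -
  have lin: "smooth_on UNIV (\<lambda>x. x - c)"
    by (intro smooth_on_diff smooth_on_linear smooth_on_const bounded_linear_ident open_UNIV)
  have "smooth_on UNIV (\<lambda>x. flat_function 0 (\<epsilon>\<^sup>2 - (x - c) \<bullet> (x - c)))"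
    by (rule smooth_on_compose[OF _ _ _ _ smooth_on_flat_function])
      (auto intro!: smooth_on_diff smooth_on_const smooth_on_bilinear[OF _ bounded_bilinear_inner] lin)
  from smooth_on_mult[OF _ this smooth_on_const, of "1 / flat_function 0 (\<epsilon>\<^sup>2)"]
  show ?thesis unfolding bump_def[abs_def] by simp
qed


section \<open>The Hadamard lemma\<close>

lemma scaleR_mem_convex:
  fixes t :: real
  assumes "convex U" "0 \<in> U" "x \<in> U" "t \<in> {0..1}"
  shows "t *\<^sub>R x \<in> U"
  using convexD_alt[OF assms(1-3), of t] assms(4) by simp

lemma continuous_on_radial:
  fixes h :: "'a::real_normed_vector \<Rightarrow> real"
  assumes "convex U" "0 \<in> U" "continuous_on U h"
  shows "continuous_on (U \<times> {0..1}) (\<lambda>(x, t). t ^ m * h (t *\<^sub>R x))"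
proof -
  have "continuous_on (U \<times> {0..1}) (\<lambda>p. h (snd p *\<^sub>R fst p))"
    by (rule continuous_on_compose2[OF assms(3)])
      (auto intro!: continuous_intros scaleR_mem_convex[OF assms(1,2)])
  then show ?thesis unfolding case_prod_beta by (intro continuous_on_mult continuous_intros)
qed

lemma continuous_on_radial_slice:
  fixes h :: "'a::real_normed_vector \<Rightarrow> real"
  assumes "convex U" "0 \<in> U" "continuous_on U h" "x \<in> U"
  shows "continuous_on {0..1} (\<lambda>t. t ^ m * h (t *\<^sub>R x))"
proof -
  have "continuous_on {0..1} (\<lambda>t. (x, t :: real))" by (intro continuous_intros)
  from continuous_on_compose2[OF continuous_on_radial[OF assms(1-3), of m] this]
  show ?thesis using assms(4) by auto
qed

text \<open>
  Differentiating under the integral sign replaces \<open>h\<close> by a directional derivative of \<open>h\<close> and \<open>m\<close> by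
  \<open>m + 1\<close>; stated for all \<open>m\<close>, the smoothness therefore follows by induction on the order.
\<close>

lemma Ck_on_radial_integral:
  fixes h :: "'a::euclidean_space \<Rightarrow> real"
  assumes "open U" "convex U" "0 \<in> U" "smooth_on U h"
  shows "Ck_on k U (\<lambda>x. integral {0..1} (\<lambda>t. t ^ m * h (t *\<^sub>R x)))"
  using assms(4)
proof (induction k arbitrary: m h)
  case (0 m h)
  have "continuous_on (U \<times> cbox 0 1) (\<lambda>(x, t). t ^ m * h (t *\<^sub>R x))"
    using continuous_on_radial[OF assms(2,3) smooth_on_imp_continuous_on[OF 0]] by simp
  from integral_continuous_on_param[OF this] show ?case by simp
next
  case (Suc k m h)
  let ?h' = "\<lambda>x. frechet_derivative h (at x)"
  note mem = scaleR_mem_convex[OF assms(2,3)]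
  have bl: "bounded_linear (?h' x)" if "x \<in> U" for x
    using smooth_on_has_derivative[OF Suc.prems that] by (rule has_derivative_bounded_linear)
  define F where "F x t = Blinfun (\<lambda>v. t ^ Suc m * ?h' (t *\<^sub>R x) v)" for x :: 'a and t :: real
  have F: "blinfun_apply (F x t) = (\<lambda>v. t ^ Suc m * ?h' (t *\<^sub>R x) v)" if "x \<in> U" "t \<in> {0..1}" for x t
    unfolding F_def
    by (rule bounded_linear_Blinfun_apply) (intro bounded_linear_const_mult bl mem that)
  have contF: "continuous_on (U \<times> {0..1}) (\<lambda>(x, t). F x t)"
  proof (rule continuous_on_blinfun_componentwise)
    fix i :: 'a
    have "continuous_on (U \<times> {0..1}) (\<lambda>(x, t). t ^ Suc m * ?h' (t *\<^sub>R x) i)"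
      by (rule continuous_on_radial[OF assms(2,3) smooth_on_imp_continuous_on[OF smooth_on_derivative[OF Suc.prems]]])
    then show "continuous_on (U \<times> {0..1}) (\<lambda>x. blinfun_apply (case x of (x, t) \<Rightarrow> F x t) i)"
      by (rule continuous_on_eq) (auto simp: F)
  qed
  have "((\<lambda>x. integral (cbox 0 1) (\<lambda>t. t ^ m * h (t *\<^sub>R x))) has_derivative
      blinfun_apply (integral (cbox 0 1) (F x))) (at x within U)" if "x \<in> U" for x
  proof (rule leibniz_rule[where fx = F])
    fix x and t :: real assume x: "x \<in> U" "t \<in> cbox 0 1"
    have "((\<lambda>x. h (t *\<^sub>R x)) has_derivative (\<lambda>v. ?h' (t *\<^sub>R x) (t *\<^sub>R v))) (at x within U)"
      by (rule has_derivative_compose[OF _ smooth_on_has_derivative[OF Suc.prems]])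
        (use x mem in \<open>auto intro!: derivative_eq_intros\<close>)
    then have "((\<lambda>x. t ^ m * h (t *\<^sub>R x)) has_derivative (\<lambda>v. t ^ m * ?h' (t *\<^sub>R x) (t *\<^sub>R v))) (at x within U)"
      by (rule has_derivative_mult_right)
    moreover have "(\<lambda>v. t ^ m * ?h' (t *\<^sub>R x) (t *\<^sub>R v)) = blinfun_apply (F x t)"
      using linear_cmul[OF bounded_linear.linear[OF bl[OF mem[OF x(1)]]]] x
      by (auto simp: F fun_eq_iff)
    ultimately show "((\<lambda>x. t ^ m * h (t *\<^sub>R x)) has_derivative blinfun_apply (F x t)) (at x within U)"
      by simp
  next
    fix x assume "x \<in> U"
    then have "continuous_on {0..1} (\<lambda>t. t ^ m * h (t *\<^sub>R x))"
      by (rule continuous_on_radial_slice[OF assms(2,3) smooth_on_imp_continuous_on[OF Suc.prems]])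
    then show "(\<lambda>t. t ^ m * h (t *\<^sub>R x)) integrable_on cbox 0 1"
      by (simp add: integrable_continuous_interval)
  qed (use contF assms that in auto)
  note leibniz = this
  have D: "((\<lambda>x. integral {0..1} (\<lambda>t. t ^ m * h (t *\<^sub>R x))) has_derivative
      blinfun_apply (integral {0..1} (F x))) (at x)" if "x \<in> U" for x
    using leibniz[OF that] unfolding at_within_open[OF that assms(1)] box_real .
  show ?case
  proof (rule Ck_on_SucI[OF assms(1) D])
    fix v
    have "Ck_on k U (\<lambda>x. integral {0..1} (\<lambda>t. t ^ Suc m * ?h' (t *\<^sub>R x) v))"
      by (rule Suc.IH) (rule smooth_on_derivative[OF Suc.prems])
    then show "Ck_on k U (\<lambda>x. blinfun_apply (integral {0..1} (F x)) v)"
    proof (rule Ck_on_cong[OF assms(1), rotated])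
      fix x assume x: "x \<in> U"
      have "continuous_on {0..1} (F x)"
      proof -
        have "continuous_on {0..1} (\<lambda>t. (x, t :: real))" by (intro continuous_intros)
        from continuous_on_compose2[OF contF this] show ?thesis using x by auto
      qed
      then have "F x integrable_on {0..1}" by (rule integrable_continuous_interval)
      then have "blinfun_apply (integral {0..1} (F x)) v = integral {0..1} (\<lambda>t. blinfun_apply (F x t) v)"
        by (rule blinfun_apply_integral)
      also have "\<dots> = integral {0..1} (\<lambda>t. t ^ Suc m * ?h' (t *\<^sub>R x) v)"
        by (rule integral_cong) (simp add: F x)
      finally show "integral {0..1} (\<lambda>t. t ^ Suc m * ?h' (t *\<^sub>R x) v) = blinfun_apply (integral {0..1} (F x)) v"
        by simp
    qed
  qed
qed

text \<open>
  The fundamental theorem of calculus along the segment from \<open>0\<close> to \<open>x\<close> gives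
  \<open>f x - f 0 = \<Sum>\<^sub>b (x \<bullet> b) \<integral> (\<partial>\<^sub>b f) (t x) dt\<close>, and the integrals depend smoothly on \<open>x\<close>.
\<close>

lemma hadamard_lemma_0:
  fixes f :: "'a::euclidean_space \<Rightarrow> real"
  assumes "open U" "convex U" "0 \<in> U" "smooth_on U f"
  shows "\<exists>G. (\<forall>b. smooth_on U (G b) \<and> G b 0 = frechet_derivative f (at 0) b) \<and>
    (\<forall>x\<in>U. f x = f 0 + (\<Sum>b\<in>Basis. (x \<bullet> b) * G b x))"
proof -
  let ?f' = "\<lambda>x. frechet_derivative f (at x)"
  define G where "G b x = integral {0..1} (\<lambda>t. ?f' (t *\<^sub>R x) b)" for b x
  note mem = scaleR_mem_convex[OF assms(2,3)]
  have "smooth_on U (G b)" for b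
    using Ck_on_radial_integral[OF assms(1-3) smooth_on_derivative[OF assms(4)], where m = 0]
    by (simp add: smooth_on_def G_def[abs_def])
  moreover have "G b 0 = ?f' 0 b" for b by (simp add: G_def)
  moreover have "f x = f 0 + (\<Sum>b\<in>Basis. (x \<bullet> b) * G b x)" if x: "x \<in> U" for x
  proof -
    have der: "((\<lambda>t. f (t *\<^sub>R x)) has_vector_derivative ?f' (t *\<^sub>R x) x) (at t within {0..1})"
      if "t \<in> {0..1}" for t
    proof -
      have "((\<lambda>t. f (t *\<^sub>R x)) has_derivative (\<lambda>s. ?f' (t *\<^sub>R x) (s *\<^sub>R x))) (at t within {0..1})"
        by (rule has_derivative_compose[OF _ smooth_on_has_derivative[OF assms(4)]])
          (use that x mem in \<open>auto intro!: derivative_eq_intros\<close>)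
      then show ?thesis
        unfolding has_vector_derivative_def
        using linear_cmul[OF has_derivative_linear[OF smooth_on_has_derivative[OF assms(4) mem[OF x that]]]]
        by simp
    qed
    have "((\<lambda>t. ?f' (t *\<^sub>R x) x) has_integral f x - f 0) {0..1}"
      using fundamental_theorem_of_calculus[OF _ der] by simp
    then have "f x - f 0 = integral {0..1} (\<lambda>t. ?f' (t *\<^sub>R x) x)"
      by (simp add: integral_unique)
    also have "\<dots> = integral {0..1} (\<lambda>t. \<Sum>b\<in>Basis. (x \<bullet> b) * ?f' (t *\<^sub>R x) b)"
    proof (rule integral_cong)
      fix t :: real assume "t \<in> {0..1}"
      note lin = has_derivative_linear[OF smooth_on_has_derivative[OF assms(4) mem[OF x this]]]
      have "?f' (t *\<^sub>R x) x = ?f' (t *\<^sub>R x) (\<Sum>b\<in>Basis. (x \<bullet> b) *\<^sub>R b)"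
        by (simp add: euclidean_representation)
      also have "\<dots> = (\<Sum>b\<in>Basis. (x \<bullet> b) * ?f' (t *\<^sub>R x) b)"
        using lin by (simp add: linear_sum linear_cmul)
      finally show "?f' (t *\<^sub>R x) x = (\<Sum>b\<in>Basis. (x \<bullet> b) * ?f' (t *\<^sub>R x) b)" .
    qed
    also have "\<dots> = (\<Sum>b\<in>Basis. (x \<bullet> b) * G b x)"
    proof (subst integral_sum)
      show "(\<lambda>t. (x \<bullet> b) * ?f' (t *\<^sub>R x) b) integrable_on {0..1}" for b
        using continuous_on_radial_slice[OF assms(2,3) smooth_on_imp_continuous_on[OF smooth_on_derivative[OF assms(4)]] x, of 0 b]
        by (intro integrable_on_mult_right) (simp add: integrable_continuous_interval)
    qed (auto simp: G_def)
    finally show ?thesis by simp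
  qed
  ultimately show ?thesis by blast
qed

lemma hadamard_lemma:
  fixes f :: "'a::euclidean_space \<Rightarrow> real"
  assumes "open U" "convex U" "c \<in> U" "smooth_on U f"
  obtains G where "\<And>b. smooth_on U (G b)" "\<And>b. G b c = frechet_derivative f (at c) b"
    "\<And>x. x \<in> U \<Longrightarrow> f x = f c + (\<Sum>b\<in>Basis. ((x - c) \<bullet> b) * G b x)"
proof -
  let ?U = "(\<lambda>x. x - c) ` U"
  have U: "open ?U" "convex ?U" "0 \<in> ?U"
    using assms by (auto intro: open_translation_subtract convex_translation_subtract)
  have sh: "smooth_on ?U (\<lambda>x. x + c)"
    by (intro smooth_on_add smooth_on_linear smooth_on_const bounded_linear_ident U)
  have "smooth_on ?U (\<lambda>x. f (x + c))"
    by (rule smooth_on_compose[OF U(1) assms(1) _ sh assms(4)]) auto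
  from hadamard_lemma_0[OF U this] obtain G where
    G: "smooth_on ?U (G b)" "G b 0 = frechet_derivative (\<lambda>x. f (x + c)) (at 0) b"
    "\<forall>x\<in>?U. f (x + c) = f (0 + c) + (\<Sum>b\<in>Basis. (x \<bullet> b) * G b x)" for b
    by blast
  have "((\<lambda>x. f (x + c)) has_derivative frechet_derivative f (at c)) (at 0)"
  proof -
    have "((\<lambda>x. f (x + c)) has_derivative (\<lambda>v. frechet_derivative f (at c) v)) (at 0)"
      by (rule has_derivative_compose[where f = "\<lambda>x. x + c"])
        (use smooth_on_has_derivative[OF assms(4,3)] in \<open>auto intro!: derivative_eq_intros\<close>)
    then show ?thesis by simp
  qed
  then have D: "frechet_derivative (\<lambda>x. f (x + c)) (at 0) = frechet_derivative f (at c)"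
    by (rule frechet_derivative_at[symmetric])
  have lin: "smooth_on U (\<lambda>x. x - c)"
    by (intro smooth_on_diff smooth_on_linear smooth_on_const bounded_linear_ident assms)
  show ?thesis
  proof (rule that[of "\<lambda>b x. G b (x - c)"])
    show "smooth_on U (\<lambda>x. G b (x - c))" for b
      by (rule smooth_on_compose[OF assms(1) U(1) _ lin G(1)]) auto
    show "G b (c - c) = frechet_derivative f (at c) b" for b
      using G(2) D by simp
    show "f x = f c + (\<Sum>b\<in>Basis. ((x - c) \<bullet> b) * G b (x - c))" if "x \<in> U" for x
      using G(3) that by force
  qed
qed


section \<open>Tangent spaces in coordinates\<close>

locale smooth_mfd =
  fixes A :: "('m::{t2_space,second_countable_topology}, 'e::euclidean_space) atlas"
  assumes smooth_manifold: "smooth_manifold A"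
begin

lemma chartD:
  assumes "(U, \<phi>) \<in> A"
  shows "open U" "open (\<phi> ` U)" "homeomorphism U (\<phi> ` U) \<phi> (inv_into U \<phi>)"
    and "continuous_on U \<phi>" "continuous_on (\<phi> ` U) (inv_into U \<phi>)"
    and "\<And>x. x \<in> U \<Longrightarrow> inv_into U \<phi> (\<phi> x) = x"
    and "\<And>y. y \<in> \<phi> ` U \<Longrightarrow> inv_into U \<phi> y \<in> U"
proof -
  show *: "open U" "open (\<phi> ` U)" "homeomorphism U (\<phi> ` U) \<phi> (inv_into U \<phi>)"
    using smooth_manifold assms by (auto simp: smooth_manifold_def)
  show "continuous_on U \<phi>" "continuous_on (\<phi> ` U) (inv_into U \<phi>)"
    using *(3) by (auto simp: homeomorphism_def)
  show "\<And>x. x \<in> U \<Longrightarrow> inv_into U \<phi> (\<phi> x) = x"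
    using *(3) by (auto simp: homeomorphism_def)
  show "\<And>y. y \<in> \<phi> ` U \<Longrightarrow> inv_into U \<phi> y \<in> U"
    by (rule inv_into_into)
qed

lemma transition_smooth:
  "(U, \<phi>) \<in> A \<Longrightarrow> (V, \<psi>) \<in> A \<Longrightarrow> smooth_on (\<phi> ` (U \<inter> V)) (\<lambda>x. \<psi> (inv_into U \<phi> x))"
  using smooth_manifold by (fastforce simp: smooth_manifold_def o_def)

lemma ex_chart: 
  obtains U \<phi> where "(U, \<phi>) \<in> A" "p \<in> U"
proof -
  have "p \<in> (\<Union>(U, \<phi>)\<in>A. U)" using smooth_manifold by (simp add: smooth_manifold_def)
  then show ?thesis using that by auto
qed

lemma chart_open_preimage:
  assumes "(U, \<phi>) \<in> A" "open W"
  shows "open (\<phi> ` U \<inter> inv_into U \<phi> -` W)"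
  using continuous_open_preimage[OF chartD(5,2)[OF assms(1)] assms(2)] .

lemma smooth_functions_iff:
  "f \<in> smooth_functions A \<longleftrightarrow> (\<forall>(U, \<phi>)\<in>A. smooth_on (\<phi> ` U) (\<lambda>x. f (inv_into U \<phi> x)))"
    (is "_ \<longleftrightarrow> ?R")
proof
  assume "f \<in> smooth_functions A"
  then show ?R by (auto simp: smooth_functions_def smooth_map_def o_def)
next
  assume R: ?R
  have "isCont f p" for p
  proof -
    obtain U \<phi> where U: "(U, \<phi>) \<in> A" "p \<in> U" by (rule ex_chart)
    have "continuous_on (\<phi> ` U) (\<lambda>x. f (inv_into U \<phi> x))"
      using R U by (auto intro!: smooth_on_imp_continuous_on)
    then have "continuous_on U (\<lambda>q. f (inv_into U \<phi> (\<phi> q)))"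
      by (rule continuous_on_compose2[OF _ chartD(4)[OF U(1)]]) simp
    then have "continuous_on U f"
      by (rule continuous_on_eq) (simp add: chartD(6)[OF U(1)])
    then show ?thesis using U chartD(1)[OF U(1)] by (simp add: continuous_on_eq_continuous_at)
  qed
  then have "continuous_on UNIV f" by (simp add: continuous_at_imp_continuous_on)
  with R show "f \<in> smooth_functions A"
    by (auto simp: smooth_functions_def smooth_map_def o_def)
qed

lemma smooth_functionsD:
  "f \<in> smooth_functions A \<Longrightarrow> (U, \<phi>) \<in> A \<Longrightarrow> smooth_on (\<phi> ` U) (\<lambda>x. f (inv_into U \<phi> x))"
  by (auto simp: smooth_functions_iff)

lemma smooth_functions_const: "(\<lambda>p. c) \<in> smooth_functions A"
  by (auto simp: smooth_functions_iff intro: smooth_on_const chartD)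

lemma smooth_functions_zero: "0 \<in> smooth_functions A"
  using smooth_functions_const[of 0] by (simp add: zero_fun_def)

lemma smooth_functions_add:
  "f \<in> smooth_functions A \<Longrightarrow> h \<in> smooth_functions A \<Longrightarrow> f + h \<in> smooth_functions A"
  by (fastforce simp: smooth_functions_iff plus_fun_def intro: smooth_on_add chartD)

lemma smooth_functions_mult:
  "f \<in> smooth_functions A \<Longrightarrow> h \<in> smooth_functions A \<Longrightarrow> f * h \<in> smooth_functions A"
  by (fastforce simp: smooth_functions_iff times_fun_def intro: smooth_on_mult chartD)

lemma smooth_functions_scale:
  assumes "f \<in> smooth_functions A"
  shows "c *\<^sub>R f \<in> smooth_functions A"
proof -
  have "c *\<^sub>R f = (\<lambda>p. c) * f" by (simp add: fun_eq_iff scaleR_fun_def)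
  then show ?thesis using smooth_functions_mult[OF smooth_functions_const assms] by simp
qed

lemma smooth_functions_diff:
  assumes "f \<in> smooth_functions A" "h \<in> smooth_functions A"
  shows "f - h \<in> smooth_functions A"
proof -
  have "f - h = f + (-1) *\<^sub>R h" by (simp add: fun_eq_iff scaleR_fun_def)
  then show ?thesis
    using smooth_functions_add[OF assms(1) smooth_functions_scale[OF assms(2), of "-1"]] by metis
qed

text \<open>
  The manifold is covered by the chart domain, where the function is smooth, and by the complement of
  the preimage of \<open>K\<close>, where it vanishes. The latter set is open because compact subsets of a Hausdorff
  space are closed.
\<close>

lemma smooth_functions_extend_by_zero:
  assumes U: "(U, \<phi>) \<in> A" and k: "smooth_on (\<phi> ` U) k"
    and K: "compact K" "K \<subseteq> \<phi> ` U" and zero: "\<And>x. x \<in> \<phi> ` U \<Longrightarrow> x \<notin> K \<Longrightarrow> k x = 0"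
  shows "(\<lambda>q. if q \<in> U then k (\<phi> q) else 0) \<in> smooth_functions A"
  unfolding smooth_functions_iff
proof (clarify, rule smooth_on_local)
  let ?F = "\<lambda>q. if q \<in> U then k (\<phi> q) else 0"
  fix V \<psi> x assume V: "(V, \<psi>) \<in> A" and x: "x \<in> \<psi> ` V"
  let ?q = "inv_into V \<psi>"
  show "\<exists>T. open T \<and> x \<in> T \<and> smooth_on T (\<lambda>x. ?F (?q x))"
  proof (cases "?q x \<in> U")
    case True
    let ?T = "\<psi> ` V \<inter> ?q -` U"
    have T: "open ?T" by (rule chart_open_preimage[OF V chartD(1)[OF U]])
    have "?T \<subseteq> \<psi> ` (V \<inter> U)" using chartD(6)[OF V] by auto
    then have "smooth_on ?T (\<lambda>x. \<phi> (?q x))"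
      by (rule smooth_on_subset[OF transition_smooth[OF V U]])
    then have "smooth_on ?T (\<lambda>x. k (\<phi> (?q x)))"
      by (intro smooth_on_compose[OF T chartD(2)[OF U] _ _ k]) auto
    then have "smooth_on ?T (\<lambda>x. ?F (?q x))"
      by (rule smooth_on_cong[OF T]) auto
    then show ?thesis using T True x by (intro exI[of _ ?T]) auto
  next
    case False
    let ?K = "inv_into U \<phi> ` K"
    have "compact ?K"
      by (rule compact_continuous_image[OF continuous_on_subset[OF chartD(5)[OF U] K(2)] K(1)])
    then have "open (- ?K)" by (simp add: compact_imp_closed open_Compl)
    let ?T = "\<psi> ` V \<inter> ?q -` (- ?K)"
    have T: "open ?T" by (rule chart_open_preimage[OF V \<open>open (- ?K)\<close>])
    have "?q x \<notin> ?K" using False K(2) chartD(7)[OF U] by auto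
    then have "x \<in> ?T" using x by auto
    moreover have "smooth_on ?T (\<lambda>x. ?F (?q x))"
    proof (rule smooth_on_cong[OF T smooth_on_const[OF T, of 0]])
      fix y assume "y \<in> ?T"
      then have "?q y \<notin> ?K" by auto
      then have "\<phi> (?q y) \<notin> K" if "?q y \<in> U"
        using chartD(6)[OF U that] by (metis imageI)
      then show "0 = ?F (?q y)" using zero by auto
    qed
    ultimately show ?thesis using T by (intro exI[of _ ?T]) auto
  qed
qed

definition coord_tangent :: "'m set \<Rightarrow> ('m \<Rightarrow> 'e) \<Rightarrow> 'm \<Rightarrow> 'e \<Rightarrow> 'm tvec" where
  "coord_tangent U \<phi> p w f =
    (if f \<in> smooth_functions A then frechet_derivative (\<lambda>x. f (inv_into U \<phi> x)) (at (\<phi> p)) w else 0)"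

lemma has_derivative_in_chart:
  assumes "(U, \<phi>) \<in> A" "p \<in> U" "f \<in> smooth_functions A"
  shows "((\<lambda>x. f (inv_into U \<phi> x)) has_derivative (\<lambda>w. coord_tangent U \<phi> p w f)) (at (\<phi> p))"
  using smooth_on_has_derivative[OF smooth_functionsD[OF assms(3,1)], of "\<phi> p"] assms
  by (simp add: coord_tangent_def)

lemma coord_tangent_eqI:
  assumes "((\<lambda>x. f (inv_into U \<phi> x)) has_derivative D) (at (\<phi> p))" "f \<in> smooth_functions A"
  shows "coord_tangent U \<phi> p w f = D w"
  using frechet_derivative_at[OF assms(1)] assms(2) by (simp add: coord_tangent_def)

lemma coord_tangent_in_tangent_space:
  assumes U: "(U, \<phi>) \<in> A" "p \<in> U"
  shows "coord_tangent U \<phi> p w \<in> tangent_space A p"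
  unfolding tangent_space_def
proof (safe, goal_cases)
  case (1 f h)
  show ?case
    by (subst coord_tangent_eqI[where f = "f + h"])
      (use has_derivative_add[OF has_derivative_in_chart[OF U 1(1)] has_derivative_in_chart[OF U 1(2)]] 1
        in \<open>auto simp: smooth_functions_add\<close>)
next
  case (2 f h)
  show ?case
    by (subst coord_tangent_eqI[where f = "f * h"])
      (use has_derivative_mult[OF has_derivative_in_chart[OF U 2(1)] has_derivative_in_chart[OF U 2(2)]] 2
        chartD(6)[OF U] in \<open>auto simp: smooth_functions_mult mult.commute\<close>)
next
  case (3 c f)
  show ?case
    by (subst coord_tangent_eqI[where f = "c *\<^sub>R f"])
      (use has_derivative_scaleR_right[OF has_derivative_in_chart[OF U 3], of c] 3
        smooth_functions_scale[OF 3] in \<open>auto simp: scaleR_fun_def\<close>)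
next
  case (4 f)
  then show ?case by (simp add: coord_tangent_def)
qed

lemma linear_coord_tangent:
  assumes U: "(U, \<phi>) \<in> A" "p \<in> U"
  shows "linear (coord_tangent U \<phi> p)"
proof (rule linearI; rule ext)
  fix b1 b2 :: 'e and f
  show "coord_tangent U \<phi> p (b1 + b2) f = (coord_tangent U \<phi> p b1 + coord_tangent U \<phi> p b2) f"
    using linear_add[OF has_derivative_linear[OF has_derivative_in_chart[OF U, of f]], of b1 b2]
    by (cases "f \<in> smooth_functions A") (auto simp: coord_tangent_def)
next
  fix r and b :: 'e and f
  show "coord_tangent U \<phi> p (r *\<^sub>R b) f = (r *\<^sub>R coord_tangent U \<phi> p b) f"
    using linear_cmul[OF has_derivative_linear[OF has_derivative_in_chart[OF U, of f]], of r b]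
    by (cases "f \<in> smooth_functions A") (auto simp: coord_tangent_def scaleR_fun_def)
qed

lemma bump_supported_in_chart:
  assumes U: "(U, \<phi>) \<in> A" "p \<in> U"
  obtains \<epsilon> where "\<epsilon> > 0" "cball (\<phi> p) \<epsilon> \<subseteq> \<phi> ` U"
  using chartD(2)[OF U(1)] U(2) open_contains_cball by (metis imageI)

text \<open>
  A coordinate cut off by a bump function is a global smooth function, and it reads off a component of \<open>w\<close>.
\<close>

lemma coord_tangent_eq_0D:
  assumes U: "(U, \<phi>) \<in> A" "p \<in> U" and zero: "coord_tangent U \<phi> p w = 0"
  shows "w = 0"
proof (rule euclidean_eqI)
  fix b :: 'e assume "b \<in> Basis"
  obtain \<epsilon> where \<epsilon>: "\<epsilon> > 0" "cball (\<phi> p) \<epsilon> \<subseteq> \<phi> ` U" by (rule bump_supported_in_chart[OF U])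
  define k where "k x = bump (\<phi> p) \<epsilon> x * ((x - \<phi> p) \<bullet> b)" for x
  define f where "f q = (if q \<in> U then k (\<phi> q) else 0)" for q
  have op: "open (\<phi> ` U)" by (rule chartD[OF U(1)])
  have bump: "smooth_on (\<phi> ` U) (bump (\<phi> p) \<epsilon>)"
    by (rule smooth_on_subset[OF smooth_on_bump]) simp
  have "smooth_on (\<phi> ` U) k"
    unfolding k_def[abs_def]
    by (intro smooth_on_mult op bump smooth_on_bilinear[OF op bounded_bilinear_inner] smooth_on_diff
        smooth_on_linear[OF op bounded_linear_ident] smooth_on_const)
  then have f: "f \<in> smooth_functions A"
    unfolding f_def[abs_def]
    by (rule smooth_functions_extend_by_zero[OF U(1) _ compact_cball \<epsilon>(2)])
      (simp add: k_def bump_outside[OF \<epsilon>(1)])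
  obtain B where B: "(bump (\<phi> p) \<epsilon> has_derivative B) (at (\<phi> p))"
    using smooth_on_has_derivative[OF smooth_on_bump UNIV_I] by blast
  have "((\<lambda>x. (x - \<phi> p) \<bullet> b) has_derivative (\<lambda>v. v \<bullet> b)) (at (\<phi> p))"
    by (auto intro!: derivative_eq_intros)
  from has_derivative_mult[OF B this]
  have "(k has_derivative (\<lambda>v. v \<bullet> b)) (at (\<phi> p))"
    by (simp add: bump_center[OF \<epsilon>(1)] k_def[abs_def])
  then have "((\<lambda>x. f (inv_into U \<phi> x)) has_derivative (\<lambda>v. v \<bullet> b)) (at (\<phi> p))"
    by (rule has_derivative_transform_within_open[OF _ op])
      (use U chartD(6)[OF U(1)] in \<open>auto simp: f_def\<close>)
  from coord_tangent_eqI[OF this f, of w] show "w \<bullet> b = 0 \<bullet> b"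
    using zero by simp
qed

lemma derivation_const:
  assumes "v \<in> tangent_space A p" shows "v (\<lambda>q. c) = 0"
proof -
  have "v ((\<lambda>q. 1) * (\<lambda>q. 1)) = 1 * v (\<lambda>q. 1) + 1 * v (\<lambda>q. 1)"
    using assms smooth_functions_const[of 1] unfolding tangent_space_def by blast
  moreover have "(\<lambda>q. 1) * (\<lambda>q. 1) = (\<lambda>q::'m. 1::real)" by (simp add: fun_eq_iff)
  ultimately have "v (\<lambda>q. 1) = 0" by simp
  moreover have "v (c *\<^sub>R (\<lambda>q. 1)) = c * v (\<lambda>q. 1)"
    using assms smooth_functions_const[of 1] unfolding tangent_space_def by blast
  moreover have "c *\<^sub>R (\<lambda>q. 1) = (\<lambda>q::'m. c)" by (simp add: fun_eq_iff scaleR_fun_def)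
  ultimately show ?thesis by simp
qed

lemma tangent_space_rules:
  assumes "v \<in> tangent_space A p"
  shows tangent_space_add: "\<And>f h. f \<in> smooth_functions A \<Longrightarrow> h \<in> smooth_functions A \<Longrightarrow> v (f + h) = v f + v h"
    and tangent_space_mult: "\<And>f h. f \<in> smooth_functions A \<Longrightarrow> h \<in> smooth_functions A \<Longrightarrow>
        v (f * h) = f p * v h + h p * v f"
    and tangent_space_scale: "\<And>f c. f \<in> smooth_functions A \<Longrightarrow> v (c *\<^sub>R f) = c * v f"
    and tangent_space_nonsmooth: "\<And>f. f \<notin> smooth_functions A \<Longrightarrow> v f = 0"
  using assms unfolding tangent_space_def by blast+

lemma tangent_space_diff:
  assumes "v \<in> tangent_space A p" "f \<in> smooth_functions A" "h \<in> smooth_functions A"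
  shows "v (f - h) = v f - v h"
proof -
  have "f - h = f + (-1) *\<^sub>R h" by (simp add: fun_eq_iff scaleR_fun_def)
  then show ?thesis
    using assms tangent_space_add[OF assms(1,2) smooth_functions_scale[OF assms(3), of "-1"]]
      tangent_space_scale[OF assms(1,3), of "-1"] by simp
qed

lemma smooth_functions_sum:
  "(\<And>i. i \<in> I \<Longrightarrow> F i \<in> smooth_functions A) \<Longrightarrow> (\<Sum>i\<in>I. F i) \<in> smooth_functions A"
  by (induction I rule: infinite_finite_induct) (auto simp: smooth_functions_zero smooth_functions_add)

lemma sum_fun_apply: "(\<Sum>i\<in>I. F i) x = (\<Sum>i\<in>I. F i x)" for F :: "'i \<Rightarrow> 'a \<Rightarrow> real"
  by (induction I rule: infinite_finite_induct) auto

lemma tangent_space_sum: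
  assumes "v \<in> tangent_space A p" "\<And>i. i \<in> I \<Longrightarrow> F i \<in> smooth_functions A"
  shows "v (\<Sum>i\<in>I. F i) = (\<Sum>i\<in>I. v (F i))"
  using assms(2)
proof (induction I rule: infinite_finite_induct)
  case (insert x I)
  have "v (sum F (insert x I)) = v (F x + sum F I)"
    by (simp only: sum.insert[OF insert.hyps])
  also have "\<dots> = v (F x) + v (sum F I)"
    using insert.prems by (intro tangent_space_add[OF assms(1)] smooth_functions_sum) auto
  also have "\<dots> = (\<Sum>i\<in>insert x I. v (F i))"
    using insert.IH insert.hyps insert.prems by simp
  finally show ?case .
qed (use derivation_const[OF assms(1), of 0] in \<open>auto simp: zero_fun_def\<close>)

text \<open>
  With \<open>\<rho>\<close> a bump function at \<open>p\<close> supported in the chart, the Hadamard lemma gives a global identity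
  \<open>\<rho>\<^sup>2 (f - f p) = \<Sum>\<^sub>b (\<rho> x\<^sub>b) (\<rho> G\<^sub>b)\<close>, where \<open>x\<^sub>b\<close> are the coordinates centred at \<open>p\<close>. Applying a
  derivation and the product rule leaves \<open>v f = \<Sum>\<^sub>b v (\<rho> x\<^sub>b) G\<^sub>b p\<close>.
\<close>

lemma tangent_vector_in_coordinates:
  assumes U: "(U, \<phi>) \<in> A" "p \<in> U" and v: "v \<in> tangent_space A p"
  obtains w where "v = coord_tangent U \<phi> p w"
proof -
  obtain \<epsilon> where \<epsilon>: "\<epsilon> > 0" "cball (\<phi> p) \<epsilon> \<subseteq> \<phi> ` U" by (rule bump_supported_in_chart[OF U])
  \<comment> \<open>Half the radius, so that the support of the bump function lies in an open ball inside the chart.\<close>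
  let ?\<epsilon> = "\<epsilon> / 2" let ?c = "\<phi> p"
  have \<epsilon>2: "?\<epsilon> > 0" "cball ?c ?\<epsilon> \<subseteq> ball ?c \<epsilon>" "cball ?c ?\<epsilon> \<subseteq> \<phi> ` U" using \<epsilon> by auto
  let ?\<rho> = "bump ?c ?\<epsilon>"
  define ext where "ext k q = (if q \<in> U then k (\<phi> q) else 0)" for k :: "'e \<Rightarrow> real" and q
  have ext: "ext (\<lambda>x. ?\<rho> x * k x) \<in> smooth_functions A" if k: "smooth_on (ball ?c \<epsilon>) k" for k
  proof -
    have op: "open (\<phi> ` U)" by (rule chartD[OF U(1)])
    have "smooth_on (\<phi> ` U) (\<lambda>x. ?\<rho> x * k x)"
    proof (rule smooth_on_local)
      fix x assume "x \<in> \<phi> ` U"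
      show "\<exists>T. open T \<and> x \<in> T \<and> smooth_on T (\<lambda>x. ?\<rho> x * k x)"
      proof (cases "x \<in> ball ?c \<epsilon>")
        case True
        then show ?thesis
          by (intro exI[of _ "ball ?c \<epsilon>"] conjI smooth_on_mult k smooth_on_subset[OF smooth_on_bump]) auto
      next
        case False
        have "smooth_on (- cball ?c ?\<epsilon>) (\<lambda>x. ?\<rho> x * k x)"
          by (rule smooth_on_cong[OF _ smooth_on_const[of _ 0]])
            (auto simp: bump_outside[OF \<epsilon>2(1)] open_Compl)
        then show ?thesis using False \<epsilon>2 by (intro exI[of _ "- cball ?c ?\<epsilon>"]) auto
      qed
    qed
    then show ?thesis
      unfolding ext_def[abs_def]
      by (rule smooth_functions_extend_by_zero[OF U(1) _ compact_cball \<epsilon>2(3)])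
        (simp add: bump_outside[OF \<epsilon>2(1)])
  qed
  define \<xi> where "\<xi> b = ext (\<lambda>x. ?\<rho> x * ((x - ?c) \<bullet> b))" for b
  have \<xi>: "\<xi> b \<in> smooth_functions A" for b
    unfolding \<xi>_def
    by (rule ext) (intro smooth_on_bilinear[OF _ bounded_bilinear_inner] smooth_on_diff smooth_on_linear
      bounded_linear_ident smooth_on_const open_ball)
  define w where "w = (\<Sum>b\<in>Basis. v (\<xi> b) *\<^sub>R b)"
  have "v f = coord_tangent U \<phi> p w f" for f
  proof (cases "f \<in> smooth_functions A")
    case False
    then show ?thesis using tangent_space_nonsmooth[OF v] by (simp add: coord_tangent_def)
  next
    case f: True
    let ?f = "\<lambda>x. f (inv_into U \<phi> x)"
    have "smooth_on (ball ?c \<epsilon>) ?f"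
      by (rule smooth_on_subset[OF smooth_functionsD[OF f U(1)]]) (use \<epsilon> in auto)
    then obtain G where G: "\<And>b. smooth_on (ball ?c \<epsilon>) (G b)"
      "\<And>b. G b ?c = frechet_derivative ?f (at ?c) b"
      "\<And>x. x \<in> ball ?c \<epsilon> \<Longrightarrow> ?f x = ?f ?c + (\<Sum>b\<in>Basis. ((x - ?c) \<bullet> b) * G b x)"
      using \<epsilon>(1) by (elim hadamard_lemma[OF open_ball convex_ball, rotated]) auto
    have G_c: "G b ?c = coord_tangent U \<phi> p b f" for b
      using G(2) f by (simp add: coord_tangent_def)
    define \<gamma> where "\<gamma> b = ext (\<lambda>x. ?\<rho> x * G b x)" for b
    have \<gamma>: "\<gamma> b \<in> smooth_functions A" for b unfolding \<gamma>_def by (rule ext[OF G(1)])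
    define \<eta> where "\<eta> = ext (\<lambda>x. ?\<rho> x * 1)"
    have \<eta>: "\<eta> \<in> smooth_functions A" unfolding \<eta>_def by (rule ext) (simp add: smooth_on_const)
    define f0 where "f0 = f - (\<lambda>q. f p)"
    have f0: "f0 \<in> smooth_functions A"
      unfolding f0_def by (rule smooth_functions_diff[OF f smooth_functions_const])
    have "?\<rho> ?c = 1" by (rule bump_center[OF \<epsilon>2(1)])
    then have at_p: "f0 p = 0" "\<eta> p = 1" "\<xi> b p = 0" "\<gamma> b p = coord_tangent U \<phi> p b f" for b
      using U(2) by (simp_all add: f0_def \<eta>_def \<xi>_def \<gamma>_def ext_def G_c)
    have "(\<eta> * \<eta>) * f0 = (\<Sum>b\<in>Basis. \<xi> b * \<gamma> b)"
    proof
      fix q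
      show "((\<eta> * \<eta>) * f0) q = (\<Sum>b\<in>Basis. \<xi> b * \<gamma> b) q"
      proof (cases "q \<in> U \<and> \<phi> q \<in> ball ?c \<epsilon>")
        case True
        then have "f0 q = (\<Sum>b\<in>Basis. ((\<phi> q - ?c) \<bullet> b) * G b (\<phi> q))"
          using G(3)[of "\<phi> q"] chartD(6)[OF U(1)] U(2) by (simp add: f0_def)
        then show ?thesis
          using True by (simp add: \<eta>_def \<xi>_def \<gamma>_def ext_def sum_fun_apply sum_distrib_left algebra_simps)
      next
        case False
        then have "q \<notin> U \<or> \<phi> q \<notin> cball ?c ?\<epsilon>" using \<epsilon>2 by auto
        then have "\<eta> q = 0" "\<And>b. \<xi> b q = 0"
          using bump_outside[OF \<epsilon>2(1)] by (auto simp: \<eta>_def \<xi>_def ext_def)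
        then show ?thesis by (simp add: sum_fun_apply)
      qed
    qed
    then have "v ((\<eta> * \<eta>) * f0) = v (\<Sum>b\<in>Basis. \<xi> b * \<gamma> b)" by simp
    moreover have "v ((\<eta> * \<eta>) * f0) = v f0"
      using tangent_space_mult[OF v smooth_functions_mult[OF \<eta> \<eta>] f0] at_p by simp
    moreover have "v f0 = v f"
      unfolding f0_def using tangent_space_diff[OF v f smooth_functions_const] derivation_const[OF v] by simp
    moreover have "v (\<Sum>b\<in>Basis. \<xi> b * \<gamma> b) = (\<Sum>b\<in>Basis. v (\<xi> b) * coord_tangent U \<phi> p b f)"
      using tangent_space_sum[OF v smooth_functions_mult[OF \<xi> \<gamma>]] tangent_space_mult[OF v \<xi> \<gamma>] at_p
      by (simp add: mult.commute)
    moreover note lin = has_derivative_linear[OF has_derivative_in_chart[OF U f]]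
    have "coord_tangent U \<phi> p w f = (\<Sum>b\<in>Basis. v (\<xi> b) * coord_tangent U \<phi> p b f)"
      unfolding w_def by (subst linear_sum[OF lin]) (simp only: linear_cmul[OF lin] real_scaleR_def)
    ultimately show ?thesis by simp
  qed
  then show ?thesis using that by blast
qed

lemma subspace_tangent_space: "subspace (tangent_space A p)"
  unfolding subspace_def tangent_space_def
  by (auto simp: zero_fun_def plus_fun_def[where 'b = real and 'a = "'m \<Rightarrow> real"]
      scaleR_fun_def[where 'b = real and 'a = "'m \<Rightarrow> real"] algebra_simps)

lemma tangent_space_basis:
  obtains B where "independent B" "card B = DIM('e)" "finite B" "span B = tangent_space A p"
proof -
  obtain U \<phi> where U: "(U, \<phi>) \<in> A" "p \<in> U" by (rule ex_chart)
  let ?D = "coord_tangent U \<phi> p"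
  have inj: "inj ?D"
    using coord_tangent_eq_0D[OF U] linear_coord_tangent[OF U] by (simp add: linear_injective_0)
  have lin: "linear ?D" by (rule linear_coord_tangent[OF U])
  have "independent (?D ` Basis)"
    by (rule linear_independent_injective_image[OF lin independent_Basis inj_on_subset[OF inj subset_UNIV]])
  moreover have "card (?D ` Basis) = DIM('e)"
    by (rule card_image) (use inj in \<open>auto simp: inj_on_def\<close>)
  moreover have "span (?D ` Basis) = range ?D"
    using linear_span_image[OF lin, of Basis] by simp
  moreover have "range ?D = tangent_space A p"
    using coord_tangent_in_tangent_space[OF U] tangent_vector_in_coordinates[OF U] by blast
  ultimately show ?thesis using that[of "?D ` Basis"] by simp
qed

end


section \<open>Left-invariant vector fields\<close>

locale lie_grp =
  fixes A :: "('m::{t2_space,second_countable_topology}, 'e::euclidean_space) atlas"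
    and mul :: "'m \<Rightarrow> 'm \<Rightarrow> 'm" and e :: 'm and iv :: "'m \<Rightarrow> 'm"
  assumes lie_group: "lie_group A mul e iv"

sublocale lie_grp \<subseteq> smooth_mfd A
  by unfold_locales (use lie_group in \<open>simp add: lie_group_def\<close>)

context lie_grp
begin

sublocale mul: group mul e iv
  using lie_group by (simp add: lie_group_def)

lemma mul_e [simp]: "mul e p = p" "mul p e = p"
  by simp_all

lemma continuous_on_mul: "continuous_on UNIV (\<lambda>(p, q). mul p q)"
  using lie_group by (simp add: lie_group_def smooth_map_def)

text \<open>
  Locally the products lie in one chart domain, so that the function is the chart representation of \<open>f\<close>
  after that of the multiplication. Restricting one factor gives the smoothness of left translations,
  differentiating with respect to one factor that of left-invariant extensions.
\<close>

lemma smooth_on_function_of_product: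
  assumes f: "f \<in> smooth_functions A" and U: "(U, \<phi>) \<in> A" and V: "(V, \<psi>) \<in> A"
  shows "smooth_on (\<phi> ` U \<times> \<psi> ` V) (\<lambda>(x, y). f (mul (inv_into U \<phi> x) (inv_into V \<psi> y)))"
proof (rule smooth_on_local)
  let ?m = "\<lambda>(x, y). mul (inv_into U \<phi> x) (inv_into V \<psi> y)"
  fix z assume z: "z \<in> \<phi> ` U \<times> \<psi> ` V"
  obtain W \<xi> where W: "(W, \<xi>) \<in> A" "?m z \<in> W" by (rule ex_chart)
  let ?T = "(\<phi> ` U \<times> \<psi> ` V) \<inter> (?m -` W)"
  let ?P = "map_prod \<phi> \<psi> ` (U \<times> V \<inter> (\<lambda>(p, q). mul p q) -` W)"
  have op: "open (\<phi> ` U \<times> \<psi> ` V)" using chartD(2)[OF U] chartD(2)[OF V] by (rule open_Times)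
  have inv: "continuous_on (\<phi> ` U \<times> \<psi> ` V) (\<lambda>z. (inv_into U \<phi> (fst z), inv_into V \<psi> (snd z)))"
    by (intro continuous_on_Pair continuous_on_compose2[OF chartD(5)[OF U]]
        continuous_on_compose2[OF chartD(5)[OF V]] continuous_on_fst continuous_on_snd continuous_on_id) auto
  have "continuous_on (\<phi> ` U \<times> \<psi> ` V) ?m"
    using continuous_on_compose2[OF continuous_on_mul inv] by (simp add: case_prod_beta)
  then have T: "open ?T" by (rule continuous_open_preimage[OF _ op chartD(1)[OF W(1)]])
  have sub: "?T \<subseteq> ?P"
  proof
    fix z assume "z \<in> ?T"
    then obtain p q where pq: "p \<in> U" "q \<in> V" "z = (\<phi> p, \<psi> q)" "?m z \<in> W" by auto
    then have "mul p q \<in> W" using chartD(6)[OF U] chartD(6)[OF V] by simp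
    then show "z \<in> ?P" using pq by (intro image_eqI[of _ _ "(p, q)"]) auto
  qed
  have inj: "inj_on (map_prod \<phi> \<psi>) (U \<times> V)"
    by (rule inj_onI) (use chartD(6)[OF U] chartD(6)[OF V] in \<open>auto, metis, metis\<close>)
  have inv_prod: "inv_into (U \<times> V) (map_prod \<phi> \<psi>) (x, y) = (inv_into U \<phi> x, inv_into V \<psi> y)"
    if xy: "x \<in> \<phi> ` U" "y \<in> \<psi> ` V" for x y
    using inv_into_f_f[OF inj, of "(inv_into U \<phi> x, inv_into V \<psi> y)"] xy
    by (simp add: f_inv_into_f inv_into_into)
  have "(U \<times> V, map_prod \<phi> \<psi>) \<in> prod_atlas A A" using U V by (auto simp: prod_atlas_def)
  then have "smooth_on ?P (\<xi> \<circ> (\<lambda>(p, q). mul p q) \<circ> inv_into (U \<times> V) (map_prod \<phi> \<psi>))"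
    using lie_group W(1) unfolding lie_group_def smooth_map_def by blast
  then have "smooth_on ?T (\<xi> \<circ> (\<lambda>(p, q). mul p q) \<circ> inv_into (U \<times> V) (map_prod \<phi> \<psi>))"
    by (rule smooth_on_subset[OF _ sub])
  then have "smooth_on ?T (\<lambda>z. \<xi> (?m z))"
    by (rule smooth_on_cong[OF T]) (auto simp: inv_prod)
  then have "smooth_on ?T (\<lambda>z. f (inv_into W \<xi> (\<xi> (?m z))))"
    by (intro smooth_on_compose[OF T chartD(2)[OF W(1)] _ _ smooth_functionsD[OF f W(1)]]) auto
  then have "smooth_on ?T (\<lambda>z. f (?m z))"
    by (rule smooth_on_cong[OF T]) (use chartD(6)[OF W(1)] in auto)
  then have "smooth_on ?T (\<lambda>(x, y). f (mul (inv_into U \<phi> x) (inv_into V \<psi> y)))"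
    by (simp add: case_prod_beta')
  then show "\<exists>T. open T \<and> z \<in> T \<and> smooth_on T (\<lambda>(x, y). f (mul (inv_into U \<phi> x) (inv_into V \<psi> y)))"
    using T z W(2) by (intro exI[of _ ?T]) auto
qed

lemma smooth_functions_left_translate:
  assumes f: "f \<in> smooth_functions A"
  shows "f \<circ> mul a \<in> smooth_functions A"
  unfolding smooth_functions_iff
proof clarify
  fix V \<psi> assume V: "(V, \<psi>) \<in> A"
  obtain U \<phi> where U: "(U, \<phi>) \<in> A" "a \<in> U" by (rule ex_chart)
  have op: "open (\<psi> ` V)" by (rule chartD[OF V])
  have "smooth_on (\<psi> ` V) (\<lambda>y. (\<phi> a, 0) + (0, y))"
    by (intro smooth_on_add smooth_on_const smooth_on_linear op bounded_linear_Pair bounded_linear_zero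
        bounded_linear_ident)
  then have "smooth_on (\<psi> ` V) (\<lambda>y. (\<phi> a, y))" by simp
  from smooth_on_compose[OF op _ _ this smooth_on_function_of_product[OF f U(1) V]]
  show "smooth_on (\<psi> ` V) (\<lambda>y. (f \<circ> mul a) (inv_into V \<psi> y))"
    using U chartD(2)[OF U(1)] chartD(6)[OF U(1)] op by (auto simp: open_Times)
qed

text \<open>
  In charts this function is a partial derivative of \<open>f (p q)\<close> with respect to the coordinates of \<open>q\<close>,
  taken at \<open>q = e\<close>. It makes the left-invariant extension of a tangent vector at \<open>e\<close> a smooth field.
\<close>

lemma smooth_functions_derivative_of_translates:
  assumes f: "f \<in> smooth_functions A" and v: "v \<in> tangent_space A e"
  shows "(\<lambda>p. v (f \<circ> mul p)) \<in> smooth_functions A"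
  unfolding smooth_functions_iff
proof clarify
  fix U \<phi> assume U: "(U, \<phi>) \<in> A"
  obtain V \<psi> where V: "(V, \<psi>) \<in> A" "e \<in> V" by (rule ex_chart)
  obtain w where w: "v = coord_tangent V \<psi> e w" by (rule tangent_vector_in_coordinates[OF V v])
  let ?F = "\<lambda>(x, y). f (mul (inv_into U \<phi> x) (inv_into V \<psi> y))"
  note F = smooth_on_function_of_product[OF f U V(1)]
  have op: "open (\<phi> ` U)" "open (\<psi> ` V)" using chartD(2) U V by auto
  have "smooth_on (\<phi> ` U) (\<lambda>x. (x, 0) + (0, \<psi> e))"
    by (intro smooth_on_add smooth_on_const smooth_on_linear op bounded_linear_Pair bounded_linear_zero
        bounded_linear_ident)
  then have slice: "smooth_on (\<phi> ` U) (\<lambda>x. (x, \<psi> e))" by simp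
  have "smooth_on (\<phi> ` U) (\<lambda>x. frechet_derivative ?F (at (x, \<psi> e)) (0, w))"
    by (rule smooth_on_compose[OF op(1) open_Times[OF op] _ slice smooth_on_derivative[OF F]])
      (use V in auto)
  then show "smooth_on (\<phi> ` U) (\<lambda>x. v (f \<circ> mul (inv_into U \<phi> x)))"
  proof (rule smooth_on_cong[OF op(1)])
    fix x assume x: "x \<in> \<phi> ` U"
    let ?p = "inv_into U \<phi> x"
    have "((\<lambda>y. (x, y)) has_derivative (\<lambda>w. (0, w))) (at (\<psi> e))"
      by (auto intro!: derivative_eq_intros)
    moreover have "(?F has_derivative frechet_derivative ?F (at (x, \<psi> e))) (at (x, \<psi> e))"
      by (rule smooth_on_has_derivative[OF F]) (use x V in auto)
    ultimately have "((\<lambda>y. ?F (x, y)) has_derivative (\<lambda>w. frechet_derivative ?F (at (x, \<psi> e)) (0, w))) (at (\<psi> e))"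
      by (rule has_derivative_compose)
    then have "((\<lambda>y. (f \<circ> mul ?p) (inv_into V \<psi> y)) has_derivative
        (\<lambda>w. frechet_derivative ?F (at (x, \<psi> e)) (0, w))) (at (\<psi> e))"
      by simp
    from coord_tangent_eqI[OF this smooth_functions_left_translate[OF f]]
    show "frechet_derivative ?F (at (x, \<psi> e)) (0, w) = v (f \<circ> mul ?p)"
      by (simp add: w)
  qed
qed

definition left_extend :: "'m tvec \<Rightarrow> 'm vfield" where
  "left_extend v p = differential A A (mul p) v"

lemma left_extend_smooth: "f \<in> smooth_functions A \<Longrightarrow> left_extend v p f = v (f \<circ> mul p)"
  by (simp add: left_extend_def differential_def)

lemma differential_in_tangent_space:
  assumes "v \<in> tangent_space A p"
  shows "differential A A (mul a) v \<in> tangent_space A (mul a p)"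
proof -
  have 1: "(f + h) \<circ> mul a = (f \<circ> mul a) + (h \<circ> mul a)" "(f * h) \<circ> mul a = (f \<circ> mul a) * (h \<circ> mul a)"
    "(c *\<^sub>R f) \<circ> mul a = c *\<^sub>R (f \<circ> mul a)" for f h :: "'m \<Rightarrow> real" and c
    by (auto simp: fun_eq_iff scaleR_fun_def)
  show ?thesis
    unfolding tangent_space_def
    by (auto simp: differential_def smooth_functions_add smooth_functions_mult smooth_functions_scale 1
        tangent_space_add[OF assms] tangent_space_mult[OF assms] tangent_space_scale[OF assms]
        smooth_functions_left_translate)
qed

lemma left_extend_left_invariant:
  assumes v: "v \<in> tangent_space A e"
  shows "left_extend v \<in> left_invariant_fields A mul"
proof -
  have "left_extend v p \<in> tangent_space A p" for p
    using differential_in_tangent_space[OF v, of p] by (simp add: left_extend_def)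
  moreover have "(\<lambda>p. left_extend v p f) \<in> smooth_functions A" if "f \<in> smooth_functions A" for f
    using smooth_functions_derivative_of_translates[OF that v] by (simp add: left_extend_smooth that)
  moreover have "left_extend v (mul a p) = differential A A (mul a) (left_extend v p)" for a p
  proof
    fix f :: "'m \<Rightarrow> real"
    have "f \<circ> mul (mul a p) = f \<circ> mul a \<circ> mul p" by (auto simp: mul.assoc)
    then show "left_extend v (mul a p) f = differential A A (mul a) (left_extend v p) f"
      by (simp add: left_extend_def differential_def smooth_functions_left_translate)
  qed
  ultimately show ?thesis by (auto simp: left_invariant_fields_def vector_fields_def)
qed

lemma differential_e:
  assumes "v \<in> tangent_space A p" shows "differential A A (mul e) v = v"
proof
  fix f :: "'m \<Rightarrow> real"
  have "f \<circ> mul e = f" by (auto simp: o_def)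
  then show "differential A A (mul e) v f = v f"
    using tangent_space_nonsmooth[OF assms] by (simp add: differential_def)
qed

lemma left_extend_at_e: "v \<in> tangent_space A e \<Longrightarrow> left_extend v e = v"
  by (simp add: left_extend_def differential_e)

lemma left_invariant_fieldsD:
  assumes "X \<in> left_invariant_fields A mul"
  shows "X \<in> vector_fields A" "X p \<in> tangent_space A p"
    and "X (mul a p) = differential A A (mul a) (X p)" and "X p = differential A A (mul p) (X e)"
proof -
  show 1: "X (mul a p) = differential A A (mul a) (X p)" for a p
    using assms unfolding left_invariant_fields_def by blast
  show "X \<in> vector_fields A" "X p \<in> tangent_space A p"
    using assms by (auto simp: left_invariant_fields_def vector_fields_def)
  show "X p = differential A A (mul p) (X e)" using 1[of p e] by simp
qed

lemma left_extend_eval: "X \<in> left_invariant_fields A mul \<Longrightarrow> left_extend (X e) = X"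
  by (rule ext) (simp add: left_extend_def left_invariant_fieldsD(4)[symmetric])

lemma vector_fieldsD:
  assumes "X \<in> vector_fields A"
  shows "X p \<in> tangent_space A p" "f \<in> smooth_functions A \<Longrightarrow> (\<lambda>p. X p f) \<in> smooth_functions A"
    and "f \<notin> smooth_functions A \<Longrightarrow> X p f = 0"
  using assms tangent_space_nonsmooth unfolding vector_fields_def by blast+

lemma linear_left_extend: "linear left_extend"
  by (rule linearI; intro ext)
    (auto simp: left_extend_def differential_def plus_fun_def scaleR_fun_def)

lemma left_invariant_fields_eq: "left_invariant_fields A mul = left_extend ` tangent_space A e"
  using left_extend_left_invariant left_extend_eval left_invariant_fieldsD(2) by (force simp: image_iff)

lemma subspace_left_invariant_fields: "subspace (left_invariant_fields A mul)"
  unfolding left_invariant_fields_eq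
  by (rule linear_subspace_image[OF linear_left_extend subspace_tangent_space])

lemma left_invariant_fields_eqI:
  "X \<in> left_invariant_fields A mul \<Longrightarrow> Y \<in> left_invariant_fields A mul \<Longrightarrow> X e = Y e \<Longrightarrow> X = Y"
  by (metis left_extend_eval)


subsection \<open>The Lie bracket\<close>

lemma lie_bracket_vector_field:
  assumes X: "X \<in> vector_fields A" and Y: "Y \<in> vector_fields A"
  shows "lie_bracket X Y \<in> vector_fields A"
proof -
  have XT: "X p \<in> tangent_space A p" and YT: "Y p \<in> tangent_space A p" for p
    using vector_fieldsD(1) X Y by blast+
  have sm: "(\<lambda>q. X q f) \<in> smooth_functions A" "(\<lambda>q. Y q f) \<in> smooth_functions A"
    if "f \<in> smooth_functions A" for f
    using vector_fieldsD(2) X Y that by blast+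
  have D_add: "Z p (\<lambda>q. Z' q (f + h)) = Z p (\<lambda>q. Z' q f) + Z p (\<lambda>q. Z' q h)"
    and D_mult: "Z p (\<lambda>q. Z' q (f * h)) =
      f p * Z p (\<lambda>q. Z' q h) + Z' p h * Z p f + (h p * Z p (\<lambda>q. Z' q f) + Z' p f * Z p h)"
    and D_scale: "Z p (\<lambda>q. Z' q (c *\<^sub>R f)) = c * Z p (\<lambda>q. Z' q f)"
    if ZZ: "Z \<in> vector_fields A" "Z' \<in> vector_fields A"
      and fh: "f \<in> smooth_functions A" "h \<in> smooth_functions A" for Z Z' f h p c
  proof -
    note T = vector_fieldsD(1)[OF ZZ(1), of p] and T' = vector_fieldsD(1)[OF ZZ(2)]
    note f' = vector_fieldsD(2)[OF ZZ(2) fh(1)] and h' = vector_fieldsD(2)[OF ZZ(2) fh(2)]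
    have "(\<lambda>q. Z' q (f + h)) = (\<lambda>q. Z' q f) + (\<lambda>q. Z' q h)"
      using tangent_space_add[OF T' fh] by auto
    then show "Z p (\<lambda>q. Z' q (f + h)) = Z p (\<lambda>q. Z' q f) + Z p (\<lambda>q. Z' q h)"
      using tangent_space_add[OF T f' h'] by simp
    have "(\<lambda>q. Z' q (f * h)) = f * (\<lambda>q. Z' q h) + h * (\<lambda>q. Z' q f)"
      using tangent_space_mult[OF T' fh] by auto
    then have "Z p (\<lambda>q. Z' q (f * h)) = Z p (f * (\<lambda>q. Z' q h)) + Z p (h * (\<lambda>q. Z' q f))"
      using tangent_space_add[OF T smooth_functions_mult[OF fh(1) h'] smooth_functions_mult[OF fh(2) f']] by simp
    then show "Z p (\<lambda>q. Z' q (f * h)) =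
      f p * Z p (\<lambda>q. Z' q h) + Z' p h * Z p f + (h p * Z p (\<lambda>q. Z' q f) + Z' p f * Z p h)"
      unfolding tangent_space_mult[OF T fh(1) h'] tangent_space_mult[OF T fh(2) f'] .
    have "(\<lambda>q. Z' q (c *\<^sub>R f)) = c *\<^sub>R (\<lambda>q. Z' q f)"
      using tangent_space_scale[OF T' fh(1)] by (auto simp: scaleR_fun_def)
    then show "Z p (\<lambda>q. Z' q (c *\<^sub>R f)) = c * Z p (\<lambda>q. Z' q f)"
      using tangent_space_scale[OF T f'] by simp
  qed
  have "lie_bracket X Y p \<in> tangent_space A p" for p
    unfolding tangent_space_def
  proof (safe, goal_cases)
    case (1 f h)
    then show ?case
      unfolding lie_bracket_def D_add[OF X Y 1] D_add[OF Y X 1] by simp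
  next
    case (2 f h)
    then show ?case
      unfolding lie_bracket_def D_mult[OF X Y 2] D_mult[OF Y X 2] by (simp add: algebra_simps)
  next
    case (3 c f)
    then show ?case
      unfolding lie_bracket_def D_scale[OF X Y 3 3] D_scale[OF Y X 3 3] by (simp add: algebra_simps)
  next
    case (4 f)
    then have "(\<lambda>q. Y q f) = (\<lambda>q. 0)" "(\<lambda>q. X q f) = (\<lambda>q. 0)"
      using vector_fieldsD(3) X Y by auto
    then show ?case
      by (simp add: lie_bracket_def derivation_const[OF XT] derivation_const[OF YT])
  qed
  moreover have "(\<lambda>p. lie_bracket X Y p f) \<in> smooth_functions A" if "f \<in> smooth_functions A" for f
    using smooth_functions_diff[OF vector_fieldsD(2)[OF X sm(2)[OF that]] vector_fieldsD(2)[OF Y sm(1)[OF that]]]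
    by (simp add: lie_bracket_def fun_diff_def)
  ultimately show ?thesis by (auto simp: vector_fields_def)
qed

lemma lie_bracket_left_invariant:
  assumes X: "X \<in> left_invariant_fields A mul" and Y: "Y \<in> left_invariant_fields A mul"
  shows "lie_bracket X Y \<in> left_invariant_fields A mul"
proof -
  have vf: "lie_bracket X Y \<in> vector_fields A"
    using lie_bracket_vector_field left_invariant_fieldsD(1) X Y by blast
  have translate: "(\<lambda>q. Z q f) \<circ> mul a = (\<lambda>q. Z q (f \<circ> mul a))"
    if "Z \<in> left_invariant_fields A mul" "f \<in> smooth_functions A" for Z f a
    using left_invariant_fieldsD(3)[OF that(1)] that(2) by (auto simp: differential_def)
  have "lie_bracket X Y (mul a p) f = differential A A (mul a) (lie_bracket X Y p) f" for a p f
  proof (cases "f \<in> smooth_functions A")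
    case False
    then show ?thesis using vector_fieldsD(3)[OF vf] by (simp add: differential_def)
  next
    case True
    then have "(\<lambda>q. X q f) \<in> smooth_functions A" "(\<lambda>q. Y q f) \<in> smooth_functions A"
      using vector_fieldsD(2) left_invariant_fieldsD(1) X Y by blast+
    then show ?thesis
      using True by (simp add: lie_bracket_def left_invariant_fieldsD(3)[OF X] left_invariant_fieldsD(3)[OF Y]
          differential_def translate[OF X] translate[OF Y])
  qed
  then show ?thesis using vf by (auto simp: left_invariant_fields_def)
qed

lemma lie_bracket_add_left:
  assumes "X \<in> vector_fields A" "Y \<in> vector_fields A" "Z \<in> vector_fields A"
  shows "lie_bracket (X + Y) Z = lie_bracket X Z + lie_bracket Y Z"
proof (intro ext)
  fix p f
  show "lie_bracket (X + Y) Z p f = (lie_bracket X Z + lie_bracket Y Z) p f"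
  proof (cases "f \<in> smooth_functions A")
    case True
    have "(\<lambda>q. X q f + Y q f) = (\<lambda>q. X q f) + (\<lambda>q. Y q f)" by auto
    then show ?thesis
      using tangent_space_add[OF vector_fieldsD(1)[OF assms(3)] vector_fieldsD(2)[OF assms(1) True]
          vector_fieldsD(2)[OF assms(2) True]]
      by (simp add: lie_bracket_def)
  next
    case False
    then show ?thesis
      using vector_fieldsD(3)[OF assms(1) False] vector_fieldsD(3)[OF assms(2) False]
        vector_fieldsD(3)[OF assms(3) False] derivation_const[OF vector_fieldsD(1)[OF assms(1)]]
        derivation_const[OF vector_fieldsD(1)[OF assms(2)]] derivation_const[OF vector_fieldsD(1)[OF assms(3)]]
      by (simp add: lie_bracket_def)
  qed
qed

lemma lie_bracket_scale_left:
  assumes "X \<in> vector_fields A" "Z \<in> vector_fields A"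
  shows "lie_bracket (c *\<^sub>R X) Z = c *\<^sub>R lie_bracket X Z"
proof (intro ext)
  fix p f
  show "lie_bracket (c *\<^sub>R X) Z p f = (c *\<^sub>R lie_bracket X Z) p f"
  proof (cases "f \<in> smooth_functions A")
    case True
    have "(\<lambda>q. c * X q f) = c *\<^sub>R (\<lambda>q. X q f)" by (auto simp: scaleR_fun_def)
    then show ?thesis
      using tangent_space_scale[OF vector_fieldsD(1)[OF assms(2)] vector_fieldsD(2)[OF assms(1) True]]
      by (simp add: lie_bracket_def scaleR_fun_def algebra_simps)
  next
    case False
    then show ?thesis
      using vector_fieldsD(3)[OF assms(1) False] vector_fieldsD(3)[OF assms(2) False]
        derivation_const[OF vector_fieldsD(1)[OF assms(1)]] derivation_const[OF vector_fieldsD(1)[OF assms(2)]]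
      by (simp add: lie_bracket_def scaleR_fun_def)
  qed
qed

lemma lie_bracket_antisym: "lie_bracket Y X = - lie_bracket X Y"
  by (auto simp: fun_eq_iff lie_bracket_def)

lemma lie_bracket_jacobi:
  assumes X: "X \<in> vector_fields A" and Y: "Y \<in> vector_fields A" and Z: "Z \<in> vector_fields A"
  shows "lie_bracket X (lie_bracket Y Z) + lie_bracket Y (lie_bracket Z X) + lie_bracket Z (lie_bracket X Y) = 0"
proof (intro ext)
  fix p f
  have br: "lie_bracket X (lie_bracket Y Z) p f =
      X p (\<lambda>q. Y q (\<lambda>r. Z r f)) - X p (\<lambda>q. Z q (\<lambda>r. Y r f))
      - Y p (\<lambda>q. Z q (\<lambda>r. X r f)) + Z p (\<lambda>q. Y q (\<lambda>r. X r f))"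
    if f: "f \<in> smooth_functions A" and "X \<in> vector_fields A" "Y \<in> vector_fields A" "Z \<in> vector_fields A" for X Y Z
  proof -
    have "(\<lambda>q. Y q (\<lambda>r. Z r f) - Z q (\<lambda>r. Y r f)) = (\<lambda>q. Y q (\<lambda>r. Z r f)) - (\<lambda>q. Z q (\<lambda>r. Y r f))"
      by auto
    then show ?thesis
      using tangent_space_diff[OF vector_fieldsD(1)[OF that(2)]
          vector_fieldsD(2)[OF that(3) vector_fieldsD(2)[OF that(4) f]]
          vector_fieldsD(2)[OF that(4) vector_fieldsD(2)[OF that(3) f]]]
      by (simp add: lie_bracket_def)
  qed
  show "(lie_bracket X (lie_bracket Y Z) + lie_bracket Y (lie_bracket Z X) + lie_bracket Z (lie_bracket X Y)) p f = 0 p f"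
  proof (cases "f \<in> smooth_functions A")
    case True
    then show ?thesis using br[OF True X Y Z] br[OF True Y Z X] br[OF True Z X Y] by simp
  next
    case False
    have "lie_bracket X (lie_bracket Y Z) p f = 0" "lie_bracket Y (lie_bracket Z X) p f = 0"
      "lie_bracket Z (lie_bracket X Y) p f = 0"
      by (intro vector_fieldsD(3)[OF _ False] lie_bracket_vector_field X Y Z)+
    then show ?thesis by simp
  qed
qed

end


section \<open>Orthonormal bases\<close>

text \<open>
  Tangent spaces and the Lie algebra are subspaces of function spaces that carry no global inner
  product, so the inner product lives on a subspace.
\<close>

locale inner_product_on =
  fixes L :: "'v::real_vector set" and ip :: "'v \<Rightarrow> 'v \<Rightarrow> real"
  assumes subspace_L: "subspace L"
    and ip_sym: "u \<in> L \<Longrightarrow> v \<in> L \<Longrightarrow> ip u v = ip v u"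
    and ip_add_left: "u \<in> L \<Longrightarrow> v \<in> L \<Longrightarrow> w \<in> L \<Longrightarrow> ip (u + v) w = ip u w + ip v w"
    and ip_scale_left: "u \<in> L \<Longrightarrow> v \<in> L \<Longrightarrow> ip (c *\<^sub>R u) v = c * ip u v"
    and ip_pos: "u \<in> L \<Longrightarrow> u \<noteq> 0 \<Longrightarrow> ip u u > 0"
begin

lemmas L_closed = subspace_0[OF subspace_L] subspace_add[OF subspace_L] subspace_diff[OF subspace_L]
  subspace_scale[OF subspace_L] subspace_neg[OF subspace_L] subspace_sum[OF subspace_L]

lemma ip_add_right: "u \<in> L \<Longrightarrow> v \<in> L \<Longrightarrow> w \<in> L \<Longrightarrow> ip w (u + v) = ip w u + ip w v"
  using ip_add_left[of u v w] ip_sym L_closed by simp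

lemma ip_scale_right: "u \<in> L \<Longrightarrow> v \<in> L \<Longrightarrow> ip u (c *\<^sub>R v) = c * ip u v"
  using ip_scale_left[of v u c] ip_sym L_closed by simp

lemma ip_zero [simp]: "v \<in> L \<Longrightarrow> ip 0 v = 0" "v \<in> L \<Longrightarrow> ip v 0 = 0"
  using ip_scale_left[of 0 v 0] ip_scale_right[of v 0 0] L_closed by simp_all

lemma ip_minus_left: "u \<in> L \<Longrightarrow> v \<in> L \<Longrightarrow> ip (- u) v = - ip u v"
  using ip_scale_left[of u v "-1"] by simp

lemma ip_minus_right: "u \<in> L \<Longrightarrow> v \<in> L \<Longrightarrow> ip u (- v) = - ip u v"
  using ip_scale_right[of u v "-1"] by simp

lemma ip_diff_left: "u \<in> L \<Longrightarrow> v \<in> L \<Longrightarrow> w \<in> L \<Longrightarrow> ip (u - v) w = ip u w - ip v w"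
  using ip_add_left[of u "- v" w] ip_minus_left[of v w] L_closed by simp

lemma ip_diff_right: "u \<in> L \<Longrightarrow> v \<in> L \<Longrightarrow> w \<in> L \<Longrightarrow> ip w (u - v) = ip w u - ip w v"
  using ip_add_right[of u "- v" w] ip_minus_right[of w v] L_closed by simp

lemmas ip_bilinear = ip_add_left ip_add_right ip_scale_left ip_scale_right ip_minus_left ip_minus_right
  ip_diff_left ip_diff_right

lemma ip_sum_left:
  "(\<And>i. i \<in> I \<Longrightarrow> F i \<in> L) \<Longrightarrow> w \<in> L \<Longrightarrow> ip (\<Sum>i\<in>I. F i) w = (\<Sum>i\<in>I. ip (F i) w)"
  by (induction I rule: infinite_finite_induct) (auto simp: ip_add_left L_closed)

lemma orthonormal_basisD:
  assumes "orthonormal_basis ip S vs" "S \<subseteq> L"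
  shows "i < length vs \<Longrightarrow> vs ! i \<in> L" "i < length vs \<Longrightarrow> vs ! i \<in> S" "span (set vs) = S"
    and "i < length vs \<Longrightarrow> j < length vs \<Longrightarrow> ip (vs ! i) (vs ! j) = (if i = j then 1 else 0)"
  using assms span_base[of "vs ! i" "set vs"] by (auto simp: orthonormal_basis_def)

lemma orthogonal_projection_exists:
  assumes on: "orthonormal_basis ip S vs" and S: "S \<subseteq> L" and u: "u \<in> L"
  shows "\<exists>w\<in>S. \<forall>n\<in>S. ip (u - w) n = 0"
proof (intro bexI ballI)
  note onD = orthonormal_basisD[OF on S]
  let ?w = "\<Sum>i<length vs. ip u (vs ! i) *\<^sub>R (vs ! i)"
  have sub: "subspace S" using onD(3) subspace_span by metis
  have w: "?w \<in> S" by (intro subspace_sum[OF sub] subspace_scale[OF sub] onD(2)) simp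
  have perp: "ip (u - ?w) (vs ! j) = 0" if j: "j < length vs" for j
  proof -
    have "ip ?w (vs ! j) = (\<Sum>i<length vs. ip (ip u (vs ! i) *\<^sub>R (vs ! i)) (vs ! j))"
      by (rule ip_sum_left) (use onD(1) j L_closed in auto)
    also have "\<dots> = (\<Sum>i<length vs. if i = j then ip u (vs ! j) else 0)"
      by (rule sum.cong) (use onD j in \<open>auto simp: ip_scale_left\<close>)
    also have "\<dots> = ip u (vs ! j)" using j by simp
    finally show ?thesis using ip_diff_left[of u ?w "vs ! j"] u w S onD(1)[OF j] by auto
  qed
  have uw: "u - ?w \<in> L" using u w S L_closed by blast
  show "?w \<in> S" by (fact w)
  show "ip (u - ?w) n = 0" if "n \<in> S" for n
  proof -
    have "n \<in> span (set vs)" using that onD(3) by simp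
    then have "n \<in> L \<and> ip (u - ?w) n = 0"
    proof (induction rule: span_induct_alt)
      case base
      show ?case using uw L_closed by simp
    next
      case (step c x y)
      then obtain j where "j < length vs" "x = vs ! j" by (auto simp: in_set_conv_nth)
      then show ?case using step perp onD(1) uw L_closed by (simp add: ip_add_right ip_scale_right)
    qed
    then show ?thesis by simp
  qed
qed

lemma gram_schmidt:
  assumes "finite B" "independent B" "B \<subseteq> L"
  shows "\<exists>vs. length vs = card B \<and> orthonormal_basis ip (span B) vs"
  using assms
proof (induction B)
  case empty
  show ?case by (intro exI[of _ "[]"]) (simp add: orthonormal_basis_def)
next
  case (insert b B)
  have b: "b \<in> L" and BL: "span B \<subseteq> L" and nb: "b \<notin> span B"
    using insert span_minimal[OF _ subspace_L] by (auto simp: independent_insert)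
  obtain vs where vs: "length vs = card B" "orthonormal_basis ip (span B) vs"
    using insert by (auto simp: independent_insert)
  note onD = orthonormal_basisD[OF vs(2) BL]
  obtain w where w: "w \<in> span B" "\<And>n. n \<in> span B \<Longrightarrow> ip (b - w) n = 0"
    using orthogonal_projection_exists[OF vs(2) BL b] by blast
  have uL: "b - w \<in> L" using b w BL L_closed by blast
  have "b - w \<noteq> 0" using w nb by auto
  define u where "u = (1 / sqrt (ip (b - w) (b - w))) *\<^sub>R (b - w)"
  have pos: "ip (b - w) (b - w) > 0" by (rule ip_pos[OF uL \<open>b - w \<noteq> 0\<close>])
  have u: "u \<in> L" "ip u u = 1"
    using uL pos L_closed by (simp_all add: u_def ip_scale_left ip_scale_right)
  have perp: "ip u n = 0" "ip n u = 0" if "n \<in> span B" for n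
    using w(2)[OF that] uL that BL ip_sym[of n u] u(1) by (auto simp: u_def ip_scale_left)
  have "orthonormal_basis ip (span (insert b B)) (u # vs)"
    unfolding orthonormal_basis_def
  proof (intro conjI allI impI)
    have "b = sqrt (ip (b - w) (b - w)) *\<^sub>R u + w" using pos by (simp add: u_def)
    moreover have "w \<in> span (insert u (set vs))" "u \<in> span (insert u (set vs))"
      using w(1) onD(3) span_mono[of "set vs" "insert u (set vs)"] by (auto intro: span_base)
    ultimately have "b \<in> span (insert u (set vs))" by (metis span_add span_scale)
    moreover have "B \<subseteq> span (insert u (set vs))"
      using span_superset[of B] onD(3) span_mono[of "set vs" "insert u (set vs)"] by blast
    moreover have "u \<in> span (insert b B)"
      unfolding u_def using w(1) span_mono[of B "insert b B"]
      by (intro span_scale span_diff) (auto intro: span_base)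
    moreover have "set vs \<subseteq> span (insert b B)"
      using span_superset[of "set vs"] onD(3) span_mono[of B "insert b B"] by blast
    ultimately show "span (set (u # vs)) = span (insert b B)"
      by (subst span_eq) auto
    fix i j assume "i < length (u # vs)" "j < length (u # vs)"
    then show "ip ((u # vs) ! i) ((u # vs) ! j) = (if i = j then 1 else 0)"
      using u onD perp by (auto simp: nth_Cons split: nat.splits)
  qed
  then show ?case using vs(1) insert by (intro exI[of _ "u # vs"]) simp
qed

lemma orthonormal_basis_of_subspace:
  assumes "subspace S" "S \<subseteq> L" "finite C" "L \<subseteq> span C"
  obtains vs where "length vs = dim S" "orthonormal_basis ip S vs"
proof -
  obtain B where B: "B \<subseteq> S" "independent B" "S \<subseteq> span B" "card B = dim S"
    by (rule basis_exists)
  have "finite B"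
    using independent_span_bound[OF assms(3) B(2)] B(1) assms(2,4) by blast
  moreover have "span B = S" using B(1,3) span_minimal[OF B(1) assms(1)] by blast
  ultimately show ?thesis
    using gram_schmidt[of B] B assms(2) that by (metis order_trans)
qed

lemma orthonormal_imp_independent:
  assumes L: "set vs \<subseteq> L"
    and on: "\<And>i j. i < length vs \<Longrightarrow> j < length vs \<Longrightarrow> ip (vs ! i) (vs ! j) = (if i = j then 1 else 0)"
  shows "distinct vs" "independent (set vs)"
proof -
  show "distinct vs"
    unfolding distinct_conv_nth using on by (metis zero_neq_one)
  have on': "ip v w = (if v = w then 1 else 0)" if "v \<in> set vs" "w \<in> set vs" for v w
    using that on \<open>distinct vs\<close> by (auto simp: in_set_conv_nth nth_eq_iff_index_eq)
  show "independent (set vs)"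
  proof
    assume "dependent (set vs)"
    then obtain c v where c: "v \<in> set vs" "c v \<noteq> 0" "(\<Sum>w\<in>set vs. c w *\<^sub>R w) = 0"
      by (auto simp: dependent_finite)
    have "0 = ip (\<Sum>w\<in>set vs. c w *\<^sub>R w) v" using c L by auto
    also have "\<dots> = (\<Sum>w\<in>set vs. ip (c w *\<^sub>R w) v)"
      by (rule ip_sum_left) (use L c L_closed in auto)
    also have "\<dots> = (\<Sum>w\<in>set vs. if w = v then c v else 0)"
      by (rule sum.cong) (use L c on' in \<open>auto simp: ip_scale_left subset_iff\<close>)
    also have "\<dots> = c v" using c by simp
    finally show False using c by simp
  qed
qed

end


section \<open>Metric Lie algebras with a conformal minimal splitting\<close>

text \<open>
  The left-invariant content of the geometric hypotheses: \<open>V\<close> consists of the vertical and \<open>H\<close> of the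
  horizontal left-invariant fields. The hypothesis \<open>conformal\<close> expresses \<open>B\<^sup>H = g \<otimes> N\<close> for the second
  fundamental form of \<open>H\<close>, with \<open>\<mu> = g(N, \<cdot>)\<close>, and \<open>minimal\<close> expresses that the second fundamental form of
  \<open>V\<close> is traceless.
\<close>

locale conformal_minimal_splitting = inner_product_on L ip
  for L :: "'v::real_vector set" and ip +
  fixes br :: "'v \<Rightarrow> 'v \<Rightarrow> 'v" and V H :: "'v set" and \<mu> :: "'v \<Rightarrow> real"
  assumes br_closed: "u \<in> L \<Longrightarrow> v \<in> L \<Longrightarrow> br u v \<in> L"
    and br_add_left: "u \<in> L \<Longrightarrow> v \<in> L \<Longrightarrow> w \<in> L \<Longrightarrow> br (u + v) w = br u w + br v w"
    and br_scale_left: "u \<in> L \<Longrightarrow> v \<in> L \<Longrightarrow> br (c *\<^sub>R u) v = c *\<^sub>R br u v"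
    and br_antisym: "u \<in> L \<Longrightarrow> v \<in> L \<Longrightarrow> br v u = - br u v"
    and jacobi: "u \<in> L \<Longrightarrow> v \<in> L \<Longrightarrow> w \<in> L \<Longrightarrow> br u (br v w) + br v (br w u) + br w (br u v) = 0"
    and V_sub: "V \<subseteq> L" and H_sub: "H \<subseteq> L"
    and orth: "u \<in> V \<Longrightarrow> x \<in> H \<Longrightarrow> ip u x = 0"
    and L_span: "L = span (V \<union> H)"
    and V_br: "u \<in> V \<Longrightarrow> v \<in> V \<Longrightarrow> br u v \<in> V"
    and conformal: "u \<in> V \<Longrightarrow> x \<in> H \<Longrightarrow> y \<in> H \<Longrightarrow> ip (br u x) y + ip (br u y) x = 2 * ip x y * \<mu> u"
    and minimal: "x \<in> H \<Longrightarrow> span {u, v} = V \<Longrightarrow> ip u u = 1 \<Longrightarrow> ip v v = 1 \<Longrightarrow> ip u v = 0 \<Longrightarrow>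
      ip (br u x) u + ip (br v x) v = 0"
begin

definition frame :: "'v \<Rightarrow> 'v \<Rightarrow> 'v \<Rightarrow> 'v \<Rightarrow> bool" where
  "frame X Y Z W \<longleftrightarrow> span {X, Y} = H \<and> span {Z, W} = V \<and>
     ip X X = 1 \<and> ip Y Y = 1 \<and> ip X Y = 0 \<and> ip Z Z = 1 \<and> ip W W = 1 \<and> ip Z W = 0"

lemma frameD:
  assumes "frame X Y Z W"
  shows "X \<in> H" "Y \<in> H" "Z \<in> V" "W \<in> V" "X \<in> L" "Y \<in> L" "Z \<in> L" "W \<in> L"
    and "ip X X = 1" "ip Y Y = 1" "ip Z Z = 1" "ip W W = 1"
    and "ip X Y = 0" "ip Y X = 0" "ip Z W = 0" "ip W Z = 0"
    and "ip X Z = 0" "ip Z X = 0" "ip X W = 0" "ip W X = 0"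
    and "ip Y Z = 0" "ip Z Y = 0" "ip Y W = 0" "ip W Y = 0"
proof -
  have m: "X \<in> H" "Y \<in> H" "Z \<in> V" "W \<in> V"
    using assms span_superset[of "{X, Y}"] span_superset[of "{Z, W}"] by (auto simp: frame_def)
  then have l: "X \<in> L" "Y \<in> L" "Z \<in> L" "W \<in> L" using V_sub H_sub by auto
  show "X \<in> H" "Y \<in> H" "Z \<in> V" "W \<in> V" "X \<in> L" "Y \<in> L" "Z \<in> L" "W \<in> L" by (fact m l)+
  show "ip X X = 1" "ip Y Y = 1" "ip Z Z = 1" "ip W W = 1" "ip X Y = 0" "ip Z W = 0"
    using assms by (auto simp: frame_def)
  then show "ip Y X = 0" "ip W Z = 0" using ip_sym l by metis+
  show *: "ip Z X = 0" "ip W X = 0" "ip Z Y = 0" "ip W Y = 0" using orth m by auto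
  show "ip X Z = 0" "ip X W = 0" "ip Y Z = 0" "ip Y W = 0" using * ip_sym l by metis+
qed

lemma rotate_span:
  fixes X Y :: 'v
  assumes "c\<^sup>2 + s\<^sup>2 = 1"
  shows "span {c *\<^sub>R X + s *\<^sub>R Y, (- s) *\<^sub>R X + c *\<^sub>R Y} = span {X, Y}"
proof (subst span_eq, intro conjI subsetI)
  let ?S = "{c *\<^sub>R X + s *\<^sub>R Y, (- s) *\<^sub>R X + c *\<^sub>R Y}"
  fix x assume "x \<in> ?S"
  then show "x \<in> span {X, Y}" by (auto intro!: span_add span_diff span_scale span_neg intro: span_base)
next
  let ?S = "{c *\<^sub>R X + s *\<^sub>R Y, (- s) *\<^sub>R X + c *\<^sub>R Y}"
  fix x assume x: "x \<in> {X, Y}"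
  have 1: "c * c + s * s = 1" using assms by (simp add: power2_eq_square)
  have "c *\<^sub>R (c *\<^sub>R X + s *\<^sub>R Y) - s *\<^sub>R ((- s) *\<^sub>R X + c *\<^sub>R Y) = (c * c + s * s) *\<^sub>R X"
    "s *\<^sub>R (c *\<^sub>R X + s *\<^sub>R Y) + c *\<^sub>R ((- s) *\<^sub>R X + c *\<^sub>R Y) = (c * c + s * s) *\<^sub>R Y"
    by (simp_all add: algebra_simps)
  then have "X = c *\<^sub>R (c *\<^sub>R X + s *\<^sub>R Y) - s *\<^sub>R ((- s) *\<^sub>R X + c *\<^sub>R Y)"
    "Y = s *\<^sub>R (c *\<^sub>R X + s *\<^sub>R Y) + c *\<^sub>R ((- s) *\<^sub>R X + c *\<^sub>R Y)"
    unfolding 1 by simp_all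
  moreover have "c *\<^sub>R (c *\<^sub>R X + s *\<^sub>R Y) - s *\<^sub>R ((- s) *\<^sub>R X + c *\<^sub>R Y) \<in> span ?S"
    "s *\<^sub>R (c *\<^sub>R X + s *\<^sub>R Y) + c *\<^sub>R ((- s) *\<^sub>R X + c *\<^sub>R Y) \<in> span ?S"
    by (intro span_add span_diff span_scale span_base insertI1 insertI2)+
  ultimately show "x \<in> span ?S" using x by (metis insertE singletonD)
qed

lemma rotate_orthonormal:
  assumes "X \<in> L" "Y \<in> L" "ip X X = 1" "ip Y Y = 1" "ip X Y = 0" "c\<^sup>2 + s\<^sup>2 = 1"
  shows "ip (c *\<^sub>R X + s *\<^sub>R Y) (c *\<^sub>R X + s *\<^sub>R Y) = 1"
    and "ip ((- s) *\<^sub>R X + c *\<^sub>R Y) ((- s) *\<^sub>R X + c *\<^sub>R Y) = 1"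
    and "ip (c *\<^sub>R X + s *\<^sub>R Y) ((- s) *\<^sub>R X + c *\<^sub>R Y) = 0"
  using assms ip_sym[of X Y] by (auto simp: ip_bilinear L_closed power2_eq_square)

lemma frame_rotate_H:
  assumes "frame X Y Z W" "c\<^sup>2 + s\<^sup>2 = 1"
  shows "frame (c *\<^sub>R X + s *\<^sub>R Y) ((- s) *\<^sub>R X + c *\<^sub>R Y) Z W"
  using assms rotate_orthonormal[OF frameD(5,6,9,10,13)[OF assms(1)] assms(2)] rotate_span[OF assms(2), of X Y]
  unfolding frame_def by simp

lemma frame_rotate_V:
  assumes "frame X Y Z W" "c\<^sup>2 + s\<^sup>2 = 1"
  shows "frame X Y (c *\<^sub>R Z + s *\<^sub>R W) ((- s) *\<^sub>R Z + c *\<^sub>R W)"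
  using assms rotate_orthonormal[OF frameD(7,8,11,12,15)[OF assms(1)] assms(2)] rotate_span[OF assms(2), of Z W]
  unfolding frame_def by simp

lemma exists_rotation:
  fixes p q :: real
  obtains c s where "c\<^sup>2 + s\<^sup>2 = 1" "c * q = s * p"
proof (cases "p = 0 \<and> q = 0")
  case True
  then show ?thesis using that[of 1 0] by simp
next
  case False
  then have "p\<^sup>2 + q\<^sup>2 > 0" by (simp add: sum_power2_gt_zero_iff)
  then have "(p / sqrt (p\<^sup>2 + q\<^sup>2))\<^sup>2 + (q / sqrt (p\<^sup>2 + q\<^sup>2))\<^sup>2 = 1"
    using False by (simp add: power_divide add_divide_distrib[symmetric])
  then show ?thesis using that by (simp add: mult.commute)
qed

lemma span_two: 
  fixes a b :: 'v
  assumes "u \<in> span {a, b}" obtains k l where "u = k *\<^sub>R a + l *\<^sub>R b"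
proof -
  from assms obtain k where "u - k *\<^sub>R a \<in> span {b}" by (auto simp: span_insert[of a])
  then obtain l where "u - k *\<^sub>R a = l *\<^sub>R b" by (auto simp: span_singleton)
  then have "u = k *\<^sub>R a + l *\<^sub>R b" by (simp add: algebra_simps)
  then show ?thesis by (rule that)
qed

lemma frame_span:
  assumes "frame X Y Z W" shows "span {X, Y, Z, W} = L"
proof -
  have "V \<subseteq> span {X, Y, Z, W}" "H \<subseteq> span {X, Y, Z, W}"
    using assms span_mono[of "{Z, W}" "{X, Y, Z, W}"] span_mono[of "{X, Y}" "{X, Y, Z, W}"]
    by (auto simp: frame_def)
  then have "L \<subseteq> span {X, Y, Z, W}" unfolding L_span by (intro span_minimal) auto
  moreover have "span {X, Y, Z, W} \<subseteq> L"
    using frameD[OF assms] by (intro span_minimal subspace_L) auto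
  ultimately show ?thesis by blast
qed

lemma frame_expand_V:
  assumes f: "frame X Y Z W" and "u \<in> V"
  shows "u = ip u Z *\<^sub>R Z + ip u W *\<^sub>R W"
proof -
  note F = frameD[OF f]
  have "u \<in> span {Z, W}" using assms by (simp add: frame_def)
  then obtain k l where "u = k *\<^sub>R Z + l *\<^sub>R W" by (rule span_two)
  then show ?thesis using F by (simp add: ip_bilinear L_closed)
qed

lemma frame_expand:
  assumes f: "frame X Y Z W" and "u \<in> L"
  shows "u = ip u X *\<^sub>R X + ip u Y *\<^sub>R Y + ip u Z *\<^sub>R Z + ip u W *\<^sub>R W"
proof -
  note F = frameD[OF f]
  from assms frame_span[OF f] obtain x where "u - x *\<^sub>R X \<in> span {Y, Z, W}"
    by (auto simp: span_insert[of X])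
  then obtain y where "u - x *\<^sub>R X - y *\<^sub>R Y \<in> span {Z, W}" by (auto simp: span_insert[of Y])
  then obtain z w where "u - x *\<^sub>R X - y *\<^sub>R Y = z *\<^sub>R Z + w *\<^sub>R W" by (rule span_two)
  then have "u = x *\<^sub>R X + y *\<^sub>R Y + z *\<^sub>R Z + w *\<^sub>R W" by (simp add: algebra_simps)
  then show ?thesis using F by (simp add: ip_bilinear L_closed)
qed

lemma br_self: "u \<in> L \<Longrightarrow> br u u = 0"
  using br_antisym[of u u] by (simp add: eq_neg_iff_add_eq_0 flip: scaleR_2)

lemma br_minus_left: "u \<in> L \<Longrightarrow> v \<in> L \<Longrightarrow> br (- u) v = - br u v"
  using br_scale_left[of u v "-1"] by simp

lemma br_diff_left: "u \<in> L \<Longrightarrow> v \<in> L \<Longrightarrow> w \<in> L \<Longrightarrow> br (u - v) w = br u w - br v w"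
  using br_add_left[of u "- v" w] br_minus_left[of v w] L_closed by simp

lemma br_add_right: "u \<in> L \<Longrightarrow> v \<in> L \<Longrightarrow> w \<in> L \<Longrightarrow> br w (u + v) = br w u + br w v"
  using br_add_left[of u v w] br_antisym[of u w] br_antisym[of v w] br_antisym[of "u + v" w] L_closed by simp

lemma br_scale_right: "u \<in> L \<Longrightarrow> v \<in> L \<Longrightarrow> br u (c *\<^sub>R v) = c *\<^sub>R br u v"
  using br_scale_left[of v u c] br_antisym[of v u] br_antisym[of "c *\<^sub>R v" u] L_closed by simp

text \<open>The bracket of the two vectors of an oriented orthonormal pair depends on their plane only.\<close>

lemma br_rotate:
  assumes "X \<in> L" "Y \<in> L" "c\<^sup>2 + s\<^sup>2 = 1"
  shows "br ((- s) *\<^sub>R X + c *\<^sub>R Y) (c *\<^sub>R X + s *\<^sub>R Y) = br Y X"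
proof -
  have 1: "c * c + s * s = 1" using assms(3) by (simp add: power2_eq_square)
  have "br ((- s) *\<^sub>R X + c *\<^sub>R Y) (c *\<^sub>R X + s *\<^sub>R Y) = (c * c + s * s) *\<^sub>R br Y X"
    using assms br_antisym[of Y X]
    by (simp add: br_add_left br_diff_left br_add_right br_scale_left br_scale_right L_closed br_self scaleR_left_distrib)
  then show ?thesis unfolding 1 by simp
qed

end


context conformal_minimal_splitting
begin

text \<open>
  The general shape of the brackets in a frame whose pairs \<open>(X, Y)\<close> and \<open>(Z, W)\<close> have been rotated so that
  \<open>[Y, X]\<close> has no component along \<open>Y\<close> and \<open>[W, Z]\<close> none along \<open>Z\<close>. Conformality is visible in the repeated
  coefficients \<open>\<alpha>, \<beta>\<close> and \<open>a, b\<close>, and minimality in the coefficients \<open>- z1\<close> and \<open>- z2\<close>.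
\<close>

definition gauged_frame :: "'v \<Rightarrow> 'v \<Rightarrow> 'v \<Rightarrow> 'v \<Rightarrow> real \<Rightarrow> real \<Rightarrow> real \<Rightarrow> real \<Rightarrow>
    real \<Rightarrow> real \<Rightarrow> real \<Rightarrow> real \<Rightarrow> real \<Rightarrow> real \<Rightarrow> real \<Rightarrow> real \<Rightarrow> real \<Rightarrow> real \<Rightarrow> bool" where
  "gauged_frame X Y Z W \<alpha> \<beta> a b z1 w1 z2 w2 z3 z4 \<kappa> r \<theta>1 \<theta>2 \<longleftrightarrow> frame X Y Z W \<and>
     br W Z = \<kappa> *\<^sub>R W \<and>
     br Z X = \<alpha> *\<^sub>R X + \<beta> *\<^sub>R Y + z1 *\<^sub>R Z + w1 *\<^sub>R W \<and>
     br Z Y = (- \<beta>) *\<^sub>R X + \<alpha> *\<^sub>R Y + z2 *\<^sub>R Z + w2 *\<^sub>R W \<and>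
     br W X = a *\<^sub>R X + b *\<^sub>R Y + z3 *\<^sub>R Z + (- z1) *\<^sub>R W \<and>
     br W Y = (- b) *\<^sub>R X + a *\<^sub>R Y + z4 *\<^sub>R Z + (- z2) *\<^sub>R W \<and>
     br Y X = r *\<^sub>R X + \<theta>1 *\<^sub>R Z + \<theta>2 *\<^sub>R W"

lemma frame_conformal:
  assumes f: "frame X Y Z W" and u: "u \<in> V"
  shows "ip (br u X) X = ip (br u Y) Y" "ip (br u Y) X = - ip (br u X) Y"
  using conformal[OF u frameD(1,1)[OF f]] conformal[OF u frameD(2,2)[OF f]]
    conformal[OF u frameD(1,2)[OF f]] frameD(9,10,13)[OF f] by simp_all

lemma frame_minimal:
  assumes f: "frame X Y Z W"
  shows "ip (br W X) W = - ip (br Z X) Z" "ip (br W Y) W = - ip (br Z Y) Z"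
  using minimal[OF frameD(1)[OF f], of Z W] minimal[OF frameD(2)[OF f], of Z W] f
  unfolding frame_def by simp_all

text \<open>
  Rotations inside \<open>H\<close> and inside \<open>V\<close> remove one component each from \<open>[Y, X]\<close> and \<open>[W, Z]\<close>.
\<close>

lemma gauged_frameI:
  assumes f: "frame X Y Z W" and "ip (br W Z) Z = 0" "ip (br Y X) Y = 0"
  shows "gauged_frame X Y Z W (ip (br Z X) X) (ip (br Z X) Y) (ip (br W X) X) (ip (br W X) Y)
    (ip (br Z X) Z) (ip (br Z X) W) (ip (br Z Y) Z) (ip (br Z Y) W) (ip (br W X) Z) (ip (br W Y) Z)
    (ip (br W Z) W) (ip (br Y X) X) (ip (br Y X) Z) (ip (br Y X) W)"
proof -
  note F = frameD[OF f]
  have "br W Z = ip (br W Z) W *\<^sub>R W"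
    using frame_expand_V[OF f V_br[OF F(4,3)]] assms(2) by simp
  then show ?thesis
    unfolding gauged_frame_def
    using f frame_expand[OF f br_closed[OF F(7,5)]] frame_expand[OF f br_closed[OF F(7,6)]]
      frame_expand[OF f br_closed[OF F(8,5)]] frame_expand[OF f br_closed[OF F(8,6)]]
      frame_expand[OF f br_closed[OF F(6,5)]] assms(3)
      frame_conformal[OF f F(3)] frame_conformal[OF f F(4)] frame_minimal[OF f]
    by simp
qed

lemma ex_frame_gauged_H:
  assumes f: "frame X Y Z W"
  obtains X' Y' where "frame X' Y' Z W" "ip (br Y' X') Y' = 0"
proof -
  note F = frameD[OF f]
  obtain c s where cs: "c\<^sup>2 + s\<^sup>2 = 1" "c * ip (br Y X) Y = s * ip (br Y X) X"
    by (rule exists_rotation)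
  have "ip (br Y X) ((- s) *\<^sub>R X + c *\<^sub>R Y) = 0"
    using cs(2) F br_closed[OF F(6,5)] by (simp add: ip_bilinear L_closed)
  then show ?thesis
    using that[OF frame_rotate_H[OF f cs(1)]] br_rotate[OF F(5,6) cs(1)] by simp
qed

lemma ex_frame_gauged_V:
  assumes f: "frame X Y Z W"
  obtains Z' W' where "frame X Y Z' W'" "ip (br W' Z') Z' = 0"
proof -
  note F = frameD[OF f]
  obtain c s where cs: "c\<^sup>2 + s\<^sup>2 = 1" "c * ip (br W Z) Z = s * (- ip (br W Z) W)"
    by (rule exists_rotation)
  have "ip (br W Z) (c *\<^sub>R Z + s *\<^sub>R W) = 0"
    using cs(2) F br_closed[OF F(8,7)] by (simp add: ip_bilinear L_closed)
  then show ?thesis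
    using that[OF frame_rotate_V[OF f cs(1)]] br_rotate[OF F(7,8) cs(1)] by simp
qed

text \<open>
  With \<open>A = \<alpha> + i\<beta>\<close>, \<open>B = a + ib\<close>, \<open>\<zeta>\<^sub>1 = z1 + i z2\<close>, \<open>\<zeta>\<^sub>3 = z3 + i z4\<close>, \<open>\<omega> = w1 + i w2\<close> and a star for
  the complex conjugate, the equations say: \<open>\<kappa> B = 0\<close>, \<open>(\<kappa> - A\<^sup>*) \<zeta>\<^sub>3 + B\<^sup>* \<zeta>\<^sub>1 = 0\<close>,
  \<open>(A\<^sup>* - \<kappa>) \<zeta>\<^sub>1 + B\<^sup>* \<omega> = 0\<close>, \<open>A \<zeta>\<^sub>1 + B \<omega> = - i r A\<^sup>*\<close>, \<open>A \<zeta>\<^sub>3 - B \<zeta>\<^sub>1 = - i r B\<^sup>*\<close>, followed by four real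
  equations for the vertical part \<open>\<theta>1 Z + \<theta>2 W\<close> of \<open>[Y, X]\<close>.
\<close>

lemma jacobi_equations:
  assumes "gauged_frame X Y Z W \<alpha> \<beta> a b z1 w1 z2 w2 z3 z4 \<kappa> r \<theta>1 \<theta>2"
  shows "\<kappa> * a = 0" "\<kappa> * b = 0"
    and "(\<kappa> - \<alpha>) * z3 - \<beta> * z4 + a * z1 + b * z2 = 0"
    and "(\<kappa> - \<alpha>) * z4 + \<beta> * z3 + a * z2 - b * z1 = 0"
    and "(\<alpha> - \<kappa>) * z1 + \<beta> * z2 + a * w1 + b * w2 = 0"
    and "(\<alpha> - \<kappa>) * z2 - \<beta> * z1 + a * w2 - b * w1 = 0"
    and "\<alpha> * z1 - \<beta> * z2 + a * w1 - b * w2 + r * \<beta> = 0"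
    and "\<alpha> * z2 + \<beta> * z1 + a * w2 + b * w1 + r * \<alpha> = 0"
    and "\<alpha> * z3 - \<beta> * z4 - a * z1 + b * z2 + r * b = 0"
    and "\<alpha> * z4 + \<beta> * z3 - a * z2 - b * z1 + r * a = 0"
    and "r * z1 = 2 * \<alpha> * \<theta>1 + w2 * z3 - w1 * z4"
    and "r * w1 - \<kappa> * \<theta>2 = 2 * \<alpha> * \<theta>2 + 2 * (z2 * w1 - z1 * w2)"
    and "r * z3 = 2 * a * \<theta>1 + 2 * (z1 * z4 - z2 * z3)"
    and "- r * z1 + \<kappa> * \<theta>1 = 2 * a * \<theta>2 + z4 * w1 - z3 * w2"
proof -
  define lc where "lc x y z w = x *\<^sub>R X + y *\<^sub>R Y + z *\<^sub>R Z + w *\<^sub>R W" for x y z w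
  have f: "frame X Y Z W" using assms by (simp add: gauged_frame_def)
  note F = frameD[OF f]
  have lc_add: "lc x y z w + lc x' y' z' w' = lc (x + x') (y + y') (z + z') (w + w')"
    and lc_scale: "k *\<^sub>R lc x y z w = lc (k * x) (k * y) (k * z) (k * w)" for k x y z w x' y' z' w'
    by (simp_all add: lc_def algebra_simps)
  have lc_0: "x = 0 \<and> y = 0 \<and> z = 0 \<and> w = 0" if "lc x y z w = 0" for x y z w
  proof -
    have "ip (lc x y z w) X = x" "ip (lc x y z w) Y = y" "ip (lc x y z w) Z = z" "ip (lc x y z w) W = w"
      unfolding lc_def using F by (simp_all add: ip_bilinear L_closed)
    then show ?thesis using that F by simp
  qed
  have br_lc: "br (lc x y z w) u = x *\<^sub>R br X u + y *\<^sub>R br Y u + z *\<^sub>R br Z u + w *\<^sub>R br W u"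
    if "u \<in> L" for x y z w u
    unfolding lc_def using F that by (simp add: br_add_left br_scale_left L_closed)
  have neg: "- lc x y z w = lc (- x) (- y) (- z) (- w)" for x y z w by (simp add: lc_def)
  have B: "br W Z = lc 0 0 0 \<kappa>" "br Z X = lc \<alpha> \<beta> z1 w1" "br Z Y = lc (- \<beta>) \<alpha> z2 w2"
    "br W X = lc a b z3 (- z1)" "br W Y = lc (- b) a z4 (- z2)" "br Y X = lc r 0 \<theta>1 \<theta>2"
    using assms by (simp_all add: lc_def gauged_frame_def)
  have B': "br Z W = lc 0 0 0 (- \<kappa>)" "br X Z = lc (- \<alpha>) (- \<beta>) (- z1) (- w1)"
    "br Y Z = lc \<beta> (- \<alpha>) (- z2) (- w2)" "br X W = lc (- a) (- b) (- z3) z1"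
    "br Y W = lc b (- a) (- z4) z2" "br X Y = lc (- r) 0 (- \<theta>1) (- \<theta>2)"
    using br_antisym[OF F(8,7)] br_antisym[OF F(7,5)] br_antisym[OF F(7,6)] br_antisym[OF F(8,5)]
      br_antisym[OF F(8,6)] br_antisym[OF F(6,5)] by (simp_all add: B neg)
  have B0: "br X X = lc 0 0 0 0" "br Y Y = lc 0 0 0 0" "br Z Z = lc 0 0 0 0" "br W W = lc 0 0 0 0"
    using F by (simp_all add: br_self lc_def)
  have jac: "br (br v w) u + br (br w u) v + br (br u v) w = 0" if "u \<in> L" "v \<in> L" "w \<in> L" for u v w
  proof -
    have "br (br v w) u + br (br w u) v + br (br u v) w
        = - (br u (br v w) + br v (br w u) + br w (br u v))"
      using br_antisym[OF that(1) br_closed[OF that(2,3)]] br_antisym[OF that(2) br_closed[OF that(3,1)]]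
        br_antisym[OF that(3) br_closed[OF that(1,2)]] by simp
    then show ?thesis using jacobi[OF that] by simp
  qed
  note eval = B B' B0 br_lc[OF F(5)] br_lc[OF F(6)] br_lc[OF F(7)] br_lc[OF F(8)] lc_scale lc_add
  note J1 = jac[OF F(5,8,7), unfolded eval, THEN lc_0]
  note J2 = jac[OF F(6,8,7), unfolded eval, THEN lc_0]
  note J3 = jac[OF F(7,6,5), unfolded eval, THEN lc_0]
  note J4 = jac[OF F(8,6,5), unfolded eval, THEN lc_0]
  show "\<kappa> * a = 0" "\<kappa> * b = 0" "(\<kappa> - \<alpha>) * z3 - \<beta> * z4 + a * z1 + b * z2 = 0"
    "(\<alpha> - \<kappa>) * z1 + \<beta> * z2 + a * w1 + b * w2 = 0"
    using J1 by algebra+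
  show "(\<kappa> - \<alpha>) * z4 + \<beta> * z3 + a * z2 - b * z1 = 0"
    "(\<alpha> - \<kappa>) * z2 - \<beta> * z1 + a * w2 - b * w1 = 0"
    using J2 by algebra+
  show "\<alpha> * z1 - \<beta> * z2 + a * w1 - b * w2 + r * \<beta> = 0"
    "\<alpha> * z2 + \<beta> * z1 + a * w2 + b * w1 + r * \<alpha> = 0"
    "r * z1 = 2 * \<alpha> * \<theta>1 + w2 * z3 - w1 * z4"
    "r * w1 - \<kappa> * \<theta>2 = 2 * \<alpha> * \<theta>2 + 2 * (z2 * w1 - z1 * w2)"
    using J3 by algebra+
  show "\<alpha> * z3 - \<beta> * z4 - a * z1 + b * z2 + r * b = 0"
    "\<alpha> * z4 + \<beta> * z3 - a * z2 - b * z1 + r * a = 0"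
    "r * z3 = 2 * a * \<theta>1 + 2 * (z1 * z4 - z2 * z3)"
    "- r * z1 + \<kappa> * \<theta>1 = 2 * a * \<theta>2 + z4 * w1 - z3 * w2"
    using J4 by algebra+
qed

end


section \<open>Solving the Jacobi equations\<close>

definition in_families :: "('v::real_vector \<Rightarrow> 'v \<Rightarrow> 'v) \<Rightarrow> 'v \<Rightarrow> 'v \<Rightarrow> 'v \<Rightarrow> 'v \<Rightarrow> bool" where
  "in_families br X Y Z W \<longleftrightarrow>
        ((\<exists>\<kappa> r w1 w2. lie_g1 br X Y Z W \<kappa> r w1 w2) \<or>
        (\<exists>\<kappa> \<alpha> \<beta> w1 w2. lie_g2 br X Y Z W \<kappa> \<alpha> \<beta> w1 w2) \<or>
        (\<exists>\<alpha> \<beta> w1 w2 \<theta>2. lie_g3 br X Y Z W \<alpha> \<beta> w1 w2 \<theta>2) \<or>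
        (\<exists>\<kappa> z2 w1 w2. lie_g4 br X Y Z W \<kappa> z2 w1 w2) \<or>
        (\<exists>\<alpha> a \<beta> b r. lie_g5 br X Y Z W \<alpha> a \<beta> b r) \<or>
        (\<exists>z1 z2 z3 r \<theta>1 \<theta>2. lie_g6 br X Y Z W z1 z2 z3 r \<theta>1 \<theta>2) \<or>
        (\<exists>z2 w1 w2 \<theta>1 \<theta>2. lie_g7 br X Y Z W z2 w1 w2 \<theta>1 \<theta>2) \<or>
        (\<exists>z2 z4 w2 r \<theta>1 \<theta>2. lie_g8 br X Y Z W z2 z4 w2 r \<theta>1 \<theta>2) \<or>
        (\<exists>z2 z3 z4 \<theta>1 \<theta>2. lie_g9 br X Y Z W z2 z3 z4 \<theta>1 \<theta>2) \<or>
        (\<exists>\<alpha> a \<beta> b. lie_g10 br X Y Z W \<alpha> a \<beta> b) \<or>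
        (\<exists>z1 z2 z3 w1 \<theta>1 \<theta>2. lie_g11 br X Y Z W z1 z2 z3 w1 \<theta>1 \<theta>2) \<or>
        (\<exists>z3 w1 w2 \<theta>1 \<theta>2. lie_g12 br X Y Z W z3 w1 w2 \<theta>1 \<theta>2) \<or>
        (\<exists>z3 z4 \<theta>1 \<theta>2. lie_g13 br X Y Z W z3 z4 \<theta>1 \<theta>2) \<or>
        (\<exists>z2 z4 w2 \<theta>1 \<theta>2. lie_g14 br X Y Z W z2 z4 w2 \<theta>1 \<theta>2) \<or>
        (\<exists>\<alpha> w1 w2. lie_g15 br X Y Z W \<alpha> w1 w2) \<or>
        (\<exists>\<beta> w1 w2 \<theta>1 \<theta>2. lie_g16 br X Y Z W \<beta> w1 w2 \<theta>1 \<theta>2) \<or>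
        (\<exists>\<alpha> a w1 w2. lie_g17 br X Y Z W \<alpha> a w1 w2) \<or>
        (\<exists>\<beta> b z3 z4 \<theta>1 \<theta>2. lie_g18 br X Y Z W \<beta> b z3 z4 \<theta>1 \<theta>2) \<or>
        (\<exists>\<alpha> \<beta> w1 w2. lie_g19 br X Y Z W \<alpha> \<beta> w1 w2) \<or>
        (\<exists>\<alpha> a \<beta> w1 w2. lie_g20 br X Y Z W \<alpha> a \<beta> w1 w2))"

lemma in_familiesI:
  shows "lie_g1 br X Y Z W k r w1 w2 \<Longrightarrow> in_families br X Y Z W"
    and "lie_g2 br X Y Z W k a b w1 w2 \<Longrightarrow> in_families br X Y Z W"
    and "lie_g3 br X Y Z W a b w1 w2 t2 \<Longrightarrow> in_families br X Y Z W"
    and "lie_g4 br X Y Z W k z2 w1 w2 \<Longrightarrow> in_families br X Y Z W"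
    and "lie_g5 br X Y Z W x a y b r \<Longrightarrow> in_families br X Y Z W"
    and "lie_g6 br X Y Z W z1 z2 z3 r t1 t2 \<Longrightarrow> in_families br X Y Z W"
    and "lie_g7 br X Y Z W z2 w1 w2 t1 t2 \<Longrightarrow> in_families br X Y Z W"
    and "lie_g8 br X Y Z W z2 z4 w2 r t1 t2 \<Longrightarrow> in_families br X Y Z W"
    and "lie_g9 br X Y Z W z2 z3 z4 t1 t2 \<Longrightarrow> in_families br X Y Z W"
    and "lie_g10 br X Y Z W x a y b \<Longrightarrow> in_families br X Y Z W"
    and "lie_g11 br X Y Z W z1 z2 z3 w1 t1 t2 \<Longrightarrow> in_families br X Y Z W"
    and "lie_g12 br X Y Z W z3 w1 w2 t1 t2 \<Longrightarrow> in_families br X Y Z W"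
    and "lie_g13 br X Y Z W z3 z4 t1 t2 \<Longrightarrow> in_families br X Y Z W"
    and "lie_g14 br X Y Z W z2 z4 w2 t1 t2 \<Longrightarrow> in_families br X Y Z W"
    and "lie_g15 br X Y Z W x w1 w2 \<Longrightarrow> in_families br X Y Z W"
    and "lie_g16 br X Y Z W y w1 w2 t1 t2 \<Longrightarrow> in_families br X Y Z W"
    and "lie_g19 br X Y Z W x y w1 w2 \<Longrightarrow> in_families br X Y Z W"
  unfolding in_families_def by auto

context conformal_minimal_splitting
begin

text \<open>
  The equation \<open>\<kappa> B = 0\<close> gives \<open>B = 0\<close>, and \<open>(\<kappa> - A\<^sup>*) \<zeta>\<^sub>1 = (\<kappa> - A\<^sup>*) \<zeta>\<^sub>3 = 0\<close> remains. If \<open>A \<noteq> \<kappa>\<close>, both \<open>\<zeta>\<^sub>1\<close> and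
  \<open>\<zeta>\<^sub>3\<close> vanish, and \<open>r A = 0\<close> and \<open>(\<kappa> + 2\<alpha>) \<theta>2 = r w1\<close> separate the first three families. If \<open>A = \<kappa>\<close>,
  everything is determined by \<open>\<kappa>\<close>, \<open>z2\<close> and \<open>\<omega>\<close>.
\<close>

lemma family_kappa_nonzero:
  assumes g: "gauged_frame X Y Z W \<alpha> \<beta> a b z1 w1 z2 w2 z3 z4 \<kappa> r \<theta>1 \<theta>2" and \<kappa>: "\<kappa> \<noteq> 0"
  shows "in_families br X Y Z W"
proof -
  note J = jacobi_equations[OF g]
  have ab: "a = 0" "b = 0" using J(1,2) \<kappa> by auto
  note J = J(3-)[unfolded ab, simplified]
  show ?thesis
  proof (cases "(\<kappa> - \<alpha>)\<^sup>2 + \<beta>\<^sup>2 = 0")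
    case True
    then have "\<kappa> - \<alpha> = 0" "\<beta> = 0" by (simp_all only: sum_power2_eq_zero_iff)
    then have A: "\<alpha> = \<kappa>" "\<beta> = 0" by auto
    have z: "z1 = 0" "z3 = 0" "z4 = 0" "r = - z2"
      using J A \<kappa> by (auto simp: add_eq_0_iff2 distrib_left[symmetric] mult.commute)
    then have "\<theta>1 = 0" "\<kappa> * \<theta>2 = - z2 * w1" using J A \<kappa> by (auto simp: algebra_simps)
    moreover from this have "\<kappa> *\<^sub>R br Y X = (\<kappa> * r) *\<^sub>R X + (\<kappa> * \<theta>2) *\<^sub>R W"
      using g by (simp add: gauged_frame_def scaleR_add_right)
    ultimately have "lie_g4 br X Y Z W \<kappa> z2 w1 w2"
      using g \<kappa> unfolding gauged_frame_def lie_g4_def ab A z by (simp add: mult.commute)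
    then show ?thesis by (rule in_familiesI)
  next
    case ne: False
    have "((\<kappa> - \<alpha>)\<^sup>2 + \<beta>\<^sup>2) * z3 = 0" "((\<kappa> - \<alpha>)\<^sup>2 + \<beta>\<^sup>2) * z4 = 0"
      "((\<kappa> - \<alpha>)\<^sup>2 + \<beta>\<^sup>2) * z1 = 0" "((\<kappa> - \<alpha>)\<^sup>2 + \<beta>\<^sup>2) * z2 = 0"
      using J(1-4) by algebra+
    then have z: "z1 = 0" "z2 = 0" "z3 = 0" "z4 = 0" using ne by auto
    then have \<theta>1: "\<theta>1 = 0" using J \<kappa> by auto
    have \<theta>2: "r * w1 - \<kappa> * \<theta>2 = 2 * \<alpha> * \<theta>2" and rA: "r * \<alpha> = 0" "r * \<beta> = 0"
      using J z by auto
    note vals = ab z \<theta>1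
    consider "r \<noteq> 0" | "r = 0" "\<theta>2 = 0" | "r = 0" "\<theta>2 \<noteq> 0" by blast
    then show ?thesis
    proof cases
      case 1
      then have A: "\<alpha> = 0" "\<beta> = 0" using rA by auto
      then have "\<kappa> * \<theta>2 = r * w1" using \<theta>2 by simp
      then have "lie_g1 br X Y Z W \<kappa> r w1 w2"
        using g \<kappa> 1 unfolding gauged_frame_def lie_g1_def vals A by (simp add: scaleR_add_right)
      then show ?thesis by (rule in_familiesI)
    next
      case 2
      then have "lie_g2 br X Y Z W \<kappa> \<alpha> \<beta> w1 w2"
        using g \<kappa> ne unfolding gauged_frame_def lie_g2_def vals 2 by simp
      then show ?thesis by (rule in_familiesI)
    next
      case 3
      then have "(\<kappa> + 2 * \<alpha>) * \<theta>2 = 0" using \<theta>2 by (simp add: algebra_simps)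
      then have k: "\<kappa> = - 2 * \<alpha>" using 3 by simp
      then have "lie_g3 br X Y Z W \<alpha> \<beta> w1 w2 \<theta>2"
        using g \<kappa> 3 unfolding gauged_frame_def lie_g3_def vals k by simp
      then show ?thesis by (rule in_familiesI)
    qed
  qed
qed

text \<open>
  Here \<open>V\<close> is an abelian ideal, and the equations say that the traceless matrices \<open>M\<^sub>X\<close>, \<open>M\<^sub>Y\<close> by which \<open>X\<close>
  and \<open>Y\<close> act on it satisfy \<open>[M\<^sub>Y, M\<^sub>X] = r M\<^sub>X\<close>. If \<open>r \<noteq> 0\<close>, then \<open>M\<^sub>X\<close> is nilpotent, that is
  \<open>z1\<^sup>2 + w1 z3 = 0\<close>; if \<open>r = 0\<close>, the matrices commute and are therefore linearly dependent.
\<close>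

lemma family_abelian_ideal:
  assumes g: "gauged_frame X Y Z W 0 0 0 0 z1 w1 z2 w2 z3 z4 0 r \<theta>1 \<theta>2"
  shows "in_families br X Y Z W"
proof -
  note J = jacobi_equations[OF g, simplified]
  have J1: "r * z1 = w2 * z3 - w1 * z4" and J2: "r * w1 = 2 * (z2 * w1 - z1 * w2)"
    and J3: "r * z3 = 2 * (z1 * z4 - z2 * z3)"
    using J by auto
  show ?thesis
  proof (cases "r = 0")
    case r: False
    have "r * (z1\<^sup>2 + w1 * z3) = 0" using J1 J2 J3 by algebra
    then have nil: "z1\<^sup>2 = - (w1 * z3)" using r by simp
    consider "z1 \<noteq> 0" | "z1 = 0" "w1 \<noteq> 0" | "z1 = 0" "w1 = 0" "z3 \<noteq> 0" | "z1 = 0" "w1 = 0" "z3 = 0"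
      by blast
    then show ?thesis
    proof cases
      case 1
      then have z3: "z3 \<noteq> 0" and w1: "w1 = - (z1\<^sup>2 / z3)" using nil by (auto simp: field_simps)
      have z4: "z4 = z3 * (r + 2 * z2) / (2 * z1)"
        using J3 1 by (simp add: field_simps)
      have "z1 * (2 * z3 * w2 - z1 * (r - 2 * z2)) = 0" using J1 J2 J3 nil by algebra
      then have "2 * z3 * w2 = z1 * (r - 2 * z2)" using 1 by simp
      then have w2: "w2 = z1 * (r - 2 * z2) / (2 * z3)" using z3 by (simp add: field_simps)
      have "lie_g6 br X Y Z W z1 z2 z3 r \<theta>1 \<theta>2"
        using g 1 z3 r unfolding gauged_frame_def lie_g6_def z4 w2 w1 by simp
      then show ?thesis by (rule in_familiesI)
    next
      case 2
      then have v: "z3 = 0" "r = 2 * z2" using nil J2 by (auto simp: power2_eq_square)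
      then have z4: "z4 = 0" using J1 2 by simp
      have "lie_g7 br X Y Z W z2 w1 w2 \<theta>1 \<theta>2"
        using g 2 r unfolding gauged_frame_def lie_g7_def v z4 2 by simp
      then show ?thesis by (rule in_familiesI)
    next
      case 3
      then have "(r + 2 * z2) * z3 = 0" using J3 by (simp add: algebra_simps)
      then have v: "r = - 2 * z2" "w2 = 0" using J1 3 by auto
      then have "lie_g9 br X Y Z W z2 z3 z4 \<theta>1 \<theta>2"
        using g 3 r unfolding gauged_frame_def lie_g9_def by simp
      then show ?thesis by (rule in_familiesI)
    next
      case 4
      then have "lie_g8 br X Y Z W z2 z4 w2 r \<theta>1 \<theta>2"
        using g r unfolding gauged_frame_def lie_g8_def by simp
      then show ?thesis by (rule in_familiesI)
    qed
  next
    case r: True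
    consider "z1 \<noteq> 0" | "z1 = 0" "w1 \<noteq> 0" | "z1 = 0" "w1 = 0" "z3 \<noteq> 0" | "z1 = 0" "w1 = 0" "z3 = 0"
      by blast
    then show ?thesis
    proof cases
      case 1
      then have v: "w2 = z2 * w1 / z1" "z4 = z2 * z3 / z1" using J2 J3 r by (auto simp: field_simps)
      have "lie_g11 br X Y Z W z1 z2 z3 w1 \<theta>1 \<theta>2"
        using g 1 unfolding gauged_frame_def lie_g11_def v r by simp
      then show ?thesis by (rule in_familiesI)
    next
      case 2
      then have v: "z2 = 0" "z4 = z3 * w2 / w1" using J1 J2 r by (auto simp: field_simps)
      have "lie_g12 br X Y Z W z3 w1 w2 \<theta>1 \<theta>2"
        using g 2 unfolding gauged_frame_def lie_g12_def v r 2 by simp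
      then show ?thesis by (rule in_familiesI)
    next
      case 3
      then have v: "z2 = 0" "w2 = 0" using J1 J3 r by auto
      have "lie_g13 br X Y Z W z3 z4 \<theta>1 \<theta>2"
        using g 3 unfolding gauged_frame_def lie_g13_def v r 3 by simp
      then show ?thesis by (rule in_familiesI)
    next
      case 4
      have "lie_g14 br X Y Z W z2 z4 w2 \<theta>1 \<theta>2"
        using g unfolding gauged_frame_def lie_g14_def r 4 by simp
      then show ?thesis by (rule in_familiesI)
    qed
  qed
qed

text \<open>
  With \<open>\<kappa> = B = 0\<close> and \<open>A \<noteq> 0\<close> the complex equations reduce to \<open>A\<^sup>* \<zeta>\<^sub>1 = A\<^sup>* \<zeta>\<^sub>3 = 0\<close> and \<open>r A\<^sup>* = 0\<close>.
\<close>

lemma family_rank_one: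
  assumes g: "gauged_frame X Y Z W \<alpha> \<beta> 0 0 z1 w1 z2 w2 z3 z4 0 r \<theta>1 \<theta>2"
    and ne: "\<alpha> \<noteq> 0 \<or> \<beta> \<noteq> 0"
  shows "in_families br X Y Z W"
proof -
  note J = jacobi_equations[OF g, simplified]
  have n: "\<alpha>\<^sup>2 + \<beta>\<^sup>2 \<noteq> 0" using ne by (simp add: sum_power2_eq_zero_iff)
  have "(\<alpha>\<^sup>2 + \<beta>\<^sup>2) * z1 = 0" "(\<alpha>\<^sup>2 + \<beta>\<^sup>2) * z2 = 0" "(\<alpha>\<^sup>2 + \<beta>\<^sup>2) * z3 = 0" "(\<alpha>\<^sup>2 + \<beta>\<^sup>2) * z4 = 0"
    using jacobi_equations(3-6)[OF g] by algebra+
  then have z: "z1 = 0" "z2 = 0" "z3 = 0" "z4 = 0" using n by auto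
  then have r: "r = 0" using J ne by auto
  have \<theta>: "\<theta>1 = 0 \<and> \<theta>2 = 0" if "\<alpha> \<noteq> 0" using J z r that by auto
  consider "\<alpha> = 0" | "\<alpha> \<noteq> 0" "\<beta> = 0" | "\<alpha> \<noteq> 0" "\<beta> \<noteq> 0" by blast
  then show ?thesis
  proof cases
    case 1
    then have "lie_g16 br X Y Z W \<beta> w1 w2 \<theta>1 \<theta>2"
      using g ne unfolding gauged_frame_def lie_g16_def z r by simp
    then show ?thesis by (rule in_familiesI)
  next
    case 2
    then have "lie_g15 br X Y Z W \<alpha> w1 w2"
      using g \<theta> unfolding gauged_frame_def lie_g15_def z r by simp
    then show ?thesis by (rule in_familiesI)
  next
    case 3
    then have "lie_g19 br X Y Z W \<alpha> \<beta> w1 w2"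
      using g \<theta> unfolding gauged_frame_def lie_g19_def z r by simp
    then show ?thesis by (rule in_familiesI)
  qed
qed

text \<open>
  In the complex notation, eliminating between the four complex equations gives \<open>2 D \<omega> = r (A\<^sup>*)\<^sup>2\<close>,
  \<open>2 D \<zeta>\<^sub>1 = - r A\<^sup>* B\<^sup>*\<close> and \<open>2 D \<zeta>\<^sub>3 = - r (B\<^sup>*)\<^sup>2\<close>, where \<open>D = Im (A B\<^sup>*) \<noteq> 0\<close>.
\<close>

lemma family_rank_two:
  assumes g: "gauged_frame X Y Z W \<alpha> \<beta> a b z1 w1 z2 w2 z3 z4 0 r \<theta>1 \<theta>2"
    and D: "a * \<beta> - \<alpha> * b \<noteq> 0"
  shows "in_families br X Y Z W"
proof -
  note J = jacobi_equations[OF g, simplified]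
  let ?D = "a * \<beta> - \<alpha> * b"
  \<comment> \<open>The common factor of the solution: \<open>\<omega> = k (A\<^sup>*)\<^sup>2\<close>, and similarly for the other unknowns.\<close>
  define k where "k = r / (2 * ?D)"
  have k: "r = 2 * ?D * k" using D by (simp add: k_def)
  have P1: "\<alpha> * z1 + \<beta> * z2 + a * w1 + b * w2 = 0" and Q1: "\<alpha> * z2 - \<beta> * z1 + a * w2 - b * w1 = 0"
    using jacobi_equations(5,6)[OF g] by simp_all
  have P2: "\<alpha> * z3 + \<beta> * z4 - a * z1 - b * z2 = 0" and Q2: "\<alpha> * z4 - \<beta> * z3 - a * z2 + b * z1 = 0"
    using jacobi_equations(3,4)[OF g] by simp_all
  note P3 = jacobi_equations(7)[OF g] and Q3 = jacobi_equations(8)[OF g]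
  note P4 = jacobi_equations(9)[OF g] and Q4 = jacobi_equations(10)[OF g]
  have "2 * ?D * w1 - r * (\<alpha>\<^sup>2 - \<beta>\<^sup>2) = 0"
    using P1 Q1 P3 Q3 by algebra
  moreover have "2 * ?D * w2 + 2 * r * \<alpha> * \<beta> = 0"
    using P1 Q1 P3 Q3 by algebra
  moreover have "2 * ?D * z2 - r * (\<alpha> * b + \<beta> * a) = 0"
    using P1 Q1 P3 Q3 by algebra
  moreover have "2 * ?D * z1 - r * (\<beta> * b - \<alpha> * a) = 0"
    using P1 Q1 P3 Q3 by algebra
  moreover have "2 * ?D * z3 - r * (b\<^sup>2 - a\<^sup>2) = 0"
    using P2 Q2 P4 Q4 by algebra
  moreover have "2 * ?D * z4 - 2 * r * a * b = 0"
    using P2 Q2 P4 Q4 by algebra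
  ultimately have "2 * ?D * (w1 - k * (\<alpha>\<^sup>2 - \<beta>\<^sup>2)) = 0" "2 * ?D * (w2 + 2 * k * \<alpha> * \<beta>) = 0"
    "2 * ?D * (z2 - k * (\<alpha> * b + \<beta> * a)) = 0" "2 * ?D * (z1 - k * (\<beta> * b - \<alpha> * a)) = 0"
    "2 * ?D * (z3 - k * (b\<^sup>2 - a\<^sup>2)) = 0" "2 * ?D * (z4 - 2 * k * a * b) = 0"
    unfolding k by algebra+
  then have v: "w1 = k * (\<alpha>\<^sup>2 - \<beta>\<^sup>2)" "w2 = - 2 * k * \<alpha> * \<beta>" "z2 = k * (\<alpha> * b + \<beta> * a)"
    "z1 = k * (\<beta> * b - \<alpha> * a)" "z3 = k * (b\<^sup>2 - a\<^sup>2)" "z4 = 2 * k * a * b"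
    using D by (auto simp: eq_neg_iff_add_eq_0)
  have "\<alpha> * (\<theta>1 + k * a * r) = 0" "\<alpha> * (\<theta>2 - k * \<alpha> * r) = 0"
    "a * (\<theta>1 + k * a * r) = 0" "a * (\<theta>2 - k * \<alpha> * r) = 0"
    using jacobi_equations(11-14)[OF g] v k by algebra+
  moreover have "\<alpha> \<noteq> 0 \<or> a \<noteq> 0" using D by auto
  ultimately have \<theta>: "\<theta>1 = - k * a * r" "\<theta>2 = k * \<alpha> * r" by (auto simp: eq_neg_iff_add_eq_0)
  show ?thesis
  proof (cases "r = 0")
    case True
    then have "k = 0" by (simp add: k_def)
    then have "lie_g10 br X Y Z W \<alpha> a \<beta> b"
      using g D True unfolding gauged_frame_def lie_g10_def v \<theta> by (simp add: mult.commute)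
    then show ?thesis by (rule in_familiesI)
  next
    case False
    have k2: "2 * k = r / ?D" unfolding nonzero_eq_divide_eq[OF D] using k by algebra
    have "w2 = - ((2 * k) * \<alpha> * \<beta>)" "z4 = (2 * k) * a * b" by (simp_all add: v)
    then have c: "w2 = - (r * \<alpha> * \<beta> / ?D)" "z4 = r * a * b / ?D"
      unfolding k2 by simp_all
    have c': "w1 = r * (\<alpha>\<^sup>2 - \<beta>\<^sup>2) / (2 * ?D)" "z1 = r * (\<beta> * b - \<alpha> * a) / (2 * ?D)"
      "z2 = r * (\<alpha> * b + \<beta> * a) / (2 * ?D)" "z3 = r * (b\<^sup>2 - a\<^sup>2) / (2 * ?D)"
      "\<theta>1 = - (a * r\<^sup>2 / (2 * ?D))" "\<theta>2 = \<alpha> * r\<^sup>2 / (2 * ?D)"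
      unfolding v \<theta> k_def by (simp_all add: power2_eq_square)
    have "- (r * (\<beta> * b - \<alpha> * a) / (2 * ?D)) = r * (\<alpha> * a - \<beta> * b) / (2 * ?D)"
      by (simp add: minus_divide_left right_diff_distrib del: times_divide_eq_left)
    with False D have "lie_g5 br X Y Z W \<alpha> a \<beta> b r"
      using g unfolding gauged_frame_def lie_g5_def c c'
      by (simp only: scaleR_minus_left add_uminus_conv_diff scaleR_zero_left add_0_right) simp
    then show ?thesis by (rule in_familiesI)
  qed
qed

theorem classification:
  assumes "frame X Y Z W"
  obtains X' Y' Z' W' where "frame X' Y' Z' W'" "in_families br X' Y' Z' W'"
proof -
  obtain Z1 W1 where f1: "frame X Y Z1 W1" "ip (br W1 Z1) Z1 = 0"
    by (rule ex_frame_gauged_V[OF assms])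
  obtain X1 Y1 where f: "frame X1 Y1 Z1 W1" "ip (br Y1 X1) Y1 = 0"
    by (rule ex_frame_gauged_H[OF f1(1)])
  note g = gauged_frameI[OF f(1) f1(2) f(2)]
  note F = frameD[OF f(1)]
  let ?\<kappa> = "ip (br W1 Z1) W1"
  let ?\<alpha> = "ip (br Z1 X1) X1" and ?\<beta> = "ip (br Z1 X1) Y1"
  let ?a = "ip (br W1 X1) X1" and ?b = "ip (br W1 X1) Y1"
  consider "?\<kappa> \<noteq> 0" | "?\<kappa> = 0" "?a * ?\<beta> - ?\<alpha> * ?b \<noteq> 0" | "?\<kappa> = 0" "?a * ?\<beta> = ?\<alpha> * ?b" by auto
  then show ?thesis
  proof cases
    case 1
    show ?thesis by (rule that[OF f(1) family_kappa_nonzero[OF g 1]])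
  next
    case 2
    show ?thesis by (rule that[OF f(1) family_rank_two[OF g[unfolded 2(1)] 2(2)]])
  next
    case 3
    \<comment> \<open>The real linear map \<open>Z \<mapsto> A\<close>, \<open>W \<mapsto> B\<close> has a kernel; rotate \<open>W\<close> into it.\<close>
    have "\<exists>c s. c\<^sup>2 + s\<^sup>2 = 1 \<and> c * ?a = s * ?\<alpha> \<and> c * ?b = s * ?\<beta>"
    proof (cases "?\<alpha> = 0 \<and> ?a = 0")
      case True
      obtain c s where "c\<^sup>2 + s\<^sup>2 = 1" "c * ?b = s * ?\<beta>" by (rule exists_rotation)
      then show ?thesis using True by auto
    next
      case False
      obtain c s where cs: "c\<^sup>2 + s\<^sup>2 = 1" "c * ?a = s * ?\<alpha>" by (rule exists_rotation)
      have "?\<alpha> * (c * ?b - s * ?\<beta>) = 0" "?a * (c * ?b - s * ?\<beta>) = 0"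
        using cs(2) 3(2) by algebra+
      then show ?thesis using cs False by auto
    qed
    then obtain c s where cs: "c\<^sup>2 + s\<^sup>2 = 1" "c * ?a = s * ?\<alpha>" "c * ?b = s * ?\<beta>" by blast
    define Z2 W2 where "Z2 = c *\<^sub>R Z1 + s *\<^sub>R W1" and "W2 = (- s) *\<^sub>R Z1 + c *\<^sub>R W1"
    have f2: "frame X1 Y1 Z2 W2" unfolding Z2_def W2_def by (rule frame_rotate_V[OF f(1) cs(1)])
    note F2 = frameD[OF f2]
    have "br W1 Z1 = 0" using g 3(1) by (simp add: gauged_frame_def)
    then have "br W2 Z2 = 0" using br_rotate[OF F(7,8) cs(1)] by (simp add: Z2_def W2_def)
    then have k: "ip (br W2 Z2) Z2 = 0" "ip (br W2 Z2) W2 = 0" using F2 by simp_all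
    have "ip (br W2 X1) X1 = 0" "ip (br W2 X1) Y1 = 0"
      using cs(2,3) F br_closed[OF F(7,5)] br_closed[OF F(8,5)]
      by (simp_all add: W2_def br_add_left br_diff_left br_scale_left ip_bilinear L_closed)
    note g2 = gauged_frameI[OF f2 k(1) f(2), unfolded k(2) this]
    show ?thesis
    proof (cases "ip (br Z2 X1) X1 = 0 \<and> ip (br Z2 X1) Y1 = 0")
      case True
      then have e: "ip (br Z2 X1) X1 = 0" "ip (br Z2 X1) Y1 = 0" by auto
      show ?thesis by (rule that[OF f2 family_abelian_ideal[OF g2[unfolded e]]])
    next
      case False
      then have e: "ip (br Z2 X1) X1 \<noteq> 0 \<or> ip (br Z2 X1) Y1 \<noteq> 0" by auto
      show ?thesis by (rule that[OF f2 family_rank_one[OF g2 e]])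
    qed
  qed
qed

end


section \<open>From the geometry to the Lie algebra\<close>

locale conformal_minimal_lie_foliation = lie_grp A mul e iv
  for A :: "('m::{t2_space,second_countable_topology}, 'e::euclidean_space) atlas"
    and mul :: "'m \<Rightarrow> 'm \<Rightarrow> 'm" and e :: 'm and iv :: "'m \<Rightarrow> 'm" +
  fixes g :: "'m metric" and nab :: "'m connection" and D :: "'m distribution"
  assumes dim4: "DIM('e) = 4"
    and left_invariant_metric: "left_invariant_metric A mul g"
    and levi_civita: "levi_civita A g nab"
    and foliation: "foliation A D"
    and left_invariant_distribution: "left_invariant_distribution A mul D"
    and codim2: "\<forall>p. dim (orth_complement A g D p) = 2"
    and conformal_foliation: "conformal_foliation A g nab D"
    and minimal_foliation: "minimal_foliation A g nab D"
begin

abbreviation "\<gg> \<equiv> left_invariant_fields A mul"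
abbreviation "ip \<equiv> induced_inner_product g e"
abbreviation "T \<equiv> tangent_space A e"
abbreviation "H\<^sub>e \<equiv> orth_complement A g D e"

definition "vert = {X \<in> \<gg>. X e \<in> D e}"
definition "horiz = {X \<in> \<gg>. X e \<in> H\<^sub>e}"

lemma metric_at: "inner_product_on (tangent_space A p) (g p)"
proof
  have R: "\<forall>u\<in>tangent_space A p. \<forall>v\<in>tangent_space A p.
      g p u v = g p v u \<and> (u \<noteq> 0 \<longrightarrow> g p u u > 0) \<and>
      (\<forall>w\<in>tangent_space A p. g p (u + v) w = g p u w + g p v w) \<and>
      (\<forall>c. g p (c *\<^sub>R u) v = c * g p u v)"
    using left_invariant_metric unfolding left_invariant_metric_def riemannian_metric_def by meson
  show "subspace (tangent_space A p)" by (rule subspace_tangent_space)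
  fix u v w c assume u: "u \<in> tangent_space A p"
  show "u \<noteq> 0 \<Longrightarrow> 0 < g p u u" using R u by simp
  assume v: "v \<in> tangent_space A p"
  show "g p u v = g p v u" using R u v by simp
  show "g p (c *\<^sub>R u) v = c * g p u v" using R u v by simp
  assume w: "w \<in> tangent_space A p"
  show "g p (u + v) w = g p u w + g p v w" using R u v w by simp
qed

sublocale T: inner_product_on T "g e"
  by (rule metric_at)

lemma linear_eval: "linear (\<lambda>X :: 'm vfield. X p)"
  by (rule linearI) (simp_all add: scaleR_fun_def)

lemma metric_constant:
  assumes "X \<in> \<gg>" "Y \<in> \<gg>" shows "g p (X p) (Y p) = ip X Y"
proof -
  have "g (mul p e) (differential A A (mul p) (X e)) (differential A A (mul p) (Y e)) = g e (X e) (Y e)"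
    using left_invariant_metric left_invariant_fieldsD(2)[OF assms(1)] left_invariant_fieldsD(2)[OF assms(2)]
    unfolding left_invariant_metric_def by blast
  then show ?thesis
    using left_invariant_fieldsD(4)[OF assms(1), of p] left_invariant_fieldsD(4)[OF assms(2), of p]
    by (simp add: induced_inner_product_def)
qed

sublocale L: inner_product_on \<gg> ip
proof
  show "subspace \<gg>" by (rule subspace_left_invariant_fields)
  fix X Y Z c assume X: "X \<in> \<gg>"
  note XT = left_invariant_fieldsD(2)[OF X, of e]
  show "X \<noteq> 0 \<Longrightarrow> 0 < ip X X"
  proof -
    assume "X \<noteq> 0"
    then have "X e \<noteq> 0"
      using left_invariant_fields_eqI[OF X subspace_0[OF subspace_left_invariant_fields]] by auto
    then show "0 < ip X X" using T.ip_pos[OF XT] by (simp add: induced_inner_product_def)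
  qed
  assume Y: "Y \<in> \<gg>"
  note YT = left_invariant_fieldsD(2)[OF Y, of e]
  show "ip X Y = ip Y X" using T.ip_sym[OF XT YT] by (simp add: induced_inner_product_def)
  show "ip (c *\<^sub>R X) Y = c * ip X Y"
    using T.ip_scale_left[OF XT YT] by (simp add: induced_inner_product_def scaleR_fun_def)
  assume Z: "Z \<in> \<gg>"
  show "ip (X + Y) Z = ip X Z + ip Y Z"
    using T.ip_add_left[OF XT YT left_invariant_fieldsD(2)[OF Z]] by (simp add: induced_inner_product_def)
qed


subsection \<open>Vertical and horizontal left-invariant fields\<close>

lemma D_sub: "D p \<subseteq> tangent_space A p" and subspace_D: "subspace (D p)"
  using foliation by (simp_all add: foliation_def smooth_distribution_def)

lemma subspace_orth: "subspace (orth_complement A g D p)"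
proof -
  interpret p: inner_product_on "tangent_space A p" "g p" by (rule metric_at)
  show ?thesis
    unfolding subspace_def orth_complement_def
    using D_sub[of p] by (auto simp: p.L_closed p.ip_add_left p.ip_scale_left subset_iff)
qed

lemma orth_sub: "orth_complement A g D p \<subseteq> tangent_space A p"
  by (auto simp: orth_complement_def)

lemma left_extend_image:
  assumes "S \<subseteq> T" shows "left_extend ` S = {X \<in> \<gg>. X e \<in> S}"
proof (intro equalityI subsetI)
  fix X assume "X \<in> left_extend ` S"
  then obtain v where v: "v \<in> S" "X = left_extend v" by blast
  then have "v \<in> T" using assms by blast
  then show "X \<in> {X \<in> \<gg>. X e \<in> S}"
    using v left_extend_left_invariant left_extend_at_e by simp
next
  fix X assume "X \<in> {X \<in> \<gg>. X e \<in> S}"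
  then have "X = left_extend (X e)" "X e \<in> S" using left_extend_eval by auto
  then show "X \<in> left_extend ` S" by (rule image_eqI)
qed

lemma vert_eq: "vert = left_extend ` D e"
  unfolding vert_def by (rule left_extend_image[OF D_sub, symmetric])

lemma horiz_eq: "horiz = left_extend ` H\<^sub>e"
  unfolding horiz_def by (rule left_extend_image[OF orth_sub, symmetric])

lemma vertD: "X \<in> vert \<Longrightarrow> X \<in> \<gg>" "X \<in> vert \<Longrightarrow> X e \<in> D e"
  and horizD: "X \<in> horiz \<Longrightarrow> X \<in> \<gg>" "X \<in> horiz \<Longrightarrow> X e \<in> H\<^sub>e"
  by (auto simp: vert_def horiz_def)

text \<open>
  A left-invariant field is determined by its value at \<open>e\<close>. Hence \<open>vert\<close> is the span of any set of
  left-invariant generators of the distribution.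
\<close>

lemma D_eq_vert: "D p = (\<lambda>X. X p) ` vert"
proof -
  obtain S where S: "S \<subseteq> \<gg>" "D = generated_distribution S"
    using left_invariant_distribution unfolding left_invariant_distribution_def by blast
  have D: "D p = (\<lambda>X. X p) ` span S" for p
    unfolding S(2) generated_distribution_def by (rule linear_span_image[OF linear_eval])
  have SL: "span S \<subseteq> \<gg>" by (rule span_minimal[OF S(1) subspace_left_invariant_fields])
  have "vert = span S"
  proof
    show "vert \<subseteq> span S"
    proof
      fix X assume X: "X \<in> vert"
      then obtain Y where Y: "Y \<in> span S" "X e = Y e" using D[of e] vertD(2) by blast
      then have "X = Y" using left_invariant_fields_eqI[OF vertD(1)[OF X]] SL by blast
      then show "X \<in> span S" using Y by simp
    qed
    show "span S \<subseteq> vert" using SL D[of e] by (auto simp: vert_def)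
  qed
  then show ?thesis using D by simp
qed

lemma vert_section: "X \<in> vert \<Longrightarrow> X \<in> sections A D"
  using D_eq_vert left_invariant_fieldsD(1) vertD(1) by (auto simp: sections_def)

lemma ip_vert_horiz: "X \<in> horiz \<Longrightarrow> U \<in> vert \<Longrightarrow> ip X U = 0"
  by (auto simp: horiz_def vert_def orth_complement_def induced_inner_product_def)

lemma horiz_section:
  assumes X: "X \<in> horiz" shows "X \<in> sections A (orth_complement A g D)"
proof -
  have "g p (X p) w = 0" if "w \<in> D p" for p w
    using that metric_constant[OF horizD(1)[OF X] vertD(1)] ip_vert_horiz[OF X] by (auto simp: D_eq_vert)
  then show ?thesis
    using left_invariant_fieldsD(1,2)[OF horizD(1)[OF X]] by (auto simp: sections_def orth_complement_def)
qed

lemma vert_lie_bracket: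
  assumes "X \<in> vert" "Y \<in> vert" shows "lie_bracket X Y \<in> vert"
proof -
  have "lie_bracket X Y \<in> sections A D"
    using foliation vert_section assms unfolding foliation_def by blast
  then show ?thesis
    using lie_bracket_left_invariant assms by (auto simp: vert_def sections_def)
qed

text \<open>The dimension count \<open>dim V = 4 - 2\<close> is done with orthonormal bases.\<close>

lemma ex_adapted_basis:
  obtains h1 h2 v1 v2 where "orthonormal_basis (g e) H\<^sub>e [h1, h2]" "orthonormal_basis (g e) (D e) [v1, v2]"
proof -
  obtain B where B: "independent B" "card B = DIM('e)" "finite B" "span B = T"
    by (rule tangent_space_basis)
  obtain vs where vs: "length vs = dim (D e)" "orthonormal_basis (g e) (D e) vs"
    by (rule T.orthonormal_basis_of_subspace[OF subspace_D D_sub B(3)]) (use B in auto)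
  obtain hs where hs: "length hs = dim H\<^sub>e" "orthonormal_basis (g e) H\<^sub>e hs"
    by (rule T.orthonormal_basis_of_subspace[OF subspace_orth orth_sub B(3)]) (use B in auto)
  note V = T.orthonormal_basisD[OF vs(2) D_sub] and H = T.orthonormal_basisD[OF hs(2) orth_sub]
  have perp: "g e (hs ! i) (vs ! j) = 0" "g e (vs ! j) (hs ! i) = 0" if "i < length hs" "j < length vs" for i j
  proof -
    show "g e (hs ! i) (vs ! j) = 0" using H(2) V(2) that by (auto simp: orth_complement_def)
    then show "g e (vs ! j) (hs ! i) = 0" using T.ip_sym[OF V(1) H(1)] that by simp
  qed
  have sub: "set (vs @ hs) \<subseteq> T" using V(1) H(1) by (auto simp: in_set_conv_nth)
  have "g e ((vs @ hs) ! i) ((vs @ hs) ! j) = (if i = j then 1 else 0)"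
    if "i < length (vs @ hs)" "j < length (vs @ hs)" for i j
    using that V(4) H(4) perp by (auto simp: nth_append)
  note ind = T.orthonormal_imp_independent[OF sub this]
  have "T \<subseteq> span (set (vs @ hs))"
  proof
    fix u assume u: "u \<in> T"
    obtain w where w: "w \<in> D e" "\<forall>n\<in>D e. g e (u - w) n = 0"
      using T.orthogonal_projection_exists[OF vs(2) D_sub u] by blast
    have "w \<in> T" using w(1) D_sub by blast
    then have "u - w \<in> H\<^sub>e" using w(2) T.L_closed u by (auto simp: orth_complement_def)
    then have "u - w \<in> span (set (vs @ hs))" "w \<in> span (set (vs @ hs))"
      using w(1) V(3) H(3) span_mono[of "set vs" "set (vs @ hs)"] span_mono[of "set hs" "set (vs @ hs)"] by auto
    then show "u \<in> span (set (vs @ hs))" using span_add by fastforce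
  qed
  then have "span (set (vs @ hs)) = span B"
    using span_minimal[OF sub subspace_tangent_space] B(4) by blast
  then have "card (set (vs @ hs)) = card B"
    using dim_eq_card[OF _ ind(2)] dim_eq_card[OF _ B(1)] by metis
  then have "length vs + length hs = 4"
    using distinct_card[OF ind(1)] B(2) dim4 by simp
  moreover have "length hs = 2" using hs(1) codim2 by simp
  ultimately have "length vs = 2" by simp
  then obtain v1 v2 where "vs = [v1, v2]" by (auto simp: length_Suc_conv numeral_2_eq_2)
  moreover obtain h1 h2 where "hs = [h1, h2]" using \<open>length hs = 2\<close> by (auto simp: length_Suc_conv numeral_2_eq_2)
  ultimately show ?thesis using vs(2) hs(2) that by blast
qed

text \<open>
  The definite description in the orthogonal projection is justified by an orthonormal basis, which
  gives existence, and by positivity, which gives uniqueness.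
\<close>

lemma orth_projD:
  assumes N: "subspace (N e)" "N e \<subseteq> T" and on: "orthonormal_basis (g e) (N e) vs" and v: "v \<in> T"
  shows "orth_proj g N e v \<in> N e" "n \<in> N e \<Longrightarrow> g e (orth_proj g N e v) n = g e v n"
proof -
  obtain w where w: "w \<in> N e" "\<forall>n\<in>N e. g e (v - w) n = 0"
    using T.orthogonal_projection_exists[OF on N(2) v] by blast
  have uniq: "w' = w" if w': "w' \<in> N e" "\<forall>n\<in>N e. g e (v - w') n = 0" for w'
  proof (rule ccontr)
    assume "w' \<noteq> w"
    have L: "w \<in> T" "w' \<in> T" using w w' N(2) by auto
    have n: "w' - w \<in> N e" by (rule subspace_diff[OF N(1) w'(1) w(1)])
    have "g e (v - w) (w' - w) - g e (v - w') (w' - w) = g e (w' - w) (w' - w)"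
      using v L T.ip_diff_left[of v w "w' - w"] T.ip_diff_left[of v w' "w' - w"]
        T.ip_diff_left[of w' w "w' - w"] T.L_closed by simp
    then have "g e (w' - w) (w' - w) = 0" using w(2) w'(2) n by simp
    then show False using T.ip_pos[of "w' - w"] n N(2) \<open>w' \<noteq> w\<close> by auto
  qed
  have eq: "orth_proj g N e v = w"
    unfolding orth_proj_def
  proof (rule the_equality)
    show "w \<in> N e \<and> (\<forall>n\<in>N e. g e (v - w) n = 0)" using w by simp
    show "w' = w" if "w' \<in> N e \<and> (\<forall>n\<in>N e. g e (v - w') n = 0)" for w'
      by (rule uniq[OF conjunct1[OF that] conjunct2[OF that]])
  qed
  then show "orth_proj g N e v \<in> N e" using w by simp
  show "g e (orth_proj g N e v) n = g e v n" if "n \<in> N e"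
  proof -
    have "w \<in> T" "n \<in> T" using that w(1) N(2) by auto
    then show ?thesis using w(2) that T.ip_diff_left[OF v, of w n] by (simp add: eq)
  qed
qed


subsection \<open>The second fundamental forms in terms of brackets\<close>

text \<open>
  On left-invariant fields the metric is constant, so for the Levi-Civita connection \<open>\<nabla>\<^sub>X\<close> is
  skew-symmetric; with the vanishing torsion this determines the symmetric parts that enter the second
  fundamental forms.
\<close>

definition conn :: "'m vfield \<Rightarrow> 'm vfield \<Rightarrow> 'm vfield \<Rightarrow> real" where
  "conn X Y Z = g e (nab X Y e) (Z e)"

lemma nab_in_T:
  assumes "X \<in> \<gg>" "Y \<in> \<gg>" shows "nab X Y e \<in> T"
proof -
  have "nab X Y \<in> vector_fields A"
    using levi_civita left_invariant_fieldsD(1)[OF assms(1)] left_invariant_fieldsD(1)[OF assms(2)]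
    by (simp add: levi_civita_def affine_connection_def)
  then show ?thesis by (rule vector_fieldsD(1))
qed

lemma conn_skew:
  assumes "X \<in> \<gg>" "Y \<in> \<gg>" "Z \<in> \<gg>" shows "conn X Y Z = - conn X Z Y"
proof -
  note vf = left_invariant_fieldsD(1)
  have "X e (\<lambda>q. g q (Y q) (Z q)) = g e (nab X Y e) (Z e) + g e (Y e) (nab X Z e)"
    using levi_civita vf[OF assms(1)] vf[OF assms(2)] vf[OF assms(3)] unfolding levi_civita_def by blast
  moreover have "X e (\<lambda>q. g q (Y q) (Z q)) = 0"
    using derivation_const[OF left_invariant_fieldsD(2)[OF assms(1)]] metric_constant[OF assms(2,3)] by simp
  ultimately show ?thesis
    using T.ip_sym[OF left_invariant_fieldsD(2)[OF assms(2)] nab_in_T[OF assms(1,3)]] by (simp add: conn_def)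
qed

lemma conn_torsion:
  assumes "X \<in> \<gg>" "Y \<in> \<gg>" "Z \<in> \<gg>" shows "conn X Y Z - conn Y X Z = ip (lie_bracket X Y) Z"
proof -
  have "nab X Y - nab Y X = lie_bracket X Y"
    using levi_civita left_invariant_fieldsD(1) assms unfolding levi_civita_def by blast
  from fun_cong[OF this, of e] have "lie_bracket X Y e = nab X Y e - nab Y X e" by simp
  then show ?thesis
    using T.ip_diff_left[OF nab_in_T nab_in_T left_invariant_fieldsD(2)] assms
    by (simp add: conn_def induced_inner_product_def)
qed

lemma conformal_bracket:
  "\<exists>\<mu>. \<forall>U\<in>vert. \<forall>X\<in>horiz. \<forall>Y\<in>horiz.
    ip (lie_bracket U X) Y + ip (lie_bracket U Y) X = 2 * ip X Y * \<mu> U"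
proof -
  obtain V0 where V0: "V0 \<in> sections A D"
    and sff: "\<And>X Y. X \<in> sections A (orth_complement A g D) \<Longrightarrow> Y \<in> sections A (orth_complement A g D) \<Longrightarrow>
        second_fundamental_form g nab D X Y = fscale (\<lambda>p. g p (X p) (Y p)) V0"
    using conformal_foliation unfolding conformal_foliation_def by blast
  obtain v1 v2 where on: "orthonormal_basis (g e) (D e) [v1, v2]" by (rule ex_adapted_basis)
  have "ip (lie_bracket U X) Y + ip (lie_bracket U Y) X = 2 * ip X Y * g e (V0 e) (U e)"
    if U: "U \<in> vert" and X: "X \<in> horiz" and Y: "Y \<in> horiz" for U X Y
  proof -
    note L = vertD(1)[OF U] horizD(1)[OF X] horizD(1)[OF Y]
    have UT: "U e \<in> T" by (rule left_invariant_fieldsD(2)[OF L(1)])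
    have V0T: "V0 e \<in> T" using V0 D_sub by (auto simp: sections_def)
    let ?v = "nab X Y e + nab Y X e"
    have v: "?v \<in> T" by (intro T.L_closed(2) nab_in_T L)
    note P = orth_projD[where N = D, OF subspace_D D_sub on v]
    have "(1/2) *\<^sub>R orth_proj g D e ?v = g e (X e) (Y e) *\<^sub>R V0 e"
      using fun_cong[OF sff[OF horiz_section[OF X] horiz_section[OF Y]], of e]
      by (simp add: second_fundamental_form_def fscale_def)
    then have "g e ((1/2) *\<^sub>R orth_proj g D e ?v) (U e) = g e (g e (X e) (Y e) *\<^sub>R V0 e) (U e)" by simp
    moreover have "orth_proj g D e ?v \<in> T" using P(1) D_sub by blast
    ultimately have "g e ?v (U e) = 2 * ip X Y * g e (V0 e) (U e)"
      using P(2)[OF vertD(2)[OF U]] T.ip_scale_left UT V0T by (simp add: induced_inner_product_def)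
    then have "conn X Y U + conn Y X U = 2 * ip X Y * g e (V0 e) (U e)"
      using T.ip_add_left[OF nab_in_T[OF L(2,3)] nab_in_T[OF L(3,2)] UT] by (simp add: conn_def)
    moreover have "conn X Y U + conn Y X U = ip (lie_bracket U X) Y + ip (lie_bracket U Y) X"
      using conn_skew[OF L(2,3,1)] conn_skew[OF L(3,2,1)] conn_torsion[OF L(1,2,3)]
        conn_torsion[OF L(1,3,2)] conn_skew[OF L(1,2,3)] by simp
    ultimately show ?thesis by simp
  qed
  \<comment> \<open>\<open>\<mu>\<close> is the metric dual of the vector field \<open>V0\<close> from the conformality.\<close>
  then show ?thesis by (intro exI[of _ "\<lambda>U. g e (V0 e) (U e)"]) simp
qed

lemma minimal_bracket:
  assumes X: "X \<in> horiz" and UV: "span {U, V} = vert" "ip U U = 1" "ip V V = 1" "ip U V = 0"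
  shows "ip (lie_bracket U X) U + ip (lie_bracket V X) V = 0"
proof -
  have m: "U \<in> vert" "V \<in> vert" using UV(1) span_superset[of "{U, V}"] by auto
  note L = vertD(1)[OF m(1)] vertD(1)[OF m(2)] horizD(1)[OF X]
  have "span {U e, V e} = D e"
    using linear_span_image[OF linear_eval, of e "{U, V}"] UV(1) D_eq_vert[of e] by simp
  moreover have "ip V U = 0" using UV(4) L.ip_sym L by simp
  ultimately have "orthonormal_basis (g e) (D e) (map (\<lambda>E. E e) [U, V])"
    using UV unfolding orthonormal_basis_def induced_inner_product_def
    by (auto simp: less_Suc_eq numeral_2_eq_2)
  moreover have "set [U, V] \<subseteq> sections A D" using m vert_section by auto
  ultimately have "(\<Sum>E\<leftarrow>[U, V]. second_fundamental_form g nab (orth_complement A g D) E E e) = 0"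
    using minimal_foliation unfolding minimal_foliation_def by blast
  then have sum0: "(1/2) *\<^sub>R orth_proj g (orth_complement A g D) e (nab U U e + nab U U e)
      + (1/2) *\<^sub>R orth_proj g (orth_complement A g D) e (nab V V e + nab V V e) = 0"
    by (simp add: second_fundamental_form_def)
  obtain h1 h2 where on: "orthonormal_basis (g e) H\<^sub>e [h1, h2]" by (rule ex_adapted_basis)
  have XT: "X e \<in> T" by (rule left_invariant_fieldsD(2)[OF L(3)])
  have P: "(1/2) *\<^sub>R orth_proj g (orth_complement A g D) e (nab E E e + nab E E e) \<in> T"
    "g e ((1/2) *\<^sub>R orth_proj g (orth_complement A g D) e (nab E E e + nab E E e)) (X e) = conn E E X"
    if E: "E \<in> \<gg>" for E
  proof -
    note n = nab_in_T[OF E E]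
    have v: "nab E E e + nab E E e \<in> T" by (rule T.L_closed(2)[OF n n])
    note P = orth_projD[where N = "orth_complement A g D", OF subspace_orth orth_sub on v]
    have PT: "orth_proj g (orth_complement A g D) e (nab E E e + nab E E e) \<in> T" using P(1) orth_sub by blast
    then show "(1/2) *\<^sub>R orth_proj g (orth_complement A g D) e (nab E E e + nab E E e) \<in> T"
      by (rule T.L_closed(4))
    show "g e ((1/2) *\<^sub>R orth_proj g (orth_complement A g D) e (nab E E e + nab E E e)) (X e) = conn E E X"
      using P(2)[OF horizD(2)[OF X]] T.ip_scale_left[OF PT XT] T.ip_add_left[OF n n XT] by (simp add: conn_def)
  qed
  have "conn U U X + conn V V X = 0"
    using arg_cong[OF sum0, of "\<lambda>v. g e v (X e)"] T.ip_add_left[OF P(1)[OF L(1)] P(1)[OF L(2)] XT]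
      P(2)[OF L(1)] P(2)[OF L(2)] XT by simp
  moreover have "conn E E X = - ip (lie_bracket E X) E" if "E \<in> \<gg>" for E
    using conn_skew[OF that that L(3)] conn_torsion[OF that L(3) that] conn_skew[OF L(3) that that] by simp
  ultimately show ?thesis using L by simp
qed

lemma orthonormal_pair_lift:
  assumes "orthonormal_basis (g e) S [a, b]" "S \<subseteq> T"
  shows "span {left_extend a, left_extend b} = left_extend ` S"
    and "ip (left_extend a) (left_extend a) = 1" "ip (left_extend b) (left_extend b) = 1"
    and "ip (left_extend a) (left_extend b) = 0"
proof -
  have S: "span {a, b} = S" and on: "\<forall>i<length [a, b]. \<forall>j<length [a, b].
      g e ([a, b] ! i) ([a, b] ! j) = (if i = j then 1 else 0)"
    using assms(1) by (simp_all add: orthonormal_basis_def)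
  show "span {left_extend a, left_extend b} = left_extend ` S"
    using linear_span_image[OF linear_left_extend, of "{a, b}"] S by simp
  have "a \<in> T" "b \<in> T" using S span_superset[of "{a, b}"] assms(2) by auto
  then show "ip (left_extend a) (left_extend a) = 1" "ip (left_extend b) (left_extend b) = 1"
    "ip (left_extend a) (left_extend b) = 0"
    using spec[OF on, of 0] spec[OF on, of 1] by (auto simp: induced_inner_product_def left_extend_at_e less_Suc_eq)
qed

theorem adapted_basis_in_families:
  "\<exists>X Y Z W. orthonormal_basis ip \<gg> [X, Y, Z, W] \<and> D = generated_distribution {Z, W} \<and>
    in_families lie_bracket X Y Z W"
proof -
  obtain \<mu> where \<mu>: "\<And>U X Y. U \<in> vert \<Longrightarrow> X \<in> horiz \<Longrightarrow> Y \<in> horiz \<Longrightarrow>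
    ip (lie_bracket U X) Y + ip (lie_bracket U Y) X = 2 * ip X Y * \<mu> U"
    using conformal_bracket by auto
  obtain h1 h2 v1 v2 where on: "orthonormal_basis (g e) H\<^sub>e [h1, h2]" "orthonormal_basis (g e) (D e) [v1, v2]"
    by (rule ex_adapted_basis)
  have span: "\<gg> = span (vert \<union> horiz)"
  proof
    show "span (vert \<union> horiz) \<subseteq> \<gg>"
      by (rule span_minimal[OF _ subspace_left_invariant_fields]) (auto simp: vert_def horiz_def)
    show "\<gg> \<subseteq> span (vert \<union> horiz)"
    proof
      fix X assume X: "X \<in> \<gg>"
      note XT = left_invariant_fieldsD(2)[OF X, of e]
      obtain w where w: "w \<in> D e" "\<forall>n\<in>D e. g e (X e - w) n = 0"
        using T.orthogonal_projection_exists[OF on(2) D_sub XT] by blast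
      have "w \<in> T" using w(1) D_sub by blast
      then have "X e - w \<in> H\<^sub>e" using w(2) T.L_closed XT by (auto simp: orth_complement_def)
      then have "left_extend w \<in> vert" "left_extend (X e - w) \<in> horiz"
        using w(1) by (auto simp: vert_eq horiz_eq)
      moreover have "X = left_extend w + left_extend (X e - w)"
        using linear_add[OF linear_left_extend, of w "X e - w"] left_extend_eval[OF X] by simp
      ultimately show "X \<in> span (vert \<union> horiz)" by (metis UnI1 UnI2 span_add span_base)
    qed
  qed
  interpret S: conformal_minimal_splitting \<gg> ip lie_bracket vert horiz \<mu>
  proof unfold_locales
    note vf = left_invariant_fieldsD(1)
    show "lie_bracket u v \<in> \<gg>" if "u \<in> \<gg>" "v \<in> \<gg>" for u v
      using that by (rule lie_bracket_left_invariant)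
    show "lie_bracket (u + v) w = lie_bracket u w + lie_bracket v w" if "u \<in> \<gg>" "v \<in> \<gg>" "w \<in> \<gg>" for u v w
      using that by (intro lie_bracket_add_left vf)
    show "lie_bracket (c *\<^sub>R u) v = c *\<^sub>R lie_bracket u v" if "u \<in> \<gg>" "v \<in> \<gg>" for u v c
      using that by (intro lie_bracket_scale_left vf)
    show "lie_bracket v u = - lie_bracket u v" for u v :: "'m vfield" by (rule lie_bracket_antisym)
    show "lie_bracket u (lie_bracket v w) + lie_bracket v (lie_bracket w u) + lie_bracket w (lie_bracket u v) = 0"
      if "u \<in> \<gg>" "v \<in> \<gg>" "w \<in> \<gg>" for u v w
      using that by (intro lie_bracket_jacobi vf)
    show "vert \<subseteq> \<gg>" "horiz \<subseteq> \<gg>" using vertD horizD by auto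
    show "ip u x = 0" if "u \<in> vert" "x \<in> horiz" for u x
      using ip_vert_horiz[OF that(2,1)] L.ip_sym[OF vertD(1)[OF that(1)] horizD(1)[OF that(2)]] by simp
    show "lie_bracket u v \<in> vert" if "u \<in> vert" "v \<in> vert" for u v
      using that by (rule vert_lie_bracket)
    show "\<gg> = span (vert \<union> horiz)" by (rule span)
    show "ip (lie_bracket u x) y + ip (lie_bracket u y) x = 2 * ip x y * \<mu> u"
      if "u \<in> vert" "x \<in> horiz" "y \<in> horiz" for u x y
      using that by (rule \<mu>)
    show "ip (lie_bracket u x) u + ip (lie_bracket v x) v = 0"
      if "x \<in> horiz" "span {u, v} = vert" "ip u u = 1" "ip v v = 1" "ip u v = 0" for x u v
      using that by (rule minimal_bracket)
  qed
  have "S.frame (left_extend h1) (left_extend h2) (left_extend v1) (left_extend v2)"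
    unfolding S.frame_def
    using orthonormal_pair_lift[OF on(1) orth_sub] orthonormal_pair_lift[OF on(2) D_sub]
    by (simp add: vert_eq horiz_eq)
  then obtain X Y Z W where f: "S.frame X Y Z W" and fam: "in_families lie_bracket X Y Z W"
    by (rule S.classification)
  note F = S.frameD[OF f]
  have "orthonormal_basis ip \<gg> [X, Y, Z, W]"
    unfolding orthonormal_basis_def
  proof (intro conjI allI impI)
    show "span (set [X, Y, Z, W]) = \<gg>" using S.frame_span[OF f] by simp
    fix i j assume "i < length [X, Y, Z, W]" "j < length [X, Y, Z, W]"
    then show "ip ([X, Y, Z, W] ! i) ([X, Y, Z, W] ! j) = (if i = j then 1 else 0)"
      using F by (auto simp: less_Suc_eq)
  qed
  moreover have "D = generated_distribution {Z, W}"
  proof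
    fix p
    have "D p = (\<lambda>X. X p) ` span {Z, W}" using D_eq_vert f by (simp add: S.frame_def)
    also have "\<dots> = span ((\<lambda>X. X p) ` {Z, W})" by (rule linear_span_image[OF linear_eval, symmetric])
    finally show "D p = generated_distribution {Z, W} p" by (simp add: generated_distribution_def)
  qed
  ultimately show ?thesis using fam by blast
qed

end


section \<open>The classification\<close>

theorem theorem1p1:
  fixes A :: "('m::{t2_space,second_countable_topology}, 'e::euclidean_space) atlas"
    and mul :: "'m \<Rightarrow> 'm \<Rightarrow> 'm" and e :: 'm and iv :: "'m \<Rightarrow> 'm"
    and g :: "'m metric" and nab :: "'m connection" and \<V> :: "'m distribution"
  assumes "lie_group A mul e iv" and "DIM('e) = 4"
    and "left_invariant_metric A mul g"
    and "levi_civita A g nab"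
    and "foliation A \<V>"
    and "left_invariant_distribution A mul \<V>"
    and "\<forall>p. dim (orth_complement A g \<V> p) = 2"
    and "conformal_foliation A g nab \<V>"
    and "minimal_foliation A g nab \<V>"
  shows "\<exists>X Y Z W.
     orthonormal_basis (induced_inner_product g e) (left_invariant_fields A mul) [X, Y, Z, W] \<and>
     \<V> = generated_distribution {Z, W} \<and>
       ((\<exists>\<kappa> r w1 w2. lie_g1 lie_bracket X Y Z W \<kappa> r w1 w2) \<or>
        (\<exists>\<kappa> \<alpha> \<beta> w1 w2. lie_g2 lie_bracket X Y Z W \<kappa> \<alpha> \<beta> w1 w2) \<or>
        (\<exists>\<alpha> \<beta> w1 w2 \<theta>2. lie_g3 lie_bracket X Y Z W \<alpha> \<beta> w1 w2 \<theta>2) \<or>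
        (\<exists>\<kappa> z2 w1 w2. lie_g4 lie_bracket X Y Z W \<kappa> z2 w1 w2) \<or>
        (\<exists>\<alpha> a \<beta> b r. lie_g5 lie_bracket X Y Z W \<alpha> a \<beta> b r) \<or>
        (\<exists>z1 z2 z3 r \<theta>1 \<theta>2. lie_g6 lie_bracket X Y Z W z1 z2 z3 r \<theta>1 \<theta>2) \<or>
        (\<exists>z2 w1 w2 \<theta>1 \<theta>2. lie_g7 lie_bracket X Y Z W z2 w1 w2 \<theta>1 \<theta>2) \<or>
        (\<exists>z2 z4 w2 r \<theta>1 \<theta>2. lie_g8 lie_bracket X Y Z W z2 z4 w2 r \<theta>1 \<theta>2) \<or>
        (\<exists>z2 z3 z4 \<theta>1 \<theta>2. lie_g9 lie_bracket X Y Z W z2 z3 z4 \<theta>1 \<theta>2) \<or>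
        (\<exists>\<alpha> a \<beta> b. lie_g10 lie_bracket X Y Z W \<alpha> a \<beta> b) \<or>
        (\<exists>z1 z2 z3 w1 \<theta>1 \<theta>2. lie_g11 lie_bracket X Y Z W z1 z2 z3 w1 \<theta>1 \<theta>2) \<or>
        (\<exists>z3 w1 w2 \<theta>1 \<theta>2. lie_g12 lie_bracket X Y Z W z3 w1 w2 \<theta>1 \<theta>2) \<or>
        (\<exists>z3 z4 \<theta>1 \<theta>2. lie_g13 lie_bracket X Y Z W z3 z4 \<theta>1 \<theta>2) \<or>
        (\<exists>z2 z4 w2 \<theta>1 \<theta>2. lie_g14 lie_bracket X Y Z W z2 z4 w2 \<theta>1 \<theta>2) \<or>
        (\<exists>\<alpha> w1 w2. lie_g15 lie_bracket X Y Z W \<alpha> w1 w2) \<or>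
        (\<exists>\<beta> w1 w2 \<theta>1 \<theta>2. lie_g16 lie_bracket X Y Z W \<beta> w1 w2 \<theta>1 \<theta>2) \<or>
        (\<exists>\<alpha> a w1 w2. lie_g17 lie_bracket X Y Z W \<alpha> a w1 w2) \<or>
        (\<exists>\<beta> b z3 z4 \<theta>1 \<theta>2. lie_g18 lie_bracket X Y Z W \<beta> b z3 z4 \<theta>1 \<theta>2) \<or>
        (\<exists>\<alpha> \<beta> w1 w2. lie_g19 lie_bracket X Y Z W \<alpha> \<beta> w1 w2) \<or>
        (\<exists>\<alpha> a \<beta> w1 w2. lie_g20 lie_bracket X Y Z W \<alpha> a \<beta> w1 w2))"
proof -
  interpret conformal_minimal_lie_foliation A mul e iv g nab \<V>
    by unfold_locales (fact assms)+
  show ?thesis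
    using adapted_basis_in_families unfolding in_families_def .
qed

end
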